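(* Let $X$ be a complex torus and let $\mathcal{L}$ be a holomorphic line bundle over $X$. Then there is a group embedding $$\Upsilon_{\mathcal{L}}:\mathbf{S}(\mathcal{L})\hookrightarrow\mathrm{Aut}(Y_{\mathcal{L}})$$ of $\mathbf{S}(\mathcal{L})$ into the group $\mathrm{Aut}(Y_{\mathcal{L}})$ of holomorphic automorphisms of $Y_{\mathcal{L}}=\mathbb{P}(\mathcal{L}\oplus\mathbf{1}_X)$ such that the action map $$\mathbf{S}(\mathcal{L})\times Y_{\mathcal{L}}\to Y_{\mathcal{L}},\quad(\mathfrak{u},\mathfrak{y})\mapsto\Upsilon_{\mathcal{L}}(\mathfrak{u})(\mathfrak{y})$$ is holomorphic. In addition, for every $\mathfrak{u}\in\mathbf{S}(\mathcal{L})$ the automorphism $\Upsilon_{\mathcal{L}}(\mathfrak{u})$ is a lifting of $T_x:X\to X$ with $x=\rho_{\mathcal{L}}(\mathfrak{u})$; that is, $p\circ\Upsilon_{\mathcal{L}}(\mathfrak{u})=T_x\circ p$, where $p:Y_{\mathcal{L}}\to X$ is the bundle projection.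
   Context: A complex torus is a connected compact complex Lie group $X=V/L$, $V$ a complex vector space of finite dimension $g$, $L\subset V$ a discrete subgroup of rank $2g$. For $x\in X$, $T_x:X\to X$, $z\mapsto z+x$. $\mathbf{1}_X=X\times\mathbb{C}$ is the trivial line bundle and $Y_{\mathcal{L}}=\mathbb{P}(\mathcal{L}\oplus\mathbf{1}_X)$ is the $\mathbb{C}\mathbb{P}^1$-bundle over $X$ that is the projectivization of the rank 2 bundle $\mathcal{L}\oplus\mathbf{1}_X$. $\mathbf{S}(\mathcal{L})$ is the group of all holomorphic automorphisms $\mathfrak{u}$ of the total space of $\mathcal{L}$ for which there is $x\in X$ such that $\mathfrak{u}$ is a lifting of $T_x$ and for each $z\in X$ the induced map of fibers $\mathcal{L}_z\to\mathcal{L}_{z+x}$ is a $\mathbb{C}$-linear isomorphism; $\rho_{\mathcal{L}}:\mathbf{S}(\mathcal{L})\to X$ sends $\mathfrak{u}$ to this $x$. Complex Lie group structure on $\mathbf{S}(\mathcal{L})$. By the Appell–Humbert theorem $\mathcal{L}$ is isomorphic to $\mathcal{L}(H,\alpha)$ for a unique pair $(H,\alpha)$, where $H$ is a Hermitian form on $V$ ($\mathbb{C}$-linear in the first argument) such that $E:=\mathrm{Im}\,H$ satisfies $E(L,L)\subset\mathbb{Z}$, and $\alpha:L\to\mathrm{U}(1)$ satisfies $\alpha(l_1+l_2)=(-1)^{E(l_1,l_2)}\alpha(l_1)\alpha(l_2)$. Here $\mathcal{L}(H,\alpha)$ is the quotient of $V\times\mathbb{C}$ by the group $\tilde L$ of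 maps $\mathcal{A}_{H,l}:(v,c)\mapsto(v+l,\alpha(l)e^{\pi H(v,l)+\frac12\pi H(l,l)}c)$, $l\in L$. Let $L_E^{\perp}=\{x\in V: E(x,l)\in\mathbb{Z}\ \forall l\in L\}$, a closed complex Lie subgroup of $V$ with identity component $\ker(H)=\{u\in V:H(u,v)=0\ \forall v\in V\}$. Let $\tilde{\mathfrak{G}}$ be the group of automorphisms $(v,c)\mapsto(v+u,\lambda e^{\pi H(v,u)}c)$ of $V\times\mathbb{C}$ with $(u,\lambda)\in L_E^{\perp}\times\mathbb{C}^{*}$; it is a complex Lie group with the complex structure of $L_E^{\perp}\times\mathbb{C}^{*}$, and $\tilde L$ is a central discrete subgroup of it. The quotient complex Lie group $\mathfrak{G}(H,\alpha)=\tilde{\mathfrak{G}}/\tilde L$ acts faithfully on $\mathcal{L}(H,\alpha)$ and, as a subgroup of automorphisms of its total space, equals $\mathbf{S}(\mathcal{L}(H,\alpha))$. The structure on $\mathbf{S}(\mathcal{L})$ is the one for which $\mathbf{S}(\mathcal{L})\to\mathfrak{G}(H,\alpha)$, $\mathfrak{u}\mapsto\psi\mathfrak{u}\psi^{-1}$, is an isomorphism of complex Lie groups, where $\psi:\mathcal{L}\cong\mathcal{L}(H,\alpha)$ is any isomorphism of holomorphic line bundles (the map does not depend on the choice of $\psi$). *)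

theory Defs
  imports "HOL-Analysis.Analysis" "HOL-Library.Set_Algebras" "HOL-Algebra.Bij"
begin

section \<open>Finite-dimensional complex vector spaces\<close>

class complex_normed_vector = real_normed_vector +
  fixes scaleC :: "complex \<Rightarrow> 'a \<Rightarrow> 'a"  (infixr \<open>*\<^sub>C\<close> 75)
  assumes scaleC_add_right: "c *\<^sub>C (x + y) = c *\<^sub>C x + c *\<^sub>C y"
    and scaleC_add_left: "(c + d) *\<^sub>C x = c *\<^sub>C x + d *\<^sub>C x"
    and scaleC_scaleC: "c *\<^sub>C (d *\<^sub>C x) = (c * d) *\<^sub>C x"
    and scaleC_of_real: "complex_of_real r *\<^sub>C x = r *\<^sub>R x"
    and norm_scaleC: "norm (c *\<^sub>C x) = cmod c * norm x"

lemma scaleC_one: "1 *\<^sub>C x = (x :: 'a::complex_normed_vector)"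
  using scaleC_of_real[of 1 x] by simp

global_interpretation complex_vector: vector_space "scaleC :: complex \<Rightarrow> 'a \<Rightarrow> 'a::complex_normed_vector"
  defines cspan_raw_def: cspan = complex_vector.span
    and cdim_raw_def: cdim = complex_vector.dim
    and csubspace_raw_def: csubspace = complex_vector.subspace
    and cdependent_raw_def: cdependent = complex_vector.dependent
    and cextend_basis_raw_def: cextend_basis = complex_vector.extend_basis
    and crepresentation_raw_def: crepresentation = complex_vector.representation
  by unfold_locales (simp_all add: scaleC_add_right scaleC_add_left scaleC_scaleC scaleC_one)

instantiation complex :: complex_normed_vector
begin
definition scaleC_complex :: "complex \<Rightarrow> complex \<Rightarrow> complex" where
  "scaleC_complex c x = c * x"
instance
  by standard (simp_all add: scaleC_complex_def algebra_simps scaleR_conv_of_real norm_mult)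
end

instantiation prod :: (complex_normed_vector, complex_normed_vector) complex_normed_vector
begin
definition scaleC_prod :: "complex \<Rightarrow> 'a \<times> 'b \<Rightarrow> 'a \<times> 'b" where
  "scaleC_prod c x = (c *\<^sub>C fst x, c *\<^sub>C snd x)"
instance
proof
  fix c :: complex and x :: "'a \<times> 'b"
  have "norm (c *\<^sub>C x) = sqrt ((cmod c)\<^sup>2 * ((norm (fst x))\<^sup>2 + (norm (snd x))\<^sup>2))"
    by (simp add: scaleC_prod_def norm_prod_def norm_scaleC power_mult_distrib distrib_left)
  then show "norm (c *\<^sub>C x) = cmod c * norm x"
    by (simp add: norm_prod_def real_sqrt_mult)
qed (simp_all add: scaleC_prod_def scaleC_add_right scaleC_add_left scaleC_scaleC scaleC_of_real
       prod_eq_iff)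
end

text \<open>The norm only serves to provide the topology, on which all norms agree in finite dimension.
  The zero space is not excluded.\<close>

class fin_dim_complex_vector = complex_normed_vector +
  assumes finite_dimensional: "\<exists>B. finite B \<and> (\<forall>x. \<exists>c. x = (\<Sum>b\<in>B. c b *\<^sub>C b))"

lemma ex_finite_cspan: "\<exists>B. finite B \<and> cspan B = (UNIV :: 'a::fin_dim_complex_vector set)"
proof -
  obtain B :: "'a set" where B: "finite B" "\<forall>x. \<exists>c. x = (\<Sum>b\<in>B. c b *\<^sub>C b)"
    using finite_dimensional by blast
  have "x \<in> cspan B" for x
  proof -
    obtain c where x: "x = (\<Sum>b\<in>B. c b *\<^sub>C b)" using B by blast
    show ?thesis unfolding x
      by (intro complex_vector.span_sum complex_vector.span_scale) (rule complex_vector.span_base)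
  qed
  then show ?thesis using B by (intro exI[of _ B]) auto
qed

lemma finite_cspan_imp:
  assumes "finite B" "cspan B = (UNIV :: 'a::complex_normed_vector set)"
  shows "\<exists>B. finite B \<and> (\<forall>x::'a. \<exists>c. x = (\<Sum>b\<in>B. c b *\<^sub>C b))"
proof -
  have "\<exists>c. x = (\<Sum>b\<in>B. c b *\<^sub>C b)" for x
  proof -
    have "x \<in> range (\<lambda>c. \<Sum>b\<in>B. c b *\<^sub>C b)"
      unfolding complex_vector.span_finite[OF assms(1), symmetric] assms(2) by (rule UNIV_I)
    then show ?thesis by (rule imageE) (rule exI)
  qed
  then show ?thesis using assms(1) by blast
qed

instance complex :: fin_dim_complex_vector
proof
  have "c \<in> cspan {1}" for c :: complex
    using complex_vector.span_scale[OF complex_vector.span_base[of "1::complex" "{1}"], of c]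
    by (simp add: scaleC_complex_def)
  then show "\<exists>B. finite B \<and> (\<forall>x::complex. \<exists>c. x = (\<Sum>b\<in>B. c b *\<^sub>C b))"
    by (intro finite_cspan_imp[of "{1}"]) auto
qed

instance prod :: (fin_dim_complex_vector, fin_dim_complex_vector) fin_dim_complex_vector
proof
  obtain A :: "'a set" where A: "finite A" "cspan A = UNIV" using ex_finite_cspan by blast
  obtain B :: "'b set" where B: "finite B" "cspan B = UNIV" using ex_finite_cspan by blast
  let ?C = "(\<lambda>a. (a, 0::'b)) ` A \<union> (\<lambda>b. (0::'a, b)) ` B"
  have l: "(x, 0) \<in> cspan ?C" for x
  proof -
    have "x \<in> cspan A" using A by simp
    then show ?thesis
    proof (induction rule: complex_vector.span_induct_alt)
      case base
      show ?case using complex_vector.span_zero[of ?C] by (simp add: zero_prod_def)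
    next
      case (step c u y)
      have "c *\<^sub>C (u, 0::'b) + (y, 0) \<in> cspan ?C"
        using step by (intro complex_vector.span_add complex_vector.span_scale)
                      (auto intro: complex_vector.span_base)
      then show ?case by (simp add: scaleC_prod_def)
    qed
  qed
  have r: "(0, x) \<in> cspan ?C" for x
  proof -
    have "x \<in> cspan B" using B by simp
    then show ?thesis
    proof (induction rule: complex_vector.span_induct_alt)
      case base
      show ?case using complex_vector.span_zero[of ?C] by (simp add: zero_prod_def)
    next
      case (step c u y)
      have "c *\<^sub>C (0::'a, u) + (0, y) \<in> cspan ?C"
        using step by (intro complex_vector.span_add complex_vector.span_scale)
                      (auto intro: complex_vector.span_base)
      then show ?case by (simp add: scaleC_prod_def)
    qed
  qed
  have "p \<in> cspan ?C" for p :: "'a \<times> 'b"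
    using complex_vector.span_add[OF l[of "fst p"] r[of "snd p"]] by simp
  then show "\<exists>B. finite B \<and> (\<forall>x::'a \<times> 'b. \<exists>c. x = (\<Sum>b\<in>B. c b *\<^sub>C b))"
    using A B by (intro finite_cspan_imp[of ?C]) auto
qed

text \<open>Meant for sets \<open>S\<close> that are relatively open in a complex subspace \<open>W\<close>.  If \<open>W\<close> is proper,
  the derivative is only determined on \<open>W\<close>, and the condition says that it is complex linear
  there: a complex linear map on \<open>W\<close> extends to the whole space.\<close>

definition holo_on ::
  "('v::complex_normed_vector \<Rightarrow> 'w::complex_normed_vector) \<Rightarrow> 'v set \<Rightarrow> bool" where
  "holo_on f S \<longleftrightarrow>
     (\<forall>x\<in>S. \<exists>f'. (f has_derivative f') (at x within S) \<and> (\<forall>c v. f' (c *\<^sub>C v) = c *\<^sub>C f' v))"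


section \<open>Complex manifolds\<close>

text \<open>A chart \<open>(W, D, \<phi>)\<close> maps its domain \<open>D\<close> bijectively onto a relatively open subset of the
  complex subspace \<open>W\<close> of \<open>'v\<close>.  Usually \<open>W\<close> is \<open>UNIV\<close>; proper subspaces are needed for the
  group $\mathbf{S}(\mathcal{L})$, whose dimension depends on $\mathcal{L}$.  The topology is the
  one given by the charts.\<close>

type_synonym ('p, 'v) chart = "'v set \<times> 'p set \<times> ('p \<Rightarrow> 'v)"

record ('p, 'v) cmfd =
  pts :: "'p set"
  charts :: "('p, 'v) chart set"

definition mfd_open :: "('p, 'v::complex_normed_vector) cmfd \<Rightarrow> 'p set \<Rightarrow> bool" where
  "mfd_open M U \<longleftrightarrow> U \<subseteq> pts M \<and>
     (\<forall>(W, D, \<phi>) \<in> charts M. openin (top_of_set W) (\<phi> ` (D \<inter> U)))"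

text \<open>Openness of the sets on which the coordinate expressions live is continuity of \<open>f\<close>.\<close>

definition holo_map ::
  "('p, 'v::complex_normed_vector) cmfd \<Rightarrow> ('q, 'w::complex_normed_vector) cmfd \<Rightarrow> ('p \<Rightarrow> 'q) \<Rightarrow> bool"
  where
  "holo_map M N f \<longleftrightarrow> f \<in> pts M \<rightarrow> pts N \<and>
     (\<forall>(W, D, \<phi>) \<in> charts M. \<forall>(W', D', \<phi>') \<in> charts N.
        openin (top_of_set W) (\<phi> ` (D \<inter> f -` D')) \<and>
        holo_on (\<phi>' \<circ> f \<circ> inv_into D \<phi>) (\<phi> ` (D \<inter> f -` D')))"

definition holo_fun_on ::
  "('p, 'v::complex_normed_vector) cmfd \<Rightarrow> 'p set \<Rightarrow> ('p \<Rightarrow> 'w::complex_normed_vector) \<Rightarrow> bool" where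
  "holo_fun_on M U f \<longleftrightarrow>
     (\<forall>(W, D, \<phi>) \<in> charts M. holo_on (f \<circ> inv_into D \<phi>) (\<phi> ` (D \<inter> U)))"

definition Aut :: "('p, 'v::complex_normed_vector) cmfd \<Rightarrow> ('p \<Rightarrow> 'p) monoid" where
  "Aut M = (BijGroup (pts M))
     \<lparr>carrier := {f \<in> Bij (pts M). holo_map M M f \<and> holo_map M M (inv_into (pts M) f)}\<rparr>"

definition prod_mfd :: "('p, 'v) cmfd \<Rightarrow> ('q, 'w) cmfd \<Rightarrow> ('p \<times> 'q, 'v \<times> 'w) cmfd" where
  "prod_mfd M N = \<lparr>pts = pts M \<times> pts N,
     charts = {(W \<times> W', D \<times> D', map_prod \<phi> \<phi>') | W D \<phi> W' D' \<phi>'.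
                (W, D, \<phi>) \<in> charts M \<and> (W', D', \<phi>') \<in> charts N}\<rparr>"

text \<open>The structure on the image of \<open>M\<close> under \<open>q\<close> for which \<open>q\<close> is locally biholomorphic; used
  for quotients by discrete groups and for transport along bijections.\<close>

definition push_mfd ::
  "('p, 'v::complex_normed_vector) cmfd \<Rightarrow> ('p \<Rightarrow> 'q) \<Rightarrow> ('q, 'v) cmfd" where
  "push_mfd M q = \<lparr>pts = q ` pts M,
     charts = {(W, q ` N, \<phi> \<circ> inv_into N q) | W D \<phi> N.
                (W, D, \<phi>) \<in> charts M \<and> N \<subseteq> D \<and> openin (top_of_set W) (\<phi> ` N) \<and> inj_on q N}\<rparr>"

definition space_mfd :: "('v, 'v::complex_normed_vector) cmfd" where
  "space_mfd = \<lparr>pts = UNIV, charts = {(UNIV, UNIV, id)}\<rparr>"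

definition cstar_mfd :: "(complex, complex) cmfd" where
  "cstar_mfd = \<lparr>pts = - {0}, charts = {(UNIV, - {0}, id)}\<rparr>"


section \<open>Complex tori\<close>

abbreviation zscale :: "int \<Rightarrow> 'v \<Rightarrow> 'v::real_vector" where
  "zscale k x \<equiv> of_int k *\<^sub>R x"

lemma module_zscale: "module (zscale :: int \<Rightarrow> 'v \<Rightarrow> 'v::real_vector)"
  by unfold_locales (simp_all add: scaleR_add_right scaleR_add_left)

text \<open>A discrete subgroup of \<open>V\<close> that is free of rank \<open>2g\<close>, \<open>g\<close> being the complex dimension.\<close>

definition torus_lattice :: "'v::fin_dim_complex_vector set \<Rightarrow> bool" where
  "torus_lattice L \<longleftrightarrow> discrete L \<and>
     (\<exists>B. finite B \<and> card B = 2 * cdim (UNIV :: 'v set) \<and>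
        \<not> module.dependent zscale B \<and> module.span zscale B = L)"

definition torus :: "'v::fin_dim_complex_vector set \<Rightarrow> ('v set, 'v) cmfd" where
  "torus L = push_mfd space_mfd (\<lambda>v. v +o L)"

text \<open>Cosets are added as sets.\<close>

definition translation :: "'v::fin_dim_complex_vector set \<Rightarrow> 'v set \<Rightarrow> 'v set" where
  "translation x z = z + x"


section \<open>Holomorphic vector bundles\<close>

text \<open>A local trivialization over \<open>U\<close> is represented by its component \<open>t\<close> in the model fibre
  \<open>'f\<close>: it is \<open>e \<mapsto> (bproj e, t e)\<close>.\<close>

record ('e, 'x, 'f) vbundle =
  total :: "'e set"
  bproj :: "'e \<Rightarrow> 'x"
  fadd :: "'e \<Rightarrow> 'e \<Rightarrow> 'e"
  fsmul :: "complex \<Rightarrow> 'e \<Rightarrow> 'e"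
  trivs :: "('x set \<times> ('e \<Rightarrow> 'f)) set"

definition fiber :: "('e, 'x, 'f) vbundle \<Rightarrow> 'x \<Rightarrow> 'e set" where
  "fiber E x = {e \<in> total E. bproj E e = x}"

definition holomorphic_bundle ::
  "('x, 'v::complex_normed_vector) cmfd \<Rightarrow> ('e, 'x, 'f::complex_normed_vector) vbundle \<Rightarrow> bool" where
  "holomorphic_bundle X E \<longleftrightarrow>
     bproj E \<in> total E \<rightarrow> pts X \<and>
     (\<forall>x\<in>pts X. \<forall>a\<in>fiber E x. \<forall>b\<in>fiber E x. \<forall>c.
        fadd E a b \<in> fiber E x \<and> fsmul E c a \<in> fiber E x) \<and>
     (\<forall>(U, t) \<in> trivs E. mfd_open X U \<and>
        (\<forall>x\<in>U. bij_betw t (fiber E x) UNIV \<and>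
          (\<forall>a\<in>fiber E x. \<forall>b\<in>fiber E x. \<forall>c.
             t (fadd E a b) = t a + t b \<and> t (fsmul E c a) = c *\<^sub>C t a))) \<and>
     (\<forall>x\<in>pts X. \<exists>(U, t) \<in> trivs E. x \<in> U) \<and>
     (\<forall>(U, t) \<in> trivs E. \<forall>(U', t') \<in> trivs E. \<exists>g.
        (\<forall>x\<in>U \<inter> U'. \<forall>e\<in>fiber E x. t' e = g x (t e)) \<and>
        (\<forall>w. holo_fun_on X (U \<inter> U') (\<lambda>x. g x w)))"

text \<open>A line bundle is a vector bundle with model fibre \<open>\<complex>\<close>.\<close>

abbreviation holomorphic_line_bundle ::
  "('x, 'v::complex_normed_vector) cmfd \<Rightarrow> ('e, 'x, complex) vbundle \<Rightarrow> bool" where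
  "holomorphic_line_bundle \<equiv> holomorphic_bundle"

definition total_mfd :: "('x, 'v) cmfd \<Rightarrow> ('e, 'x, 'f) vbundle \<Rightarrow> ('e, 'v \<times> 'f) cmfd" where
  "total_mfd X E = \<lparr>pts = total E,
     charts = {(W \<times> UNIV, {e \<in> total E. bproj E e \<in> D \<inter> U}, \<lambda>e. (\<phi> (bproj E e), t e)) | W D \<phi> U t.
                (W, D, \<phi>) \<in> charts X \<and> (U, t) \<in> trivs E}\<rparr>"

text \<open>\<open>u\<close> restricts to a linear isomorphism between the fibre of \<open>E\<close> over \<open>x\<close> and the fibre of
  \<open>F\<close> over \<open>y\<close>.\<close>

definition fiber_iso ::
  "('e, 'x, 'f) vbundle \<Rightarrow> ('d, 'y, 'g) vbundle \<Rightarrow> ('e \<Rightarrow> 'd) \<Rightarrow> 'x \<Rightarrow> 'y \<Rightarrow> bool" where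
  "fiber_iso E F u x y \<longleftrightarrow> bij_betw u (fiber E x) (fiber F y) \<and>
     (\<forall>a\<in>fiber E x. \<forall>b\<in>fiber E x. \<forall>c.
        u (fadd E a b) = fadd F (u a) (u b) \<and> u (fsmul E c a) = fsmul F c (u a))"

definition bundle_iso ::
  "('x, 'v::complex_normed_vector) cmfd \<Rightarrow> ('e, 'x, 'f::complex_normed_vector) vbundle \<Rightarrow>
   ('d, 'x, 'g::complex_normed_vector) vbundle \<Rightarrow> ('e \<Rightarrow> 'd) \<Rightarrow> bool" where
  "bundle_iso X E F \<psi> \<longleftrightarrow> bij_betw \<psi> (total E) (total F) \<and>
     holo_map (total_mfd X E) (total_mfd X F) \<psi> \<and>
     holo_map (total_mfd X F) (total_mfd X E) (inv_into (total E) \<psi>) \<and>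
     (\<forall>x\<in>pts X. fiber_iso E F \<psi> x x)"

definition trivial_bundle :: "('x, 'v) cmfd \<Rightarrow> ('x \<times> complex, 'x, complex) vbundle" where
  "trivial_bundle X = \<lparr>total = pts X \<times> UNIV, bproj = fst,
     fadd = (\<lambda>(x, a) (_, b). (x, a + b)), fsmul = (\<lambda>c (x, a). (x, c * a)),
     trivs = {(pts X, snd)}\<rparr>"

definition direct_sum ::
  "('e, 'x, 'f) vbundle \<Rightarrow> ('d, 'x, 'g) vbundle \<Rightarrow> ('e \<times> 'd, 'x, 'f \<times> 'g) vbundle" where
  "direct_sum E F = \<lparr>total = {(a, b). a \<in> total E \<and> b \<in> total F \<and> bproj E a = bproj F b},
     bproj = (\<lambda>(a, b). bproj E a),
     fadd = (\<lambda>(a, b) (a', b'). (fadd E a a', fadd F b b')),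
     fsmul = (\<lambda>c (a, b). (fsmul E c a, fsmul F c b)),
     trivs = {(U \<inter> U', \<lambda>(a, b). (t a, t' b)) | U t U' t'. (U, t) \<in> trivs E \<and> (U', t') \<in> trivs F}\<rparr>"

text \<open>The projectivization of a bundle of rank 2.  Its points are the one-dimensional subspaces
  of the fibres; note that \<open>e\<close> is nonzero iff \<open>fsmul E 0 e \<noteq> e\<close>.  If a trivialization maps
  \<open>m\<close> to the line \<open>[a : b]\<close>, the two affine coordinates of \<open>m\<close> are \<open>a / b\<close> and \<open>b / a\<close>, i.e. the
  \<open>c\<close> for which the image contains \<open>(c, 1)\<close> and \<open>(1, c)\<close>, respectively.\<close>

definition proj_lines :: "('e, 'x, complex \<times> complex) vbundle \<Rightarrow> 'e set set" where
  "proj_lines E = {range (\<lambda>c. fsmul E c e) | e. e \<in> total E \<and> fsmul E 0 e \<noteq> e}"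

definition proj_base :: "('e, 'x, complex \<times> complex) vbundle \<Rightarrow> 'e set \<Rightarrow> 'x" where
  "proj_base E m = (THE x. m \<subseteq> fiber E x)"

definition projectivization ::
  "('x, 'v) cmfd \<Rightarrow> ('e, 'x, complex \<times> complex) vbundle \<Rightarrow> ('e set, 'v \<times> complex) cmfd" where
  "projectivization X E = \<lparr>pts = proj_lines E,
     charts = (\<Union>(W, D, \<phi>) \<in> charts X. \<Union>(U, t) \<in> trivs E. \<Union>s \<in> {\<lambda>c. (c, 1), \<lambda>c. (1, c)}.
       {(W \<times> UNIV,
         {m \<in> proj_lines E. proj_base E m \<in> D \<inter> U \<and> (\<exists>c. s c \<in> t ` m)},
         \<lambda>m. (\<phi> (proj_base E m), THE c. s c \<in> t ` m))})\<rparr>"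


section \<open>The line bundle $\mathcal{L}(H,\alpha)$ and the group $\mathfrak{G}(H,\alpha)$\<close>

definition hermitian_form :: "('v::complex_normed_vector \<Rightarrow> 'v \<Rightarrow> complex) \<Rightarrow> bool" where
  "hermitian_form H \<longleftrightarrow>
     (\<forall>x y z. H (x + y) z = H x z + H y z) \<and>
     (\<forall>c x y. H (c *\<^sub>C x) y = c * H x y) \<and>
     (\<forall>x y. H y x = cnj (H x y))"

definition AH_data ::
  "'v::complex_normed_vector set \<Rightarrow> ('v \<Rightarrow> 'v \<Rightarrow> complex) \<Rightarrow> ('v \<Rightarrow> complex) \<Rightarrow> bool" where
  "AH_data L H \<alpha> \<longleftrightarrow> hermitian_form H \<and>
     (\<forall>l\<in>L. \<forall>m\<in>L. Im (H l m) \<in> \<int>) \<and>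
     (\<forall>l\<in>L. cmod (\<alpha> l) = 1) \<and>
     (\<forall>l\<in>L. \<forall>m\<in>L. \<alpha> (l + m) = (-1) powi \<lfloor>Im (H l m)\<rfloor> * \<alpha> l * \<alpha> m)"

definition AH_map ::
  "('v::complex_normed_vector \<Rightarrow> 'v \<Rightarrow> complex) \<Rightarrow> ('v \<Rightarrow> complex) \<Rightarrow> 'v \<Rightarrow>
   'v \<times> complex \<Rightarrow> 'v \<times> complex" where
  "AH_map H \<alpha> l = (\<lambda>(v, c). (v + l, \<alpha> l * exp (of_real pi * H v l + of_real pi / 2 * H l l) * c))"

definition AH_orbit ::
  "'v::complex_normed_vector set \<Rightarrow> ('v \<Rightarrow> 'v \<Rightarrow> complex) \<Rightarrow> ('v \<Rightarrow> complex) \<Rightarrow>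
   'v \<times> complex \<Rightarrow> ('v \<times> complex) set" where
  "AH_orbit L H \<alpha> p = (\<lambda>l. AH_map H \<alpha> l p) ` L"

text \<open>The orbit of \<open>(v, c)\<close> is the graph of a function on the coset \<open>v + L\<close>.  The base point of the
  orbit is this coset, and the vector space operations are pointwise.\<close>

definition AH_bundle ::
  "'v::complex_normed_vector set \<Rightarrow> ('v \<Rightarrow> 'v \<Rightarrow> complex) \<Rightarrow> ('v \<Rightarrow> complex) \<Rightarrow>
   (('v \<times> complex) set, 'v set, complex) vbundle" where
  "AH_bundle L H \<alpha> = \<lparr>total = range (AH_orbit L H \<alpha>),
     bproj = (\<lambda>S. fst ` S),
     fadd = (\<lambda>S T. {(v, a + b) | v a b. (v, a) \<in> S \<and> (v, b) \<in> T}),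
     fsmul = (\<lambda>c S. {(v, c * a) | v a. (v, a) \<in> S}),
     trivs = {((\<lambda>v. v +o L) ` U, \<lambda>S. THE c. \<exists>v\<in>U. (v, c) \<in> S) | U.
                open U \<and> inj_on (\<lambda>v. v +o L) U}\<rparr>"

definition herm_ker :: "('v \<Rightarrow> 'v \<Rightarrow> complex) \<Rightarrow> 'v set" where
  "herm_ker H = {u. \<forall>v. H u v = 0}"

definition perp :: "'v set \<Rightarrow> ('v \<Rightarrow> 'v \<Rightarrow> complex) \<Rightarrow> 'v set" where
  "perp L H = {x. \<forall>l\<in>L. Im (H x l) \<in> \<int>}"

text \<open>The components of the closed subgroup \<open>perp L H\<close> are the cosets of \<open>herm_ker H\<close>.\<close>

definition perp_mfd ::
  "'v::complex_normed_vector set \<Rightarrow> ('v \<Rightarrow> 'v \<Rightarrow> complex) \<Rightarrow> ('v, 'v) cmfd" where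
  "perp_mfd L H = \<lparr>pts = perp L H,
     charts = {(herm_ker H, u\<^sub>0 +o herm_ker H, \<lambda>u. u - u\<^sub>0) | u\<^sub>0. u\<^sub>0 \<in> perp L H}\<rparr>"

definition heis_map ::
  "('v::complex_normed_vector \<Rightarrow> 'v \<Rightarrow> complex) \<Rightarrow> 'v \<times> complex \<Rightarrow> 'v \<times> complex \<Rightarrow> 'v \<times> complex" where
  "heis_map H = (\<lambda>(u, r) (v, c). (v + u, r * exp (of_real pi * H v u) * c))"

definition heis_tilde_mfd ::
  "'v::complex_normed_vector set \<Rightarrow> ('v \<Rightarrow> 'v \<Rightarrow> complex) \<Rightarrow>
   ('v \<times> complex \<Rightarrow> 'v \<times> complex, 'v \<times> complex) cmfd" where
  "heis_tilde_mfd L H = push_mfd (prod_mfd (perp_mfd L H) cstar_mfd) (heis_map H)"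

text \<open>The quotient $\mathfrak{G}(H,\alpha)$ is realized by its faithful action on the total space
  of $\mathcal{L}(H,\alpha)$: two elements of $\tilde{\mathfrak{G}}$ induce the same map on orbits
  iff they are in the same coset of the discrete central subgroup $\tilde L$ of all \<open>AH_map H \<alpha> l\<close>
  with \<open>l \<in> L\<close>.\<close>

definition heis_mfd ::
  "'v::complex_normed_vector set \<Rightarrow> ('v \<Rightarrow> 'v \<Rightarrow> complex) \<Rightarrow> ('v \<Rightarrow> complex) \<Rightarrow>
   (('v \<times> complex) set \<Rightarrow> ('v \<times> complex) set, 'v \<times> complex) cmfd" where
  "heis_mfd L H \<alpha> = push_mfd (heis_tilde_mfd L H) (\<lambda>g. \<lambda>S\<in>total (AH_bundle L H \<alpha>). g ` S)"


section \<open>The group $\mathbf{S}(\mathcal{L})$ and the bundle $Y_{\mathcal{L}}$\<close>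

definition S_group ::
  "'v::fin_dim_complex_vector set \<Rightarrow> ('e, 'v set, complex) vbundle \<Rightarrow> ('e \<Rightarrow> 'e) monoid" where
  "S_group L E = (BijGroup (total E))
     \<lparr>carrier := {u \<in> carrier (Aut (total_mfd (torus L) E)).
        \<exists>x\<in>pts (torus L).
          (\<forall>e\<in>total E. bproj E (u e) = translation x (bproj E e)) \<and>
          (\<forall>z\<in>pts (torus L). fiber_iso E E u z (translation x z))}\<rparr>"

definition rho ::
  "'v::fin_dim_complex_vector set \<Rightarrow> ('e, 'v set, complex) vbundle \<Rightarrow> ('e \<Rightarrow> 'e) \<Rightarrow> 'v set" where
  "rho L E u = (THE x. x \<in> pts (torus L) \<and>
     (\<forall>e\<in>total E. bproj E (u e) = translation x (bproj E e)))"

definition conj_map :: "('e, 'x, 'f) vbundle \<Rightarrow> ('d, 'x, 'f) vbundle \<Rightarrow> ('e \<Rightarrow> 'd) \<Rightarrow>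
    ('e \<Rightarrow> 'e) \<Rightarrow> ('d \<Rightarrow> 'd)" where
  "conj_map E F \<psi> u = (\<lambda>s\<in>total F. \<psi> (u (inv_into (total E) \<psi> s)))"

text \<open>The structure transported from $\mathfrak{G}(H,\alpha)$ along $\mathfrak{u} \mapsto
  \psi\mathfrak{u}\psi^{-1}$.  By the Appell--Humbert theorem at least one triple \<open>(H, \<alpha>, \<psi>)\<close> exists;
  since \<open>(H, \<alpha>)\<close> is unique and \<open>\<psi>\<close> is unique up to a nonzero constant, all triples contribute the
  same charts.\<close>

definition S_mfd ::
  "'v::fin_dim_complex_vector set \<Rightarrow> ('e, 'v set, complex) vbundle \<Rightarrow>
   ('e \<Rightarrow> 'e, 'v \<times> complex) cmfd" where
  "S_mfd L E = \<lparr>pts = carrier (S_group L E),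
     charts = {(W, {u \<in> carrier (S_group L E). conj_map E (AH_bundle L H \<alpha>) \<psi> u \<in> D},
                 \<lambda>u. \<phi> (conj_map E (AH_bundle L H \<alpha>) \<psi> u)) | H \<alpha> \<psi> W D \<phi>.
                AH_data L H \<alpha> \<and> bundle_iso (torus L) E (AH_bundle L H \<alpha>) \<psi> \<and>
                (W, D, \<phi>) \<in> charts (heis_mfd L H \<alpha>)}\<rparr>"

definition Y_bundle ::
  "'v::fin_dim_complex_vector set \<Rightarrow> ('e, 'v set, complex) vbundle \<Rightarrow>
   ('e \<times> ('v set \<times> complex), 'v set, complex \<times> complex) vbundle" where
  "Y_bundle L E = direct_sum E (trivial_bundle (torus L))"

definition Y_mfd ::
  "'v::fin_dim_complex_vector set \<Rightarrow> ('e, 'v set, complex) vbundle \<Rightarrow>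
   (('e \<times> ('v set \<times> complex)) set, 'v \<times> complex) cmfd" where
  "Y_mfd L E = projectivization (torus L) (Y_bundle L E)"

definition Y_proj ::
  "'v::fin_dim_complex_vector set \<Rightarrow> ('e, 'v set, complex) vbundle \<Rightarrow>
   ('e \<times> ('v set \<times> complex)) set \<Rightarrow> 'v set" where
  "Y_proj L E = proj_base (Y_bundle L E)"

end

theory Submission
  imports Defs
begin

text \<open>An element \<open>u\<close> of $\mathbf{S}(\mathcal{L})$ acts on $\mathcal{L}\oplus\mathbf{1}_X$ by
  \<open>(e, (x, c)) \<mapsto> (u e, (T x, c))\<close>, and \<open>\<Upsilon> u\<close> is the induced map on lines.  In local trivializations
  \<open>u\<close> is multiplication by a nowhere vanishing function \<open>h\<close> in the fibres, so in affine fibre coordinates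
  \<open>\<Upsilon> u\<close> is one of \<open>c h\<close>, \<open>1 / (c h)\<close>, \<open>h / c\<close>, \<open>c / h\<close>.  Hence the action on $Y_{\mathcal{L}}$ is holomorphic
  as soon as the action on $\mathcal{L}$ is.  A chart of $\mathbf{S}(\mathcal{L})$ comes with an isomorphism
  $\psi:\mathcal{L}\cong\mathcal{L}(H,\alpha)$, which reduces the latter to the explicit formula
  $(v,c)\mapsto(v+u,\,r e^{\pi H(v,u)}c)$; in particular the existence of $(H,\alpha)$ plays no role.\<close>

section \<open>Calculus of holomorphic maps on relatively open sets\<close>

text \<open>\<open>holo_map\<close> speaks of every pair of charts, and a chart of S(L) takes values
  in a subspace of V x C that may be proper. Derivatives are therefore taken within relatively open
  sets, and holomorphy is checked near one point at a time. The factor h is not built from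
  transition functions: it is the fibre coordinate of the image of the vector with fibre coordinate
  1. So it inherits holomorphy from the action on the total space by substituting a constant, and it
  has no zeros because an injective homogeneous map keeps nonzero vectors nonzero. This is carried
  out for families over an arbitrary manifold: the family over a point yields holomorphy of each
  automorphism and of its inverse, the family over G(H,\<alpha>) the joint statement. In the
  explicit formula, passing between local inverses of V -> X costs a lattice vector, which can be
  frozen near a given point. The trivial summand is what makes the homomorphism injective: the line
  through (e, 1) remembers e, whereas P(L) alone would be X. Continuity of H in its first argument
  has to be extracted from finite dimension.\<close>

lemma holo_on_subset: "holo_on f S \<Longrightarrow> T \<subseteq> S \<Longrightarrow> holo_on f T"
  unfolding holo_on_def by (blast intro: has_derivative_subset)

lemma holo_on_cong:
  assumes "\<And>x. x \<in> S \<Longrightarrow> f x = g x"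
  shows "holo_on f S \<longleftrightarrow> holo_on g S"
proof -
  have "(f has_derivative f') (at x within S) \<longleftrightarrow> (g has_derivative f') (at x within S)"
    if "x \<in> S" for x f'
    by (intro iffI; rule has_derivative_transform[OF that]; simp add: assms that)
  then show ?thesis unfolding holo_on_def by simp
qed

lemma holo_on_imp_continuous_on: "holo_on f S \<Longrightarrow> continuous_on S f"
  unfolding holo_on_def continuous_on_eq_continuous_within
  by (blast intro: has_derivative_continuous)

lemma holo_on_compose:
  assumes "holo_on f S" "holo_on g T" "f ` S \<subseteq> T"
  shows "holo_on (\<lambda>x. g (f x)) S"
  unfolding holo_on_def
proof
  fix x assume x: "x \<in> S"
  obtain f' where f': "(f has_derivative f') (at x within S)" "\<And>c v. f' (c *\<^sub>C v) = c *\<^sub>C f' v"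
    using assms(1) x unfolding holo_on_def by blast
  have "f x \<in> T" using x assms(3) by blast
  then obtain g' where g': "(g has_derivative g') (at (f x) within T)" "\<And>c v. g' (c *\<^sub>C v) = c *\<^sub>C g' v"
    using assms(2) unfolding holo_on_def by blast
  have "((\<lambda>x. g (f x)) has_derivative (\<lambda>v. g' (f' v))) (at x within S)"
    by (rule has_derivative_in_compose[OF f'(1) has_derivative_subset[OF g'(1) assms(3)]])
  then show "\<exists>f'. ((\<lambda>x. g (f x)) has_derivative f') (at x within S) \<and> (\<forall>c v. f' (c *\<^sub>C v) = c *\<^sub>C f' v)"
    using f'(2) g'(2) by (intro exI[of _ "\<lambda>v. g' (f' v)"]) simp
qed

text \<open>\<open>S\<close> and \<open>Q\<close> lie in the same \<open>W\<close> and
  \<open>Q\<close> is relatively open there, so near \<open>x\<close> the set \<open>S\<close> is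
  contained in \<open>Q\<close>. A derivative within \<open>Q\<close> is then also one within
  \<open>S\<close>.\<close>

lemma holo_on_local:
  assumes "S \<subseteq> W"
    and "\<And>x. x \<in> S \<Longrightarrow> \<exists>Q. openin (top_of_set W) Q \<and> x \<in> Q \<and> holo_on f Q"
  shows "holo_on f S"
  unfolding holo_on_def
proof
  fix x assume x: "x \<in> S"
  obtain Q where Q: "openin (top_of_set W) Q" "x \<in> Q" "holo_on f Q"
    using assms(2)[OF x] by blast
  obtain T where T: "open T" "Q = W \<inter> T" using Q(1) openin_open by blast
  obtain f' where f': "(f has_derivative f') (at x within Q)" "\<forall>c v. f' (c *\<^sub>C v) = c *\<^sub>C f' v"
    using Q unfolding holo_on_def by blast
  have "(f has_derivative f') (at x within S \<inter> T)"
    using f'(1) T(2) assms(1) by (auto intro: has_derivative_subset)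
  moreover have "at x within S \<inter> T = at x within S"
    using T(1) Q(2) T(2) by (intro at_within_nhd[of x T]) auto
  ultimately show "\<exists>f'. (f has_derivative f') (at x within S) \<and> (\<forall>c v. f' (c *\<^sub>C v) = c *\<^sub>C f' v)"
    using f'(2) by auto
qed

lemma holo_on_linear:
  assumes "bounded_linear f" "\<And>c v. f (c *\<^sub>C v) = c *\<^sub>C f v"
  shows "holo_on f S"
  unfolding holo_on_def using bounded_linear_imp_has_derivative[OF assms(1)] assms(2) by (intro ballI exI[of _ f] conjI allI)

lemma scaleC_zero_right [simp]: "c *\<^sub>C (0 :: 'a::complex_normed_vector) = 0"
  using scaleC_add_right[of c "0::'a" 0] by simp

lemma holo_on_const [simp]: "holo_on (\<lambda>_. a) S"
  unfolding holo_on_def by (intro ballI exI[of _ "\<lambda>_. 0"] conjI allI has_derivative_const) simp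

lemma holo_on_ident [simp]: "holo_on (\<lambda>x. x) S"
  by (rule holo_on_linear) auto

lemma holo_on_Pair:
  assumes "holo_on f S" "holo_on g S"
  shows "holo_on (\<lambda>x. (f x, g x)) S"
  unfolding holo_on_def
proof
  fix x assume x: "x \<in> S"
  obtain f' g' where *: "(f has_derivative f') (at x within S)" "\<And>c v. f' (c *\<^sub>C v) = c *\<^sub>C f' v"
      "(g has_derivative g') (at x within S)" "\<And>c v. g' (c *\<^sub>C v) = c *\<^sub>C g' v"
    using assms x unfolding holo_on_def by blast
  show "\<exists>f'. ((\<lambda>x. (f x, g x)) has_derivative f') (at x within S) \<and> (\<forall>c v. f' (c *\<^sub>C v) = c *\<^sub>C f' v)"
    using * has_derivative_Pair[OF *(1,3)]
    by (intro exI[of _ "\<lambda>v. (f' v, g' v)"]) (simp add: scaleC_prod_def)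
qed

lemma holo_on_fst: "holo_on f S \<Longrightarrow> holo_on (\<lambda>x. fst (f x)) S"
  by (rule holo_on_compose[where T = UNIV])
     (auto intro!: holo_on_linear bounded_linear_fst simp: scaleC_prod_def)

lemma holo_on_snd: "holo_on f S \<Longrightarrow> holo_on (\<lambda>x. snd (f x)) S"
  by (rule holo_on_compose[where T = UNIV])
     (auto intro!: holo_on_linear bounded_linear_snd simp: scaleC_prod_def)

lemma holo_on_add:
  assumes "holo_on f S" "holo_on g S"
  shows "holo_on (\<lambda>x. f x + g x) S"
  unfolding holo_on_def
proof
  fix x assume x: "x \<in> S"
  obtain f' g' where *: "(f has_derivative f') (at x within S)" "\<And>c v. f' (c *\<^sub>C v) = c *\<^sub>C f' v"
      "(g has_derivative g') (at x within S)" "\<And>c v. g' (c *\<^sub>C v) = c *\<^sub>C g' v"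
    using assms x unfolding holo_on_def by blast
  show "\<exists>f'. ((\<lambda>x. f x + g x) has_derivative f') (at x within S) \<and> (\<forall>c v. f' (c *\<^sub>C v) = c *\<^sub>C f' v)"
    using * has_derivative_add[OF *(1,3)]
    by (intro exI[of _ "\<lambda>v. f' v + g' v"]) (simp add: scaleC_add_right)
qed

lemma holo_on_mult:
  fixes f g :: "'a::complex_normed_vector \<Rightarrow> complex"
  assumes "holo_on f S" "holo_on g S"
  shows "holo_on (\<lambda>x. f x * g x) S"
  unfolding holo_on_def
proof
  fix x assume x: "x \<in> S"
  obtain f' g' where *: "(f has_derivative f') (at x within S)" "\<And>c v. f' (c *\<^sub>C v) = c *\<^sub>C f' v"
      "(g has_derivative g') (at x within S)" "\<And>c v. g' (c *\<^sub>C v) = c *\<^sub>C g' v"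
    using assms x unfolding holo_on_def by blast
  show "\<exists>f'. ((\<lambda>x. f x * g x) has_derivative f') (at x within S) \<and> (\<forall>c v. f' (c *\<^sub>C v) = c *\<^sub>C f' v)"
    using has_derivative_mult[OF *(1,3)]
    by (intro exI[of _ "\<lambda>v. f x * g' v + f' v * g x"])
       (simp add: *(2,4) scaleC_complex_def distrib_left mult.assoc mult.left_commute)
qed

lemma holo_on_field_differentiable:
  fixes f :: "complex \<Rightarrow> complex"
  assumes "\<And>z. z \<in> S \<Longrightarrow> \<exists>d. (f has_field_derivative d) (at z)"
  shows "holo_on f S"
  unfolding holo_on_def
proof
  fix z assume "z \<in> S"
  then obtain d where "(f has_field_derivative d) (at z)" using assms by blast
  then have "(f has_derivative (\<lambda>v. d * v)) (at z within S)"
    unfolding has_field_derivative_def by (rule has_derivative_at_withinI)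
  then show "\<exists>f'. (f has_derivative f') (at z within S) \<and> (\<forall>c v. f' (c *\<^sub>C v) = c *\<^sub>C f' v)"
    unfolding scaleC_complex_def by (intro exI[of _ "\<lambda>v. d * v"]) (simp add: mult.left_commute)
qed

lemma holo_on_exp:
  fixes f :: "'a::complex_normed_vector \<Rightarrow> complex"
  assumes "holo_on f S"
  shows "holo_on (\<lambda>x. exp (f x)) S"
proof -
  have "holo_on (exp :: complex \<Rightarrow> complex) UNIV"
    by (rule holo_on_field_differentiable) (rule exI, rule DERIV_exp)
  then show ?thesis by (rule holo_on_compose[OF assms]) simp
qed

lemma holo_on_divide:
  fixes f g :: "'a::complex_normed_vector \<Rightarrow> complex"
  assumes "holo_on f S" "holo_on g S" "\<And>x. x \<in> S \<Longrightarrow> g x \<noteq> 0"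
  shows "holo_on (\<lambda>x. f x / g x) S"
proof -
  have "holo_on inverse (- {0 :: complex})"
    by (rule holo_on_field_differentiable) (rule exI, rule DERIV_inverse, simp)
  then have "holo_on (\<lambda>x. inverse (g x)) S"
    by (rule holo_on_compose[OF assms(2)]) (use assms(3) in auto)
  then show ?thesis
    unfolding divide_inverse by (rule holo_on_mult[OF assms(1)])
qed

lemmas holo_on_intros = holo_on_const holo_on_ident holo_on_Pair holo_on_fst holo_on_snd
  holo_on_add holo_on_mult holo_on_exp

text \<open>Induction on the independent set: a positive distance from \<open>a\<close> to the span
  of \<open>B\<close> bounds the coefficient of \<open>a\<close>, and once that term is subtracted
  the induction hypothesis bounds the others.\<close>

lemma coordinate_bound:
  fixes B :: "'v::complex_normed_vector set"
  assumes "finite B" "\<not> cdependent B"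
  shows "\<exists>K. \<forall>c. \<forall>b\<in>B. cmod (c b) \<le> K * norm (\<Sum>b\<in>B. c b *\<^sub>C b)"
  using assms
proof (induction B rule: finite_induct)
  case empty
  then show ?case by simp
next
  case (insert a B)
  have ind: "\<not> cdependent B" "a \<notin> cspan B"
    using insert.prems insert.hyps(2) complex_vector.independent_insert[of a B] by auto
  obtain K where K: "\<And>c b. b \<in> B \<Longrightarrow> cmod (c b) \<le> K * norm (\<Sum>b\<in>B. c b *\<^sub>C b)"
    using insert.IH[OF ind(1)] by blast
  \<comment> \<open>This is closedness of the span: if combinations of \<open>B\<close> converged to
    \<open>a\<close>, their coordinates would be Cauchy by the induction hypothesis, and the limits
    of the coordinates would express \<open>a\<close> through \<open>B\<close>.\<close>
  have "\<exists>d>0. \<forall>s\<in>cspan B. d \<le> dist s a"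
  proof (rule ccontr)
    assume neg: "\<not> ?thesis"
    have "\<exists>c. dist (\<Sum>b\<in>B. c b *\<^sub>C b) a < inverse (real (Suc n))" for n
    proof -
      obtain s where s: "s \<in> cspan B" "dist s a < inverse (real (Suc n))"
        using neg[unfolded not_ex de_Morgan_conj, rule_format, of "inverse (real (Suc n))"]
        by (auto simp: not_le)
      then show ?thesis
        unfolding complex_vector.span_finite[OF insert.hyps(1)] by auto
    qed
    then obtain c where c: "\<And>n. dist (\<Sum>b\<in>B. c n b *\<^sub>C b) a < inverse (real (Suc n))" by metis
    let ?s = "\<lambda>n. \<Sum>b\<in>B. c n b *\<^sub>C b"
    have lim: "?s \<longlonglongrightarrow> a"
      by (rule tendsto_dist_iff[THEN iffD2], rule tendsto_sandwich[OF _ _ tendsto_const LIMSEQ_inverse_real_of_nat])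
         (auto intro!: always_eventually less_imp_le c simp del: of_nat_Suc)
    have cauchy: "Cauchy ?s" using lim LIMSEQ_imp_Cauchy by blast
    have "\<exists>l. (\<lambda>n. c n b) \<longlonglongrightarrow> l" if b: "b \<in> B" for b
    proof -
      have "Cauchy (\<lambda>n. c n b)"
      proof (rule metric_CauchyI)
        fix e :: real assume e: "e > 0"
        have "0 < \<bar>K\<bar> + 1" by simp
        then obtain M where M: "\<And>m n. m \<ge> M \<Longrightarrow> n \<ge> M \<Longrightarrow> dist (?s m) (?s n) < e / (\<bar>K\<bar> + 1)"
          using metric_CauchyD[OF cauchy, of "e / (\<bar>K\<bar> + 1)"] e by auto
        show "\<exists>M. \<forall>m\<ge>M. \<forall>n\<ge>M. dist (c m b) (c n b) < e"
        proof (intro exI allI impI)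
          fix m n assume mn: "m \<ge> M" "n \<ge> M"
          have "?s m - ?s n = (\<Sum>b\<in>B. (c m b - c n b) *\<^sub>C b)"
            by (simp add: sum_subtractf complex_vector.scale_left_diff_distrib)
          then have "dist (c m b) (c n b) \<le> K * dist (?s m) (?s n)"
            using K[OF b, of "\<lambda>b. c m b - c n b"] by (simp add: dist_norm)
          also have "\<dots> \<le> (\<bar>K\<bar> + 1) * dist (?s m) (?s n)" by (intro mult_right_mono) auto
          also have "\<dots> < e" using M[OF mn] by (simp add: field_simps)
          finally show "dist (c m b) (c n b) < e" .
        qed
      qed
      then show ?thesis using Cauchy_convergent_iff convergent_def by blast
    qed
    then obtain l where l: "\<And>b. b \<in> B \<Longrightarrow> (\<lambda>n. c n b) \<longlonglongrightarrow> l b" by metis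
    have "?s \<longlonglongrightarrow> (\<Sum>b\<in>B. l b *\<^sub>C b)"
    proof (rule tendsto_sum)
      fix b assume b: "b \<in> B"
      have "bounded_linear (\<lambda>c. c *\<^sub>C b)"
      proof (rule bounded_linear_intro[of _ "norm b"])
        fix r x show "(r *\<^sub>R x) *\<^sub>C b = r *\<^sub>R (x *\<^sub>C b)"
          unfolding scaleR_conv_of_real[of r x] by (simp only: scaleC_scaleC[symmetric] scaleC_of_real)
      qed (simp_all add: scaleC_add_left norm_scaleC)
      then show "(\<lambda>n. c n b *\<^sub>C b) \<longlonglongrightarrow> l b *\<^sub>C b"
        by (rule bounded_linear.tendsto[OF _ l[OF b]])
    qed
    then have "a = (\<Sum>b\<in>B. l b *\<^sub>C b)" using lim LIMSEQ_unique by blast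
    then show False
      using ind(2) unfolding complex_vector.span_finite[OF insert.hyps(1)] by auto
  qed
  then obtain d where d: "d > 0" "\<And>s. s \<in> cspan B \<Longrightarrow> d \<le> dist s a" by blast
  have bound_a: "d * cmod (c a) \<le> norm (\<Sum>b\<in>insert a B. c b *\<^sub>C b)" for c
  proof (cases "c a = 0")
    case False
    \<comment> \<open>Chosen so that \<open>c a *\<^sub>C (a - ?t)\<close> is the whole
      combination.\<close>
    let ?t = "\<Sum>b\<in>B. (- c b / c a) *\<^sub>C b"
    have "?t \<in> cspan B"
      by (intro complex_vector.span_sum complex_vector.span_scale complex_vector.span_base)
    then have "d \<le> norm (a - ?t)" using d(2)[of ?t] by (simp add: dist_norm norm_minus_commute)
    then have "cmod (c a) * d \<le> norm (c a *\<^sub>C (a - ?t))"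
      by (simp add: norm_scaleC mult_left_mono)
    also have "c a *\<^sub>C (a - ?t) = c a *\<^sub>C a + (\<Sum>b\<in>B. c b *\<^sub>C b)"
      using False by (simp add: scaleC_add_right complex_vector.scale_right_diff_distrib complex_vector.scale_sum_right
        scaleC_scaleC sum_negf)
    finally show ?thesis using insert.hyps by (simp add: mult.commute)
  qed simp
  \<comment> \<open>The summand \<open>1 / d\<close> bounds the coefficient of \<open>a\<close>; the
    factor \<open>1 + norm a / d\<close> is the cost of removing \<open>c a *\<^sub>C a\<close> from
    the vector. The absolute value guards against a negative \<open>K\<close>, which is possible
    when \<open>B\<close> is empty.\<close>
  let ?K' = "\<bar>K\<bar> * (1 + norm a / d) + 1 / d"
  show ?case
  proof (intro exI[of _ ?K'] allI ballI)
    fix c b assume b: "b \<in> insert a B"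
    let ?x = "\<Sum>b\<in>insert a B. c b *\<^sub>C b"
    let ?s = "\<Sum>b\<in>B. c b *\<^sub>C b"
    have ca: "cmod (c a) \<le> norm ?x / d" using bound_a[of c] d(1) by (simp add: field_simps)
    have "?s = ?x - c a *\<^sub>C a" using insert.hyps by simp
    then have "norm ?s \<le> norm ?x + cmod (c a) * norm a"
      by (metis norm_scaleC norm_triangle_ineq4)
    also have "\<dots> \<le> norm ?x + norm ?x / d * norm a"
      using ca by (intro add_left_mono mult_right_mono) auto
    finally have s: "norm ?s \<le> norm ?x * (1 + norm a / d)" by (simp add: algebra_simps)
    have nn: "0 \<le> norm ?x / d" "0 \<le> \<bar>K\<bar> * (1 + norm a / d) * norm ?x" using d(1) by auto
    show "cmod (c b) \<le> ?K' * norm ?x"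
    proof (cases "b = a")
      case True
      then show ?thesis using ca nn by (simp add: algebra_simps)
    next
      case False
      then have "cmod (c b) \<le> K * norm ?s" using b K by blast
      also have "\<dots> \<le> \<bar>K\<bar> * norm ?s" by (intro mult_right_mono) auto
      also have "\<dots> \<le> \<bar>K\<bar> * (norm ?x * (1 + norm a / d))" using s by (intro mult_left_mono) auto
      finally show ?thesis using nn by (simp add: algebra_simps)
    qed
  qed
qed

text \<open>A derivative has to be bounded, while a Hermitian form is given by algebraic laws alone.
  Expansion in a basis and the bound on coordinates supply the continuity of
  \<open>\<lambda>v. H v z\<close>.\<close>

lemma clinear_functional_bounded:
  fixes f :: "'v::fin_dim_complex_vector \<Rightarrow> complex"
  assumes "\<And>x y. f (x + y) = f x + f y" "\<And>c x. f (c *\<^sub>C x) = c * f x"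
  shows "bounded_linear f"
proof -
  obtain A :: "'v set" where A: "finite A" "cspan A = UNIV" using ex_finite_cspan by blast
  obtain B where B: "B \<subseteq> A" "\<not> cdependent B" "A \<subseteq> cspan B"
    using complex_vector.maximal_independent_subset[of A] by blast
  have fin: "finite B" using A(1) B(1) finite_subset by blast
  have span: "cspan B = UNIV"
    using A(2) B(3) complex_vector.span_minimal[OF B(3)] by auto
  obtain K where K: "\<And>c b. b \<in> B \<Longrightarrow> cmod (c b) \<le> K * norm (\<Sum>b\<in>B. c b *\<^sub>C b)"
    using coordinate_bound[OF fin B(2)] by blast
  have f0: "f 0 = 0" using assms(1)[of 0 0] by simp
  have fsum: "f (\<Sum>b\<in>B. c b *\<^sub>C b) = (\<Sum>b\<in>B. c b * f b)" for c
    using fin by (induction B rule: finite_induct) (simp_all add: assms f0)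
  show ?thesis
  proof (rule bounded_linear_intro[of _ "\<Sum>b\<in>B. K * cmod (f b)"])
    fix x :: 'v
    have "x \<in> cspan B" using span by simp
    then obtain c where x: "x = (\<Sum>b\<in>B. c b *\<^sub>C b)"
      unfolding complex_vector.span_finite[OF fin] by auto
    have "norm (f x) \<le> (\<Sum>b\<in>B. cmod (c b) * cmod (f b))"
      unfolding x fsum by (rule order_trans[OF norm_sum]) (simp add: norm_mult)
    also have "\<dots> \<le> (\<Sum>b\<in>B. K * norm x * cmod (f b))"
      using K by (intro sum_mono mult_right_mono) (auto simp: x)
    finally show "norm (f x) \<le> norm x * (\<Sum>b\<in>B. K * cmod (f b))"
      by (simp add: sum_distrib_left mult_ac)
  next
    fix r x show "f (r *\<^sub>R x) = r *\<^sub>R f x"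
      using assms(2)[of "of_real r" x] by (simp add: scaleC_of_real scaleR_conv_of_real)
  qed (rule assms)
qed

section \<open>Maps between manifolds given by charts\<close>

text \<open>The record \<open>cmfd\<close> imposes no condition on its charts. The ones that the
  calculus relies on are collected here, above all injectivity, which makes
  \<open>inv_into D \<phi>\<close> a genuine inverse, and they are verified for each
  construction.\<close>

definition proper_charts :: "('p, 'v::complex_normed_vector) cmfd \<Rightarrow> bool" where
  "proper_charts M \<longleftrightarrow>
     (\<forall>(W, D, \<phi>) \<in> charts M. D \<subseteq> pts M \<and> inj_on \<phi> D \<and> openin (top_of_set W) (\<phi> ` D))"

definition covered :: "('p, 'v) cmfd \<Rightarrow> bool" where
  "covered M \<longleftrightarrow> (\<forall>p\<in>pts M. \<exists>(W, D, \<phi>) \<in> charts M. p \<in> D)"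

lemma proper_chartsD:
  assumes "proper_charts M" "(W, D, \<phi>) \<in> charts M"
  shows "D \<subseteq> pts M" "inj_on \<phi> D" "openin (top_of_set W) (\<phi> ` D)"
  using assms unfolding proper_charts_def by auto

lemma proper_chartsI:
  assumes "\<And>W D \<phi>. (W, D, \<phi>) \<in> charts M \<Longrightarrow> D \<subseteq> pts M"
    and "\<And>W D \<phi>. (W, D, \<phi>) \<in> charts M \<Longrightarrow> inj_on \<phi> D"
    and "\<And>W D \<phi>. (W, D, \<phi>) \<in> charts M \<Longrightarrow> openin (top_of_set W) (\<phi> ` D)"
  shows "proper_charts M"
  using assms unfolding proper_charts_def by auto

lemma coveredE:
  assumes "covered M" "p \<in> pts M"
  obtains W D \<phi> where "(W, D, \<phi>) \<in> charts M" "p \<in> D"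
  using assms unfolding covered_def by auto

lemma holo_mapD:
  assumes "holo_map M N f" "(W, D, \<phi>) \<in> charts M" "(W', D', \<phi>') \<in> charts N"
  shows "openin (top_of_set W) (\<phi> ` (D \<inter> f -` D'))"
    and "holo_on (\<phi>' \<circ> f \<circ> inv_into D \<phi>) (\<phi> ` (D \<inter> f -` D'))"
  using assms unfolding holo_map_def by auto

lemma holo_map_in: "holo_map M N f \<Longrightarrow> p \<in> pts M \<Longrightarrow> f p \<in> pts N"
  unfolding holo_map_def by auto

text \<open>Both halves of \<open>holo_map\<close>, openness of the domain and holomorphy on it, are
  local, so a neighbourhood \<open>Q\<close> of each point in the chart is enough.\<close>

lemma holo_mapI:
  assumes "f \<in> pts M \<rightarrow> pts N"
    and "\<And>W D \<phi> W' D' \<phi>' p. \<lbrakk>(W, D, \<phi>) \<in> charts M; (W', D', \<phi>') \<in> charts N; p \<in> D; f p \<in> D'\<rbrakk> \<Longrightarrow>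
      \<exists>Q. openin (top_of_set W) Q \<and> \<phi> p \<in> Q \<and> Q \<subseteq> \<phi> ` (D \<inter> f -` D') \<and>
        holo_on (\<phi>' \<circ> f \<circ> inv_into D \<phi>) Q"
  shows "holo_map M N f"
proof -
  have "openin (top_of_set W) (\<phi> ` (D \<inter> f -` D')) \<and>
      holo_on (\<phi>' \<circ> f \<circ> inv_into D \<phi>) (\<phi> ` (D \<inter> f -` D'))"
    if c: "(W, D, \<phi>) \<in> charts M" "(W', D', \<phi>') \<in> charts N" for W D \<phi> W' D' \<phi>'
  proof -
    let ?S = "\<phi> ` (D \<inter> f -` D')"
    have loc: "\<exists>Q. openin (top_of_set W) Q \<and> w \<in> Q \<and> Q \<subseteq> ?S \<and>
        holo_on (\<phi>' \<circ> f \<circ> inv_into D \<phi>) Q" if "w \<in> ?S" for w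
      using assms(2)[OF c] that by auto
    have op: "openin (top_of_set W) ?S"
      using loc by (subst openin_subopen) blast
    have "holo_on (\<phi>' \<circ> f \<circ> inv_into D \<phi>) ?S"
      using openin_imp_subset[OF op] by (rule holo_on_local) (use loc in blast)
    with op show ?thesis ..
  qed
  then show ?thesis using assms(1) unfolding holo_map_def by auto
qed

text \<open>For maps with an explicit formula \<open>R\<close> in coordinates: each \<open>z\<close>
  in \<open>Q\<close> is exhibited as the coordinate of some point, which keeps
  \<open>inv_into\<close> out of the applications.\<close>

lemma holo_mapI_expression:
  assumes "f \<in> pts M \<rightarrow> pts N"
    and inj: "\<And>W D \<phi>. (W, D, \<phi>) \<in> charts M \<Longrightarrow> inj_on \<phi> D"
    and expr: "\<And>W D \<phi> W' D' \<phi>' p. \<lbrakk>(W, D, \<phi>) \<in> charts M; (W', D', \<phi>') \<in> charts N; p \<in> D; f p \<in> D'\<rbrakk> \<Longrightarrow>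
      \<exists>Q R. openin (top_of_set W) Q \<and> \<phi> p \<in> Q \<and> holo_on R Q \<and>
        (\<forall>z\<in>Q. \<exists>x\<in>D. f x \<in> D' \<and> z = \<phi> x \<and> \<phi>' (f x) = R z)"
  shows "holo_map M N f"
proof (rule holo_mapI[OF assms(1)])
  fix W D \<phi> W' D' \<phi>' p
  assume c: "(W, D, \<phi>) \<in> charts M" "(W', D', \<phi>') \<in> charts N" "p \<in> D" "f p \<in> D'"
  obtain Q R where Q: "openin (top_of_set W) Q" "\<phi> p \<in> Q" "holo_on R Q"
    and R: "\<And>z. z \<in> Q \<Longrightarrow> \<exists>x\<in>D. f x \<in> D' \<and> z = \<phi> x \<and> \<phi>' (f x) = R z"
    using expr[OF c] by blast
  have "R z = (\<phi>' \<circ> f \<circ> inv_into D \<phi>) z" if z: "z \<in> Q" for z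
  proof -
    obtain x where "x \<in> D" "z = \<phi> x" "\<phi>' (f x) = R z" using R[OF z] by blast
    then show ?thesis using inj[OF c(1)] by simp
  qed
  then have "holo_on (\<phi>' \<circ> f \<circ> inv_into D \<phi>) Q"
    using Q(3) holo_on_cong[of Q R] by blast
  moreover have "Q \<subseteq> \<phi> ` (D \<inter> f -` D')"
  proof
    fix z assume "z \<in> Q"
    then obtain x where "x \<in> D" "f x \<in> D'" "z = \<phi> x" using R by blast
    then show "z \<in> \<phi> ` (D \<inter> f -` D')" by (intro image_eqI[of _ _ x]) simp_all
  qed
  ultimately show "\<exists>Q. openin (top_of_set W) Q \<and> \<phi> p \<in> Q \<and> Q \<subseteq> \<phi> ` (D \<inter> f -` D') \<and>
        holo_on (\<phi>' \<circ> f \<circ> inv_into D \<phi>) Q"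
    using Q by (intro exI[of _ Q] conjI)
qed

lemma holo_map_cong:
  assumes "proper_charts M" "\<And>x. x \<in> pts M \<Longrightarrow> f x = g x" "holo_map M N f"
  shows "holo_map M N g"
proof (rule holo_mapI)
  show "g \<in> pts M \<rightarrow> pts N" using holo_map_in[OF assms(3)] by (simp add: Pi_iff assms(2)[symmetric])
  fix W D \<phi> W' D' \<phi>' p
  assume c: "(W, D, \<phi>) \<in> charts M" "(W', D', \<phi>') \<in> charts N" and p: "p \<in> D" "g p \<in> D'"
  have eq: "f x = g x" if "x \<in> D" for x
    using assms(2) proper_chartsD(1)[OF assms(1) c(1)] that by blast
  have "D \<inter> f -` D' = D \<inter> g -` D'" using eq by auto
  moreover have "holo_on (\<phi>' \<circ> f \<circ> inv_into D \<phi>) (\<phi> ` (D \<inter> f -` D')) \<longleftrightarrow>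
      holo_on (\<phi>' \<circ> g \<circ> inv_into D \<phi>) (\<phi> ` (D \<inter> f -` D'))"
    by (rule holo_on_cong) (auto simp: eq inv_into_into)
  ultimately show "\<exists>Q. openin (top_of_set W) Q \<and> \<phi> p \<in> Q \<and> Q \<subseteq> \<phi> ` (D \<inter> g -` D') \<and>
        holo_on (\<phi>' \<circ> g \<circ> inv_into D \<phi>) Q"
    using holo_mapD[OF assms(3) c] p by (intro exI[of _ "\<phi> ` (D \<inter> g -` D')"]) auto
qed

section \<open>Products, compositions and families of maps\<close>

lemma prod_mfd_simps [simp]: "pts (prod_mfd M N) = pts M \<times> pts N"
  by (simp add: prod_mfd_def)

lemma prod_mfd_chartE:
  assumes "(V, C, \<kappa>) \<in> charts (prod_mfd M N)"
  obtains W D \<phi> W' D' \<phi>' where "(W, D, \<phi>) \<in> charts M" "(W', D', \<phi>') \<in> charts N"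
    "V = W \<times> W'" "C = D \<times> D'" "\<kappa> = map_prod \<phi> \<phi>'"
  using assms unfolding prod_mfd_def by auto

lemma prod_mfd_chartI:
  "(W, D, \<phi>) \<in> charts M \<Longrightarrow> (W', D', \<phi>') \<in> charts N \<Longrightarrow>
   (W \<times> W', D \<times> D', map_prod \<phi> \<phi>') \<in> charts (prod_mfd M N)"
  unfolding prod_mfd_def by (simp, intro exI conjI) (rule refl | assumption)+

lemma proper_charts_prod:
  assumes "proper_charts M" "proper_charts N"
  shows "proper_charts (prod_mfd M N)"
proof (rule proper_chartsI)
  fix V C \<kappa> assume "(V, C, \<kappa>) \<in> charts (prod_mfd M N)"
  then obtain W D \<phi> W' D' \<phi>' where c: "(W, D, \<phi>) \<in> charts M" "(W', D', \<phi>') \<in> charts N"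
    "V = W \<times> W'" "C = D \<times> D'" "\<kappa> = map_prod \<phi> \<phi>'" by (rule prod_mfd_chartE)
  note d = proper_chartsD[OF assms(1) c(1)] proper_chartsD[OF assms(2) c(2)]
  show "C \<subseteq> pts (prod_mfd M N)" using d c by auto
  show "inj_on \<kappa> C" using d c by (simp add: map_prod_inj_on)
  have "\<kappa> ` C = (\<phi> ` D) \<times> (\<phi>' ` D')" using c by (auto simp: map_prod_def)
  then show "openin (top_of_set V) (\<kappa> ` C)" using d c by (simp add: openin_Times)
qed

lemma inv_into_map_prod:
  assumes "inj_on \<phi> D" "inj_on \<phi>' D'" "x \<in> D" "y \<in> D'"
  shows "inv_into (D \<times> D') (map_prod \<phi> \<phi>') (\<phi> x, \<phi>' y) = (x, y)"
  using inv_into_f_f[OF map_prod_inj_on[OF assms(1,2)], of "(x, y)"] assms(3,4) by simp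

text \<open>A chart of \<open>N\<close> around \<open>f p\<close> splits the coordinate expression
  into two holomorphic factors; \<open>covered N\<close> provides that chart.\<close>

lemma holo_map_compose:
  assumes M: "proper_charts M" and N: "proper_charts N" "covered N"
    and f: "holo_map M N f" and g: "holo_map N K g"
  shows "holo_map M K (\<lambda>x. g (f x))"
proof (rule holo_mapI)
  show "(\<lambda>x. g (f x)) \<in> pts M \<rightarrow> pts K" using f g by (auto simp: holo_map_def)
  fix W D \<phi> W'' D'' \<phi>'' p
  assume c: "(W, D, \<phi>) \<in> charts M" "(W'', D'', \<phi>'') \<in> charts K" and p: "p \<in> D" "g (f p) \<in> D''"
  note dM = proper_chartsD[OF M c(1)]
  have "f p \<in> pts N" using holo_map_in[OF f] dM(1) p by blast
  then obtain W' D' \<phi>' where c': "(W', D', \<phi>') \<in> charts N" "f p \<in> D'" by (rule coveredE[OF N(2)])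
  note dN = proper_chartsD[OF N(1) c'(1)]
  define A where "A = \<phi> ` (D \<inter> f -` D')"
  define B where "B = \<phi>' ` (D' \<inter> g -` D'')"
  define F where "F = \<phi>' \<circ> f \<circ> inv_into D \<phi>"
  have A: "openin (top_of_set W) A" "holo_on F A"
    using holo_mapD[OF f c(1) c'(1)] by (simp_all add: A_def F_def)
  have B: "openin (top_of_set W') B" "holo_on (\<phi>'' \<circ> g \<circ> inv_into D' \<phi>') B"
    using holo_mapD[OF g c'(1) c(2)] by (simp_all add: B_def)
  have F: "F (\<phi> x) = \<phi>' (f x)" if "x \<in> D" for x using that dM by (simp add: F_def)
  have "F \<in> A \<rightarrow> W'"
    using openin_imp_subset[OF dN(3)] F by (auto simp: A_def)
  then have Q: "openin (top_of_set W) (A \<inter> F -` B)"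
    using continuous_openin_preimage[OF holo_on_imp_continuous_on[OF A(2)] _ B(1)] A(1) openin_trans
    by blast
  \<comment> \<open>\<open>B\<close> is a set of coordinates; injectivity of \<open>\<phi>'\<close>
    leads back from \<open>F (\<phi> x) \<in> B\<close> to the point \<open>f x\<close>
    itself.\<close>
  have mem: "g (f x) \<in> D''" if "x \<in> D" "f x \<in> D'" "F (\<phi> x) \<in> B" for x
    using that F dN(2) by (auto simp: B_def inj_on_eq_iff)
  have "holo_on (\<lambda>w. (\<phi>'' \<circ> g \<circ> inv_into D' \<phi>') (F w)) (A \<inter> F -` B)"
    by (rule holo_on_compose[OF holo_on_subset[OF A(2)] B(2)]) auto
  also have "?this \<longleftrightarrow> holo_on (\<phi>'' \<circ> (\<lambda>x. g (f x)) \<circ> inv_into D \<phi>) (A \<inter> F -` B)"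
    using dM dN by (intro holo_on_cong) (auto simp: A_def F)
  finally show "\<exists>Q. openin (top_of_set W) Q \<and> \<phi> p \<in> Q \<and> Q \<subseteq> \<phi> ` (D \<inter> (\<lambda>x. g (f x)) -` D'') \<and>
        holo_on (\<phi>'' \<circ> (\<lambda>x. g (f x)) \<circ> inv_into D \<phi>) Q"
    using Q p c' mem by (intro exI[of _ "A \<inter> F -` B"]) (auto simp: A_def B_def F)
qed

text \<open>The form needed for inserting a bundle isomorphism into an action while the group
  element is kept. The proof is that of the plain composition, with the product \<open>H\<close> of
  the identity and \<open>F\<close> in place of \<open>F\<close>.\<close>

lemma holo_map_compose_param:
  fixes P :: "('p, 'u::complex_normed_vector) cmfd" and M :: "('m, 'v::complex_normed_vector) cmfd"
  assumes P: "proper_charts P" and M: "proper_charts M" and N: "proper_charts N" "covered N"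
    and f: "holo_map M N f" and g: "holo_map (prod_mfd P N) K g"
  shows "holo_map (prod_mfd P M) K (\<lambda>(a, x). g (a, f x))"
proof (rule holo_mapI)
  let ?h = "\<lambda>(a, x). g (a, f x)"
  show "?h \<in> pts (prod_mfd P M) \<rightarrow> pts K" using f g by (auto simp: holo_map_def)
  fix V C \<kappa> W'' D'' \<phi>'' p
  assume c0: "(V, C, \<kappa>) \<in> charts (prod_mfd P M)" and c'': "(W'', D'', \<phi>'') \<in> charts K"
    and p: "p \<in> C" "?h p \<in> D''"
  from c0 obtain U O' \<psi> W D \<phi> where c: "(U, O', \<psi>) \<in> charts P" "(W, D, \<phi>) \<in> charts M"
    and eqs: "V = U \<times> W" "C = O' \<times> D" "\<kappa> = map_prod \<psi> \<phi>" by (rule prod_mfd_chartE)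
  note dP = proper_chartsD[OF P c(1)] and dM = proper_chartsD[OF M c(2)]
  obtain a x where ax: "p = (a, x)" "a \<in> O'" "x \<in> D" using p eqs by auto
  have "f x \<in> pts N" using holo_map_in[OF f] dM(1) ax by blast
  then obtain W' D' \<phi>' where c': "(W', D', \<phi>') \<in> charts N" "f x \<in> D'" by (rule coveredE[OF N(2)])
  note dN = proper_chartsD[OF N(1) c'(1)]
  define A where "A = \<phi> ` (D \<inter> f -` D')"
  define B where "B = map_prod \<psi> \<phi>' ` ((O' \<times> D') \<inter> g -` D'')"
  define F where "F = \<phi>' \<circ> f \<circ> inv_into D \<phi>"
  define H where "H = (\<lambda>z :: 'u \<times> 'v. (fst z, F (snd z)))"
  have A: "openin (top_of_set W) A" "holo_on F A"
    using holo_mapD[OF f c(2) c'(1)] by (simp_all add: A_def F_def)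
  have B: "openin (top_of_set (U \<times> W')) B"
      "holo_on (\<phi>'' \<circ> g \<circ> inv_into (O' \<times> D') (map_prod \<psi> \<phi>')) B"
    using holo_mapD[OF g prod_mfd_chartI[OF c(1) c'(1)] c''] by (simp_all add: B_def)
  have F: "F (\<phi> x) = \<phi>' (f x)" if "x \<in> D" for x using that dM by (simp add: F_def)
  have UA: "openin (top_of_set V) (U \<times> A)" using A(1) eqs by (simp add: openin_Times)
  have H: "holo_on H (U \<times> A)"
    unfolding H_def
    by (intro holo_on_intros holo_on_compose[where f = snd and g = F, OF _ A(2)]) auto
  have "H \<in> U \<times> A \<rightarrow> U \<times> W'"
    using openin_imp_subset[OF dN(3)] F by (auto simp: A_def H_def)
  then have Q: "openin (top_of_set V) (U \<times> A \<inter> H -` B)"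
    using continuous_openin_preimage[OF holo_on_imp_continuous_on[OF H] _ B(1)] UA openin_trans
    by blast
  have Qim: "\<exists>a x. a \<in> O' \<and> x \<in> D \<and> f x \<in> D' \<and> g (a, f x) \<in> D'' \<and> z = (\<psi> a, \<phi> x)"
    if z: "z \<in> U \<times> A \<inter> H -` B" for z
  proof -
    obtain x where x: "x \<in> D" "f x \<in> D'" "snd z = \<phi> x" using z by (auto simp: A_def)
    obtain a y where ay: "a \<in> O'" "y \<in> D'" "g (a, y) \<in> D''" "fst z = \<psi> a" "F (snd z) = \<phi>' y"
      using z by (auto simp: B_def H_def)
    have "y = f x" using ay x F dN(2) by (simp add: inj_on_eq_iff)
    then show ?thesis using ay x by (metis prod.collapse)
  qed
  have "holo_on (\<lambda>z. (\<phi>'' \<circ> g \<circ> inv_into (O' \<times> D') (map_prod \<psi> \<phi>')) (H z)) (U \<times> A \<inter> H -` B)"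
    by (rule holo_on_compose[OF holo_on_subset[OF H] B(2)]) auto
  also have "?this \<longleftrightarrow> holo_on (\<phi>'' \<circ> ?h \<circ> inv_into C \<kappa>) (U \<times> A \<inter> H -` B)"
  proof (rule holo_on_cong)
    fix z assume "z \<in> U \<times> A \<inter> H -` B"
    then obtain a x where ax: "a \<in> O'" "x \<in> D" "f x \<in> D'" "z = (\<psi> a, \<phi> x)" using Qim by blast
    then show "(\<phi>'' \<circ> g \<circ> inv_into (O' \<times> D') (map_prod \<psi> \<phi>')) (H z) = (\<phi>'' \<circ> ?h \<circ> inv_into C \<kappa>) z"
      using dP(2) dM(2) dN(2) by (simp add: eqs H_def F inv_into_map_prod)
  qed
  finally have "holo_on (\<phi>'' \<circ> ?h \<circ> inv_into C \<kappa>) (U \<times> A \<inter> H -` B)" .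
  moreover have "\<kappa> p \<in> U \<times> A \<inter> H -` B"
    using ax p c' openin_imp_subset[OF dP(3)] by (auto simp: eqs A_def B_def H_def F)
  moreover have "U \<times> A \<inter> H -` B \<subseteq> \<kappa> ` (C \<inter> ?h -` D'')"
  proof
    fix z assume "z \<in> U \<times> A \<inter> H -` B"
    then obtain a x where "a \<in> O'" "x \<in> D" "g (a, f x) \<in> D''" "z = (\<psi> a, \<phi> x)" using Qim by blast
    then show "z \<in> \<kappa> ` (C \<inter> ?h -` D'')"
      by (intro image_eqI[of _ _ "(a, x)"]) (auto simp: eqs)
  qed
  ultimately show "\<exists>Q. openin (top_of_set V) Q \<and> \<kappa> p \<in> Q \<and> Q \<subseteq> \<kappa> ` (C \<inter> ?h -` D'') \<and>
        holo_on (\<phi>'' \<circ> ?h \<circ> inv_into C \<kappa>) Q"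
    using Q by (intro exI[of _ "U \<times> A \<inter> H -` B"] conjI)
qed

text \<open>Extracts one member of a holomorphic family: a coordinate of the parameter is fixed in
  the joint coordinate expression.\<close>

lemma holo_map_slice:
  assumes M: "proper_charts M" and N: "proper_charts N"
    and g: "holo_map (prod_mfd M N) K g"
    and c0: "(U, O', \<psi>) \<in> charts M" "a \<in> O'"
  shows "holo_map N K (\<lambda>x. g (a, x))"
proof (rule holo_mapI)
  note dM = proper_chartsD[OF M c0(1)]
  show "(\<lambda>x. g (a, x)) \<in> pts N \<rightarrow> pts K" using g c0 dM(1) by (auto simp: holo_map_def)
  fix W D \<phi> W'' D'' \<phi>'' p
  assume c: "(W, D, \<phi>) \<in> charts N" "(W'', D'', \<phi>'') \<in> charts K" and p: "p \<in> D" "g (a, p) \<in> D''"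
  note dN = proper_chartsD[OF N c(1)]
  define B where "B = map_prod \<psi> \<phi> ` ((O' \<times> D) \<inter> g -` D'')"
  have B: "openin (top_of_set (U \<times> W)) B"
      "holo_on (\<phi>'' \<circ> g \<circ> inv_into (O' \<times> D) (map_prod \<psi> \<phi>)) B"
    using holo_mapD[OF g prod_mfd_chartI[OF c0(1) c(1)] c(2)] by (simp_all add: B_def)
  \<comment> \<open>The slice of \<open>B\<close> at the coordinate of \<open>a\<close>. Since
    \<open>\<psi>\<close> is injective on \<open>O'\<close>, its points come from the parameter
    \<open>a\<close> and from no other.\<close>
  define Q where "Q = W \<inter> Pair (\<psi> a) -` B"
  have "\<psi> a \<in> U" using openin_imp_subset[OF dM(3)] c0 by blast
  then have Q: "openin (top_of_set W) Q"
    unfolding Q_def by (intro continuous_openin_preimage[OF _ _ B(1)]) (auto intro!: continuous_intros)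
  have mem: "\<exists>x\<in>D. g (a, x) \<in> D'' \<and> w = \<phi> x" if "w \<in> Q" for w
  proof -
    obtain b x where "b \<in> O'" "x \<in> D" "g (b, x) \<in> D''" "\<psi> b = \<psi> a" "\<phi> x = w"
      using \<open>w \<in> Q\<close> by (auto simp: Q_def B_def)
    then show ?thesis using dM(2) c0 by (auto simp: inj_on_eq_iff)
  qed
  have "holo_on (\<lambda>w. (\<phi>'' \<circ> g \<circ> inv_into (O' \<times> D) (map_prod \<psi> \<phi>)) (\<psi> a, w)) Q"
    by (rule holo_on_compose[OF _ B(2)]) (auto simp: Q_def intro!: holo_on_intros)
  also have "?this \<longleftrightarrow> holo_on (\<phi>'' \<circ> (\<lambda>x. g (a, x)) \<circ> inv_into D \<phi>) Q"
    by (intro holo_on_cong) (use dM(2) dN(2) c0 in \<open>auto dest!: mem simp: inv_into_map_prod\<close>)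
  finally have "holo_on (\<phi>'' \<circ> (\<lambda>x. g (a, x)) \<circ> inv_into D \<phi>) Q" .
  moreover have "Q \<subseteq> \<phi> ` (D \<inter> (\<lambda>x. g (a, x)) -` D'')" using mem by blast
  moreover have "\<phi> p \<in> Q"
    using p c0 openin_imp_subset[OF dN(3)]
    by (auto simp: Q_def B_def intro!: image_eqI[of _ _ "(a, p)"])
  ultimately show "\<exists>Q. openin (top_of_set W) Q \<and> \<phi> p \<in> Q \<and> Q \<subseteq> \<phi> ` (D \<inter> (\<lambda>x. g (a, x)) -` D'') \<and>
        holo_on (\<phi>'' \<circ> (\<lambda>x. g (a, x)) \<circ> inv_into D \<phi>) Q"
    using Q by (intro exI[of _ Q] conjI)
qed

text \<open>Turns a single map into a constant family, so that results about families apply to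
  it.\<close>

lemma holo_map_prod_snd:
  assumes M: "proper_charts M" and N: "proper_charts N" and f: "holo_map N K f"
  shows "holo_map (prod_mfd M N) K (\<lambda>(a, x). f x)"
proof (rule holo_mapI)
  let ?h = "\<lambda>(a, x). f x"
  show "?h \<in> pts (prod_mfd M N) \<rightarrow> pts K" using f by (auto simp: holo_map_def)
  fix V C \<kappa> W'' D'' \<phi>'' p
  assume c0: "(V, C, \<kappa>) \<in> charts (prod_mfd M N)" and c'': "(W'', D'', \<phi>'') \<in> charts K"
    and p: "p \<in> C" "?h p \<in> D''"
  from c0 obtain U O' \<psi> W D \<phi> where c: "(U, O', \<psi>) \<in> charts M" "(W, D, \<phi>) \<in> charts N"
    and eqs: "V = U \<times> W" "C = O' \<times> D" "\<kappa> = map_prod \<psi> \<phi>" by (rule prod_mfd_chartE)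
  note dM = proper_chartsD[OF M c(1)] and dN = proper_chartsD[OF N c(2)]
  note A = holo_mapD[OF f c(2) c'']
  let ?Q = "(\<psi> ` O') \<times> (\<phi> ` (D \<inter> f -` D''))"
  have "openin (top_of_set V) ?Q" using A(1) dM(3) eqs by (simp add: openin_Times)
  moreover have "holo_on (\<lambda>z. (\<phi>'' \<circ> f \<circ> inv_into D \<phi>) (snd z)) ?Q"
    by (rule holo_on_compose[OF _ A(2)]) (auto intro!: holo_on_intros)
  then have "holo_on (\<phi>'' \<circ> ?h \<circ> inv_into C \<kappa>) ?Q"
    by (rule iffD1[OF holo_on_cong, rotated])
       (use dM(2) dN(2) in \<open>auto simp: eqs inv_into_map_prod\<close>)
  moreover have "?Q \<subseteq> \<kappa> ` (C \<inter> ?h -` D'')"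
    by (force simp: eqs)
  ultimately show "\<exists>Q. openin (top_of_set V) Q \<and> \<kappa> p \<in> Q \<and> Q \<subseteq> \<kappa> ` (C \<inter> ?h -` D'') \<and>
        holo_on (\<phi>'' \<circ> ?h \<circ> inv_into C \<kappa>) Q"
    using p eqs by (intro exI[of _ ?Q]) auto
qed

section \<open>Quotients and transported structures\<close>

lemma push_mfd_simps [simp]: "pts (push_mfd M q) = q ` pts M"
  by (simp add: push_mfd_def)

lemma push_mfd_chartE:
  assumes "(W, C, \<kappa>) \<in> charts (push_mfd M q)"
  obtains D \<phi> N where "(W, D, \<phi>) \<in> charts M" "N \<subseteq> D" "openin (top_of_set W) (\<phi> ` N)" "inj_on q N"
    "C = q ` N" "\<kappa> = \<phi> \<circ> inv_into N q"
  using assms unfolding push_mfd_def by auto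

lemma push_mfd_chartI:
  "\<lbrakk>(W, D, \<phi>) \<in> charts M; N \<subseteq> D; openin (top_of_set W) (\<phi> ` N); inj_on q N\<rbrakk> \<Longrightarrow>
   (W, q ` N, \<phi> \<circ> inv_into N q) \<in> charts (push_mfd M q)"
  unfolding push_mfd_def by auto

lemma proper_charts_push:
  assumes "proper_charts M"
  shows "proper_charts (push_mfd M q)"
proof (rule proper_chartsI)
  fix W C \<kappa> assume "(W, C, \<kappa>) \<in> charts (push_mfd M q)"
  then obtain D \<phi> N where c: "(W, D, \<phi>) \<in> charts M" "N \<subseteq> D" "openin (top_of_set W) (\<phi> ` N)"
    "inj_on q N" "C = q ` N" "\<kappa> = \<phi> \<circ> inv_into N q" by (rule push_mfd_chartE)
  note d = proper_chartsD[OF assms c(1)]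
  show "C \<subseteq> pts (push_mfd M q)" using c d by auto
  have *: "\<kappa> (q x) = \<phi> x" if "x \<in> N" for x using that c by simp
  show "inj_on \<kappa> C"
    unfolding c(5,6) using c(2,4)
    by (intro comp_inj_on inj_on_inv_into subset_refl inj_on_subset[OF d(2)]) auto
  have "\<kappa> ` C = \<phi> ` N" using * c(5) by (auto simp: image_iff)
  then show "openin (top_of_set W) (\<kappa> ` C)" using c by simp
qed

text \<open>The universal property of the pushed structure, with a parameter. A chart of
  \<open>push_mfd M q\<close> is a chart of \<open>M\<close> cut down to a set \<open>N\<close> on
  which \<open>q\<close> is injective, so in it \<open>f\<close> has the same coordinate expression
  as its composite with \<open>q\<close>.\<close>

lemma holo_map_push_prod:
  assumes M: "proper_charts M" and P: "proper_charts P"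
    and g: "holo_map (prod_mfd M P) K (\<lambda>(m, p). f (q m, p))"
  shows "holo_map (prod_mfd (push_mfd M q) P) K f"
proof (rule holo_mapI)
  let ?h = "\<lambda>(m, p). f (q m, p)"
  show "f \<in> pts (prod_mfd (push_mfd M q) P) \<rightarrow> pts K"
    using holo_map_in[OF g, of "(m, p)" for m p] by (auto simp: Pi_iff)
  fix V C \<kappa> W'' D'' \<phi>'' p
  assume c0: "(V, C, \<kappa>) \<in> charts (prod_mfd (push_mfd M q) P)" and c'': "(W'', D'', \<phi>'') \<in> charts K"
    and p: "p \<in> C" "f p \<in> D''"
  from c0 obtain U O' \<psi> W D \<phi> where c1: "(U, O', \<psi>) \<in> charts (push_mfd M q)" "(W, D, \<phi>) \<in> charts P"
    and eqs: "V = U \<times> W" "C = O' \<times> D" "\<kappa> = map_prod \<psi> \<phi>" by (rule prod_mfd_chartE)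
  from c1(1) obtain D0 \<phi>0 N where c: "(U, D0, \<phi>0) \<in> charts M" "N \<subseteq> D0" "openin (top_of_set U) (\<phi>0 ` N)"
    "inj_on q N" and eqs': "O' = q ` N" "\<psi> = \<phi>0 \<circ> inv_into N q" by (rule push_mfd_chartE)
  note dM = proper_chartsD[OF M c(1)] and dP = proper_chartsD[OF P c1(2)]
  have psi: "\<psi> (q x) = \<phi>0 x" if "x \<in> N" for x using that c eqs' by simp
  have inj: "inj_on \<psi> O'"
    unfolding eqs' using c(2,4)
    by (intro comp_inj_on inj_on_inv_into subset_refl inj_on_subset[OF dM(2)]) auto
  define B where "B = map_prod \<phi>0 \<phi> ` ((D0 \<times> D) \<inter> ?h -` D'')"
  note B = holo_mapD[OF g prod_mfd_chartI[OF c(1) c1(2)] c'', folded B_def]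
  \<comment> \<open>\<open>B\<close> belongs to the full chart domain \<open>D0\<close>, whereas the
    chart of the quotient only sees \<open>N\<close>.\<close>
  let ?Q = "B \<inter> (\<phi>0 ` N) \<times> W"
  have "openin (top_of_set V) ?Q"
    using B(1) c(3) eqs by (intro openin_Int) (auto simp: openin_Times)
  moreover have mem: "\<exists>m x. m \<in> N \<and> x \<in> D \<and> f (q m, x) \<in> D'' \<and> z = (\<phi>0 m, \<phi> x)" if z: "z \<in> ?Q" for z
  proof -
    obtain m x where mx: "m \<in> D0" "x \<in> D" "f (q m, x) \<in> D''" "z = (\<phi>0 m, \<phi> x)"
      using z by (auto simp: B_def)
    moreover have "\<phi>0 m \<in> \<phi>0 ` N" using z mx by auto
    then have "m \<in> N" using inj_on_image_mem_iff[OF dM(2) mx(1) c(2)] by blast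
    ultimately show ?thesis by blast
  qed
  moreover have "holo_on (\<phi>'' \<circ> f \<circ> inv_into C \<kappa>) ?Q"
  proof (rule iffD1[OF holo_on_cong holo_on_subset[OF B(2)]])
    fix z assume "z \<in> ?Q"
    then obtain m x where mx: "m \<in> N" "x \<in> D" "z = (\<phi>0 m, \<phi> x)" using mem by blast
    moreover have "inv_into (D0 \<times> D) (map_prod \<phi>0 \<phi>) z = (m, x)"
      using mx c(2) dM(2) dP(2) by (auto intro!: inv_into_map_prod)
    moreover have "inv_into C \<kappa> z = (q m, x)"
      using inv_into_map_prod[OF inj dP(2), of "q m" x] mx by (simp add: eqs psi eqs'(1))
    ultimately show "(\<phi>'' \<circ> ?h \<circ> inv_into (D0 \<times> D) (map_prod \<phi>0 \<phi>)) z = (\<phi>'' \<circ> f \<circ> inv_into C \<kappa>) z"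
      by simp
  qed auto
  moreover have "?Q \<subseteq> \<kappa> ` (C \<inter> f -` D'')"
  proof
    fix z assume "z \<in> ?Q"
    then obtain m x where "m \<in> N" "x \<in> D" "f (q m, x) \<in> D''" "z = (\<phi>0 m, \<phi> x)" using mem by blast
    then show "z \<in> \<kappa> ` (C \<inter> f -` D'')"
      by (intro image_eqI[of _ _ "(q m, x)"]) (auto simp: eqs psi eqs'(1))
  qed
  moreover have "\<kappa> p \<in> ?Q"
  proof -
    obtain m x where "m \<in> N" "x \<in> D" "p = (q m, x)" using p by (auto simp: eqs eqs')
    then show ?thesis
      using p c(2) openin_imp_subset[OF dP(3)]
      by (auto simp: eqs psi B_def intro!: image_eqI[of _ _ "(m, x)"])
  qed
  ultimately show "\<exists>Q. openin (top_of_set V) Q \<and> \<kappa> p \<in> Q \<and> Q \<subseteq> \<kappa> ` (C \<inter> f -` D'') \<and>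
        holo_on (\<phi>'' \<circ> f \<circ> inv_into C \<kappa>) Q"
    by (intro exI[of _ ?Q] conjI)
qed

section \<open>Projectivized line bundles\<close>

lemma fiber_iff: "e \<in> fiber E x \<longleftrightarrow> e \<in> total E \<and> bproj E e = x"
  by (simp add: fiber_def)

lemma total_mfd_simps [simp]: "pts (total_mfd X E) = total E"
  by (simp add: total_mfd_def)

lemma total_mfd_chartE:
  assumes "(V, C, \<kappa>) \<in> charts (total_mfd X E)"
  obtains W D \<phi> U t where "(W, D, \<phi>) \<in> charts X" "(U, t) \<in> trivs E" "V = W \<times> UNIV"
    "C = {e \<in> total E. bproj E e \<in> D \<inter> U}" "\<kappa> = (\<lambda>e. (\<phi> (bproj E e), t e))"
  using assms unfolding total_mfd_def by auto

lemma total_mfd_chartI: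
  "\<lbrakk>(W, D, \<phi>) \<in> charts X; (U, t) \<in> trivs E\<rbrakk> \<Longrightarrow>
   (W \<times> UNIV, {e \<in> total E. bproj E e \<in> D \<inter> U}, \<lambda>e. (\<phi> (bproj E e), t e)) \<in> charts (total_mfd X E)"
  unfolding total_mfd_def by (simp, intro exI conjI) (rule refl | assumption)+

text \<open>Phrased through openness and fibrewise bijectivity of the trivializations, so that it
  covers the given bundle and \<open>AH_bundle\<close> alike.\<close>

lemma proper_charts_total:
  fixes E :: "('e, 'x, 'f::complex_normed_vector) vbundle"
    and X :: "('x, 'v::complex_normed_vector) cmfd"
  assumes X: "proper_charts X"
    and triv: "\<And>U t. (U, t) \<in> trivs E \<Longrightarrow> mfd_open X U"
      "\<And>U t x. (U, t) \<in> trivs E \<Longrightarrow> x \<in> U \<Longrightarrow> bij_betw t (fiber E x) UNIV"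
  shows "proper_charts (total_mfd X E)"
proof (rule proper_chartsI)
  fix V C \<kappa> assume "(V, C, \<kappa>) \<in> charts (total_mfd X E)"
  then obtain W D \<phi> U t where c: "(W, D, \<phi>) \<in> charts X" "(U, t) \<in> trivs E" "V = W \<times> UNIV"
    "C = {e \<in> total E. bproj E e \<in> D \<inter> U}" "\<kappa> = (\<lambda>e. (\<phi> (bproj E e), t e))" by (rule total_mfd_chartE)
  note dX = proper_chartsD[OF X c(1)]
  show "C \<subseteq> pts (total_mfd X E)" using c by auto
  show "inj_on \<kappa> C"
  proof (rule inj_onI)
    fix e e' assume e: "e \<in> C" "e' \<in> C" "\<kappa> e = \<kappa> e'"
    then have "bproj E e = bproj E e'" using dX(2) by (auto simp: c inj_on_eq_iff)
    then show "e = e'"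
      using e triv(2)[OF c(2), of "bproj E e"] by (auto simp: c bij_betw_def fiber_iff inj_on_def)
  qed
  have "\<kappa> ` C = \<phi> ` (D \<inter> U) \<times> UNIV"
  proof (intro equalityI subsetI)
    fix z assume "z \<in> \<phi> ` (D \<inter> U) \<times> (UNIV :: 'f set)"
    then obtain x a where z: "z = (\<phi> x, a)" "x \<in> D" "x \<in> U" by auto
    then obtain e where "e \<in> fiber E x" "t e = a"
      using triv(2)[OF c(2), of x] by (auto simp: bij_betw_def) (metis UNIV_I imageE)
    then show "z \<in> \<kappa> ` C" using z by (auto simp: c fiber_iff image_iff)
  qed (auto simp: c)
  then show "openin (top_of_set V) (\<kappa> ` C)"
    using triv(1)[OF c(2)] c(1) by (auto simp: mfd_open_def c(3) openin_Times)
qed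

lemma covered_total:
  assumes "covered X" "bproj E \<in> total E \<rightarrow> pts X" "\<And>x. x \<in> pts X \<Longrightarrow> \<exists>(U, t) \<in> trivs E. x \<in> U"
  shows "covered (total_mfd X E)"
  unfolding covered_def
proof
  fix e assume "e \<in> pts (total_mfd X E)"
  then have e: "e \<in> total E" "bproj E e \<in> pts X" using assms(2) by auto
  obtain W D \<phi> where "(W, D, \<phi>) \<in> charts X" "bproj E e \<in> D" using coveredE[OF assms(1) e(2)] .
  moreover obtain U t where "(U, t) \<in> trivs E" "bproj E e \<in> U" using assms(3)[OF e(2)] by auto
  ultimately show "\<exists>(W, D, \<phi>)\<in>charts (total_mfd X E). e \<in> D"
    using e by (intro bexI[OF _ total_mfd_chartI]) auto
qed

text \<open>The line [e : b] in homogeneous coordinates. A vector of the trivial bundle carries its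
  base point along, hence the repeated \<open>bproj E e\<close>.\<close>

definition line_pt :: "('e, 'x, complex) vbundle \<Rightarrow> 'e \<Rightarrow> complex \<Rightarrow> ('e \<times> ('x \<times> complex)) set" where
  "line_pt E e b = range (\<lambda>c. (fsmul E c e, (bproj E e, c * b)))"

text \<open>The new base point is read off as \<open>bproj E (u e)\<close>, so the translation does
  not enter as a separate datum. The restriction to lines is forced by \<open>Bij\<close>, whose
  elements are extensional.\<close>

definition proj_lift :: "('x, 'v) cmfd \<Rightarrow> ('e, 'x, complex) vbundle \<Rightarrow> ('e \<Rightarrow> 'e) \<Rightarrow>
    ('e \<times> ('x \<times> complex)) set \<Rightarrow> ('e \<times> ('x \<times> complex)) set" where
  "proj_lift X E u = (\<lambda>m \<in> proj_lines (direct_sum E (trivial_bundle X)).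
     (\<lambda>(e, (_, b)). (u e, (bproj E (u e), b))) ` m)"

text \<open>On one-dimensional fibres homogeneity amounts to linearity; injectivity ensures that
  lines go to lines.\<close>

definition fibre_linear :: "('e, 'x, 'f) vbundle \<Rightarrow> ('e \<Rightarrow> 'e) \<Rightarrow> bool" where
  "fibre_linear E u \<longleftrightarrow> inj_on u (total E) \<and>
     (\<forall>e\<in>total E. u e \<in> total E \<and> (\<forall>c. u (fsmul E c e) = fsmul E c (u e)))"

text \<open>The affine coordinate of the line \<open>[z : b]\<close>, selected by \<open>k\<close>, and its denominator.\<close>

definition aff :: "bool \<Rightarrow> complex \<Rightarrow> complex \<Rightarrow> complex" where
  "aff k z b = (if k then z / b else b / z)"

definition den :: "bool \<Rightarrow> complex \<Rightarrow> complex \<Rightarrow> complex" where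
  "den k z b = (if k then b else z)"

text \<open>The entry that is normalized to 1 equals \<open>x * den k z b\<close>, so
  \<open>x\<close> must be the reciprocal of the denominator; the remaining entry is then the
  quotient \<open>aff k z b\<close>.\<close>

lemma affine_coordinate:
  "(if k then (c, 1) else (1, c)) \<in> range (\<lambda>x. (x * z, x * b)) \<longleftrightarrow> den k z b \<noteq> 0 \<and> c = aff k z b"
proof
  assume "(if k then (c, 1) else (1, c)) \<in> range (\<lambda>x. (x * z, x * b))"
  then obtain x where "(if k then (c, 1) else (1, c)) = (x * z, x * b)" by blast
  then have x: "x * den k z b = 1" "c = x * (if k then z else b)"
    by (auto simp: den_def split: if_splits)
  then have nz: "den k z b \<noteq> 0" by auto
  then have "x = 1 / den k z b" using x(1) by (simp add: eq_divide_eq)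
  then show "den k z b \<noteq> 0 \<and> c = aff k z b" using nz x(2) by (simp add: aff_def den_def)
next
  assume "den k z b \<noteq> 0 \<and> c = aff k z b"
  then show "(if k then (c, 1) else (1, c)) \<in> range (\<lambda>x. (x * z, x * b))"
    by (intro image_eqI[of _ _ "1 / den k z b"]) (auto simp: aff_def den_def split: if_splits)
qed

section \<open>Homogeneous coordinates on the projectivized sum\<close>

locale complex_line_bundle =
  fixes X :: "('x, 'v::complex_normed_vector) cmfd" and E :: "('e, 'x, complex) vbundle"
  assumes proper_base: "proper_charts X"
    and holo_bundle: "holomorphic_line_bundle X E"
begin

abbreviation "Y \<equiv> projectivization X (direct_sum E (trivial_bundle X))"

lemma bproj_in: "e \<in> total E \<Longrightarrow> bproj E e \<in> pts X"
  using holo_bundle unfolding holomorphic_bundle_def by (elim conjE funcset_mem)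

lemma fadd_in:
  assumes "a \<in> fiber E x" "b \<in> fiber E x" "x \<in> pts X"
  shows "fadd E a b \<in> fiber E x"
proof -
  have "\<forall>x\<in>pts X. \<forall>a\<in>fiber E x. \<forall>b\<in>fiber E x. \<forall>c. fadd E a b \<in> fiber E x \<and> fsmul E c a \<in> fiber E x"
    using holo_bundle unfolding holomorphic_bundle_def by (elim conjE)
  then show ?thesis using assms by blast
qed

lemma fsmul_in:
  assumes e: "e \<in> total E"
  shows "fsmul E c e \<in> total E" "bproj E (fsmul E c e) = bproj E e"
proof -
  have "\<forall>x\<in>pts X. \<forall>a\<in>fiber E x. \<forall>b\<in>fiber E x. \<forall>c. fadd E a b \<in> fiber E x \<and> fsmul E c a \<in> fiber E x"
    using holo_bundle unfolding holomorphic_bundle_def by (elim conjE)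
  moreover have "e \<in> fiber E (bproj E e)" using e by (simp add: fiber_iff)
  ultimately have "fsmul E c e \<in> fiber E (bproj E e)" using bproj_in[OF e] by blast
  then show "fsmul E c e \<in> total E" "bproj E (fsmul E c e) = bproj E e" by (simp_all add: fiber_iff)
qed

lemma triv:
  assumes "(U, t) \<in> trivs E"
  shows "mfd_open X U \<and> (\<forall>x\<in>U. bij_betw t (fiber E x) UNIV \<and>
    (\<forall>a\<in>fiber E x. \<forall>b\<in>fiber E x. \<forall>c. t (fadd E a b) = t a + t b \<and> t (fsmul E c a) = c *\<^sub>C t a))"
proof -
  have "\<forall>(U, t) \<in> trivs E. mfd_open X U \<and> (\<forall>x\<in>U. bij_betw t (fiber E x) UNIV \<and>
    (\<forall>a\<in>fiber E x. \<forall>b\<in>fiber E x. \<forall>c. t (fadd E a b) = t a + t b \<and> t (fsmul E c a) = c *\<^sub>C t a))"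
    using holo_bundle unfolding holomorphic_bundle_def by (elim conjE)
  from bspec[OF this assms] show ?thesis by simp
qed

lemma triv_open: "(U, t) \<in> trivs E \<Longrightarrow> mfd_open X U"
  using triv by blast

lemma triv_subset: "(U, t) \<in> trivs E \<Longrightarrow> U \<subseteq> pts X"
  using triv_open unfolding mfd_open_def by blast

lemma triv_bij: "(U, t) \<in> trivs E \<Longrightarrow> x \<in> U \<Longrightarrow> bij_betw t (fiber E x) UNIV"
  using triv by blast

lemma triv_fsmul:
  assumes "(U, t) \<in> trivs E" "e \<in> total E" "bproj E e \<in> U"
  shows "t (fsmul E c e) = c * t e"
proof -
  have "e \<in> fiber E (bproj E e)" using assms(2) by (simp add: fiber_iff)
  then have "t (fsmul E c e) = c *\<^sub>C t e" using triv[OF assms(1)] assms(3) by blast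
  then show ?thesis by (simp add: scaleC_complex_def)
qed

lemma triv_inj:
  assumes "(U, t) \<in> trivs E" "e \<in> total E" "e' \<in> total E" "bproj E e = bproj E e'" "bproj E e \<in> U" "t e = t e'"
  shows "e = e'"
  using triv_bij[OF assms(1,5)] assms(2-6) by (auto simp: bij_betw_def inj_on_def fiber_iff)

lemma triv_surj:
  assumes "(U, t) \<in> trivs E" "x \<in> U"
  obtains e where "e \<in> total E" "bproj E e = x" "t e = a"
proof -
  have "a \<in> t ` fiber E x" using triv_bij[OF assms] by (simp add: bij_betw_def)
  then show ?thesis using that by (auto simp: fiber_iff)
qed

lemma trivE:
  assumes "x \<in> pts X"
  obtains U t where "(U, t) \<in> trivs E" "x \<in> U"
proof -
  have "\<forall>x\<in>pts X. \<exists>(U, t) \<in> trivs E. x \<in> U"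
    using holo_bundle unfolding holomorphic_bundle_def by (elim conjE)
  then show ?thesis using assms that by blast
qed

text \<open>The bundle record states no module laws for the fibres; they are pulled back from the
  model fibre through a trivialization.\<close>

lemma fsmul_fsmul:
  assumes e: "e \<in> total E"
  shows "fsmul E c (fsmul E d e) = fsmul E (c * d) e"
proof -
  obtain U t where t: "(U, t) \<in> trivs E" "bproj E e \<in> U" using trivE[OF bproj_in[OF e]] .
  show ?thesis
    using t e by (intro triv_inj[OF t(1)]) (simp_all add: fsmul_in triv_fsmul)
qed

lemma fsmul_one:
  assumes e: "e \<in> total E"
  shows "fsmul E 1 e = e"
proof -
  obtain U t where t: "(U, t) \<in> trivs E" "bproj E e \<in> U" using trivE[OF bproj_in[OF e]] .
  show ?thesis
    using t e by (intro triv_inj[OF t(1)]) (simp_all add: fsmul_in triv_fsmul)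
qed

lemma triv_zero_iff:
  assumes "(U, t) \<in> trivs E" "e \<in> total E" "bproj E e \<in> U"
  shows "fsmul E 0 e = e \<longleftrightarrow> t e = 0"
  using triv_inj[OF assms(1), of "fsmul E 0 e" e] triv_fsmul[OF assms, of 0] assms fsmul_in[OF assms(2), of 0]
  by auto

lemma proper_charts_total_space: "proper_charts (total_mfd X E)"
  by (rule proper_charts_total[OF proper_base triv_open triv_bij])

lemma mem_line_pt: "e \<in> total E \<Longrightarrow> (e, (bproj E e, b)) \<in> line_pt E e b"
  unfolding line_pt_def by (rule image_eqI[of _ _ 1]) (simp_all add: fsmul_one)

lemma pts_Y: "pts Y = {line_pt E e b | e b. e \<in> total E \<and> (fsmul E 0 e \<noteq> e \<or> b \<noteq> 0)}"
proof -
  let ?F = "direct_sum E (trivial_bundle X)"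
  have total: "p \<in> total ?F \<longleftrightarrow> (\<exists>e b. e \<in> total E \<and> p = (e, (bproj E e, b)))" for p
    using bproj_in by (cases p) (auto simp: direct_sum_def trivial_bundle_def)
  have smul: "fsmul ?F c (e, (x, b)) = (fsmul E c e, (x, c * b))" for c e x b
    by (simp add: direct_sum_def trivial_bundle_def)
  have "proj_lines ?F = {range (\<lambda>c. fsmul ?F c (e, (bproj E e, b))) | e b.
      e \<in> total E \<and> fsmul ?F 0 (e, (bproj E e, b)) \<noteq> (e, (bproj E e, b))}"
    unfolding proj_lines_def total by blast
  then show ?thesis by (simp add: projectivization_def smul line_pt_def eq_commute[of 0])
qed

lemma line_ptI: "e \<in> total E \<Longrightarrow> fsmul E 0 e \<noteq> e \<or> b \<noteq> 0 \<Longrightarrow> line_pt E e b \<in> pts Y"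
  unfolding pts_Y by blast

lemma line_ptE:
  assumes "y \<in> pts Y"
  obtains e b where "e \<in> total E" "fsmul E 0 e \<noteq> e \<or> b \<noteq> 0" "y = line_pt E e b"
  using assms unfolding pts_Y by blast

lemma proj_base_line_pt:
  assumes e: "e \<in> total E"
  shows "proj_base (direct_sum E (trivial_bundle X)) (line_pt E e b) = bproj E e"
  unfolding proj_base_def
proof (rule the_equality)
  show "line_pt E e b \<subseteq> fiber (direct_sum E (trivial_bundle X)) (bproj E e)"
    using e by (auto simp: line_pt_def fiber_def direct_sum_def trivial_bundle_def fsmul_in bproj_in)
  fix x assume "line_pt E e b \<subseteq> fiber (direct_sum E (trivial_bundle X)) x"
  then show "x = bproj E e"
    using mem_line_pt[OF e, of b] by (auto simp: fiber_def direct_sum_def)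
qed

lemma line_pt_scale:
  assumes e: "e \<in> total E" and r: "r \<noteq> 0"
  shows "line_pt E (fsmul E r e) (r * b) = line_pt E e b"
proof -
  have "line_pt E (fsmul E r e) (r * b) = (\<lambda>c. (fsmul E c e, (bproj E e, c * b))) ` range (\<lambda>c. c * r)"
    unfolding line_pt_def image_image using e by (simp add: fsmul_fsmul fsmul_in mult.assoc)
  also have "range (\<lambda>c. c * r) = UNIV"
    using r by (intro surjI[of _ "\<lambda>c. c / r"]) simp
  finally show ?thesis by (simp add: line_pt_def)
qed

text \<open>Replaces line sets and definite descriptions by homogeneous coordinates [t e : b]: the
  chart is where the denominator selected by \<open>k\<close> is nonzero, and its fibre coordinate
  is the quotient. The last clause gives each line a representative with denominator 1.\<close>

lemma Y_chartE:
  assumes "(V, C, \<kappa>) \<in> charts Y"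
  obtains W D \<phi> U t k where "(W, D, \<phi>) \<in> charts X" "(U, t) \<in> trivs E" "V = W \<times> UNIV" "C \<subseteq> pts Y"
    "\<And>e b. e \<in> total E \<Longrightarrow> (line_pt E e b \<in> C \<longleftrightarrow> bproj E e \<in> D \<inter> U \<and> den k (t e) b \<noteq> 0)"
    "\<And>e b. e \<in> total E \<Longrightarrow> bproj E e \<in> D \<inter> U \<Longrightarrow> den k (t e) b \<noteq> 0 \<Longrightarrow>
       \<kappa> (line_pt E e b) = (\<phi> (bproj E e), aff k (t e) b)"
    "\<And>y. y \<in> C \<Longrightarrow> \<exists>e c. e \<in> total E \<and> bproj E e \<in> D \<inter> U \<and> t e = (if k then c else 1) \<and>
       y = line_pt E e (if k then 1 else c)"
proof -
  let ?F = "direct_sum E (trivial_bundle X)"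
  obtain W D \<phi> U' t' s where c: "(W, D, \<phi>) \<in> charts X" "(U', t') \<in> trivs ?F"
    "s = (\<lambda>c. (c, 1)) \<or> s = (\<lambda>c. (1, c))" "V = W \<times> UNIV"
    "C = {m \<in> proj_lines ?F. proj_base ?F m \<in> D \<inter> U' \<and> (\<exists>c. s c \<in> t' ` m)}"
    "\<kappa> = (\<lambda>m. (\<phi> (proj_base ?F m), THE c. s c \<in> t' ` m))"
  proof -
    have "\<exists>cx\<in>charts X. \<exists>ct\<in>trivs ?F. \<exists>s\<in>{\<lambda>c. (c, 1), \<lambda>c. (1, c)}. (V, C, \<kappa>) =
      (fst cx \<times> UNIV, {m \<in> proj_lines ?F. proj_base ?F m \<in> fst (snd cx) \<inter> fst ct \<and> (\<exists>c. s c \<in> snd ct ` m)},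
       \<lambda>m. (snd (snd cx) (proj_base ?F m), THE c. s c \<in> snd ct ` m))"
      using assms unfolding projectivization_def split_beta by simp blast
    then obtain cx ct s where *: "cx \<in> charts X" "ct \<in> trivs ?F" "s = (\<lambda>c. (c, 1)) \<or> s = (\<lambda>c. (1, c))"
      "(V, C, \<kappa>) =
      (fst cx \<times> UNIV, {m \<in> proj_lines ?F. proj_base ?F m \<in> fst (snd cx) \<inter> fst ct \<and> (\<exists>c. s c \<in> snd ct ` m)},
       \<lambda>m. (snd (snd cx) (proj_base ?F m), THE c. s c \<in> snd ct ` m))"
      by blast
    show ?thesis
      by (rule that[of "fst cx" "fst (snd cx)" "snd (snd cx)" "fst ct" "snd ct" s]) (use * in simp_all)
  qed
  obtain U t where t: "(U, t) \<in> trivs E" "U' = U" "t' = (\<lambda>(a, p). (t a, snd p))"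
  proof -
    obtain U t where "(U, t) \<in> trivs E" "U' = U \<inter> pts X" "t' = (\<lambda>(a, p). (t a, snd p))"
      using c(2) by (auto simp: direct_sum_def trivial_bundle_def)
    \<comment> \<open>The trivial bundle has a single trivialization over the whole base, so
      intersecting with its domain leaves \<open>U\<close> unchanged.\<close>
    then show ?thesis using that triv_subset by (metis Int_absorb2)
  qed
  obtain k where k: "s = (\<lambda>c. if k then (c, 1) else (1, c))"
    using c(3) by (metis (full_types))
  have im: "t' ` line_pt E e b = range (\<lambda>c. (c * t e, c * b))"
    if "e \<in> total E" "bproj E e \<in> U" for e b
    unfolding line_pt_def t(3) image_image using that t(1) by (simp add: triv_fsmul)
  have mem: "s c \<in> t' ` line_pt E e b \<longleftrightarrow> den k (t e) b \<noteq> 0 \<and> c = aff k (t e) b"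
    if "e \<in> total E" "bproj E e \<in> U" for e b c
    unfolding im[OF that] k by (rule affine_coordinate)
  have C: "line_pt E e b \<in> C \<longleftrightarrow> bproj E e \<in> D \<inter> U \<and> den k (t e) b \<noteq> 0" if e: "e \<in> total E" for e b
  proof -
    have "line_pt E e b \<in> pts Y" if "bproj E e \<in> U" "den k (t e) b \<noteq> 0"
      using that e triv_zero_iff[OF t(1) e] by (intro line_ptI) (auto simp: den_def split: if_splits)
    then have "line_pt E e b \<in> proj_lines ?F" if "bproj E e \<in> U" "den k (t e) b \<noteq> 0"
      using that by (simp add: projectivization_def)
    then show ?thesis
      using e mem by (auto simp: c(5) t(2) proj_base_line_pt)
  qed
  show ?thesis
  proof (rule that[OF c(1) t(1) c(4) _ C])
    show "C \<subseteq> pts Y" by (auto simp: c(5) projectivization_def)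
    show "\<kappa> (line_pt E e b) = (\<phi> (bproj E e), aff k (t e) b)"
      if "e \<in> total E" "bproj E e \<in> D \<inter> U" "den k (t e) b \<noteq> 0" for e b
      using that mem by (simp add: c(6) proj_base_line_pt)
    show "\<exists>e c. e \<in> total E \<and> bproj E e \<in> D \<inter> U \<and> t e = (if k then c else 1) \<and>
       y = line_pt E e (if k then 1 else c)" if y: "y \<in> C" for y
    proof -
      have "y \<in> pts Y" using y by (simp add: c(5) projectivization_def)
      then obtain e b where e: "e \<in> total E" "y = line_pt E e b" by (rule line_ptE)
      then have eb: "bproj E e \<in> D \<inter> U" "den k (t e) b \<noteq> 0" using C y by auto
      \<comment> \<open>Rescaling by \<open>?r\<close> does not change the line and makes its
        denominator 1.\<close>
      let ?r = "inverse (den k (t e) b)"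
      have "y = line_pt E (fsmul E ?r e) (?r * b)" using e eb by (simp add: line_pt_scale)
      then show ?thesis
        using e eb t(1)
        by (intro exI[of _ "fsmul E ?r e"] exI[of _ "aff k (t e) b"])
           (auto simp: fsmul_in triv_fsmul den_def aff_def field_simps)
    qed
  qed
qed

text \<open>By the normal form, a line in the chart is given by a base point and the free coordinate
  \<open>c\<close>: these fix \<open>t e\<close>, hence \<open>e\<close> by \<open>triv_inj\<close>.
  Conversely each such pair occurs, so the image is a full product with the complex plane.\<close>

lemma proper_charts_Y: "proper_charts Y"
proof (rule proper_chartsI)
  fix V C \<kappa> assume "(V, C, \<kappa>) \<in> charts Y"
  then obtain W D \<phi> U t k where c: "(W, D, \<phi>) \<in> charts X" "(U, t) \<in> trivs E" "V = W \<times> UNIV" "C \<subseteq> pts Y"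
    and mem: "\<And>e b. e \<in> total E \<Longrightarrow> (line_pt E e b \<in> C \<longleftrightarrow> bproj E e \<in> D \<inter> U \<and> den k (t e) b \<noteq> 0)"
    and \<kappa>: "\<And>e b. e \<in> total E \<Longrightarrow> bproj E e \<in> D \<inter> U \<Longrightarrow> den k (t e) b \<noteq> 0 \<Longrightarrow>
       \<kappa> (line_pt E e b) = (\<phi> (bproj E e), aff k (t e) b)"
    and normal: "\<And>y. y \<in> C \<Longrightarrow> \<exists>e c. e \<in> total E \<and> bproj E e \<in> D \<inter> U \<and> t e = (if k then c else 1) \<and>
       y = line_pt E e (if k then 1 else c)"
    by (rule Y_chartE) blast
  note dX = proper_chartsD[OF proper_base c(1)]
  have \<kappa>': "\<kappa> (line_pt E e (if k then 1 else c)) = (\<phi> (bproj E e), c)"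
    if "e \<in> total E" "bproj E e \<in> D \<inter> U" "t e = (if k then c else 1)" for e c
    using \<kappa>[OF that(1,2), of "if k then 1 else c"] that(3) by (auto simp: aff_def den_def)
  show "C \<subseteq> pts Y" by (rule c(4))
  show "inj_on \<kappa> C"
  proof (rule inj_onI)
    fix y y' assume y: "y \<in> C" "y' \<in> C" and eq: "\<kappa> y = \<kappa> y'"
    obtain e c where e: "e \<in> total E" "bproj E e \<in> D \<inter> U" "t e = (if k then c else 1)"
       "y = line_pt E e (if k then 1 else c)" using normal[OF y(1)] by blast
    obtain e' c' where e': "e' \<in> total E" "bproj E e' \<in> D \<inter> U" "t e' = (if k then c' else 1)"
       "y' = line_pt E e' (if k then 1 else c')" using normal[OF y(2)] by blast
    have "\<phi> (bproj E e) = \<phi> (bproj E e')" "c = c'"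
      using eq \<kappa>'[OF e(1-3)] \<kappa>'[OF e'(1-3)] e(4) e'(4) by auto
    then have "bproj E e = bproj E e'" using e(2) e'(2) dX(2) by (auto simp: inj_on_eq_iff)
    then have "e = e'" using e e' \<open>c = c'\<close> by (intro triv_inj[OF c(2)]) auto
    then show "y = y'" using e(4) e'(4) \<open>c = c'\<close> by simp
  qed
  have "\<kappa> ` C = \<phi> ` (D \<inter> U) \<times> UNIV"
  proof (intro equalityI subsetI)
    fix z assume "z \<in> \<kappa> ` C"
    then obtain y where y: "y \<in> C" "z = \<kappa> y" by blast
    obtain e c where e: "e \<in> total E" "bproj E e \<in> D \<inter> U" "t e = (if k then c else 1)"
       "y = line_pt E e (if k then 1 else c)" using normal[OF y(1)] by blast
    then show "z \<in> \<phi> ` (D \<inter> U) \<times> UNIV" using y(2) \<kappa>'[OF e(1-3)] by simp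
  next
    fix z assume "z \<in> \<phi> ` (D \<inter> U) \<times> (UNIV :: complex set)"
    then obtain x a where z: "z = (\<phi> x, a)" "x \<in> D" "x \<in> U" by auto
    obtain e where e: "e \<in> total E" "bproj E e = x" "t e = (if k then a else 1)"
      by (rule triv_surj[OF c(2) z(3)])
    have "line_pt E e (if k then 1 else a) \<in> C" using mem[OF e(1)] e z by (simp add: den_def)
    then show "z \<in> \<kappa> ` C"
      using \<kappa>'[of e a] e z by (intro image_eqI[of _ _ "line_pt E e (if k then 1 else a)"]) auto
  qed
  then show "openin (top_of_set V) (\<kappa> ` C)"
    using triv_open[OF c(2)] c(1) by (auto simp: mfd_open_def c(3) openin_Times)
qed

text \<open>If \<open>u e\<close> were zero, \<open>u\<close> would take the same value at
  \<open>fsmul E 0 e\<close> and at \<open>e\<close>, against injectivity.\<close>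

lemma fibre_linear_nonzero:
  assumes "fibre_linear E u" "e \<in> total E" "fsmul E 0 e \<noteq> e"
  shows "fsmul E 0 (u e) \<noteq> u e"
  using assms fsmul_in(1)[OF assms(2), of 0] unfolding fibre_linear_def inj_on_def by metis

lemma proj_lift_line_pt:
  assumes u: "fibre_linear E u" and e: "e \<in> total E" "fsmul E 0 e \<noteq> e \<or> b \<noteq> 0"
  shows "proj_lift X E u (line_pt E e b) = line_pt E (u e) b"
    and "line_pt E (u e) b \<in> pts Y"
proof -
  have "line_pt E e b \<in> proj_lines (direct_sum E (trivial_bundle X))"
    using line_ptI[OF e] by (simp add: projectivization_def)
  then show "proj_lift X E u (line_pt E e b) = line_pt E (u e) b"
    using u e fsmul_in unfolding proj_lift_def line_pt_def fibre_linear_def by (simp add: image_image)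
  show "line_pt E (u e) b \<in> pts Y"
    using u e fibre_linear_nonzero[OF u e(1)] unfolding fibre_linear_def by (intro line_ptI) auto
qed

text \<open>The action on \<open>E\<close> is evaluated only at the vector \<open>e1\<close> with
  fibre coordinate 1 over each base point; homogeneity then determines the image of every line by
  arithmetic with the coordinate of that one image.\<close>

theorem holo_map_proj_lift:
  fixes M :: "('m, 'p::complex_normed_vector) cmfd"
  assumes M: "proper_charts M" and lin: "\<And>m. m \<in> pts M \<Longrightarrow> fibre_linear E (u m)"
    and holo: "holo_map (prod_mfd M (total_mfd X E)) (total_mfd X E) (\<lambda>(m, e). u m e)"
  shows "holo_map (prod_mfd M Y) Y (\<lambda>(m, y). proj_lift X E (u m) y)"
proof (rule holo_mapI)
  let ?f = "\<lambda>(m, y). proj_lift X E (u m) y"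
  let ?act = "\<lambda>(m, e). u m e"
  show "?f \<in> pts (prod_mfd M Y) \<rightarrow> pts Y"
    using lin proj_lift_line_pt by (force elim!: line_ptE)
  fix V C \<kappa> V' C' \<kappa>' p
  assume c0: "(V, C, \<kappa>) \<in> charts (prod_mfd M Y)" and c0': "(V', C', \<kappa>') \<in> charts Y"
    and p: "p \<in> C" "?f p \<in> C'"
  from c0 obtain P O' \<psi> V1 C1 \<kappa>1 where c: "(P, O', \<psi>) \<in> charts M" "(V1, C1, \<kappa>1) \<in> charts Y"
    and eqs: "V = P \<times> V1" "C = O' \<times> C1" "\<kappa> = map_prod \<psi> \<kappa>1" by (rule prod_mfd_chartE)
  from c(2) obtain W D \<phi> U t k where c1: "(W, D, \<phi>) \<in> charts X" "(U, t) \<in> trivs E" "V1 = W \<times> UNIV" "C1 \<subseteq> pts Y"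
    and mem: "\<And>e b. e \<in> total E \<Longrightarrow> (line_pt E e b \<in> C1 \<longleftrightarrow> bproj E e \<in> D \<inter> U \<and> den k (t e) b \<noteq> 0)"
    and \<kappa>1: "\<And>e b. e \<in> total E \<Longrightarrow> bproj E e \<in> D \<inter> U \<Longrightarrow> den k (t e) b \<noteq> 0 \<Longrightarrow>
       \<kappa>1 (line_pt E e b) = (\<phi> (bproj E e), aff k (t e) b)"
    and normal: "\<And>y. y \<in> C1 \<Longrightarrow> \<exists>e c. e \<in> total E \<and> bproj E e \<in> D \<inter> U \<and> t e = (if k then c else 1) \<and>
       y = line_pt E e (if k then 1 else c)"
    by (rule Y_chartE) blast
  from c0' obtain W' D' \<phi>' U' t' k' where c': "(W', D', \<phi>') \<in> charts X" "(U', t') \<in> trivs E"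
    and mem': "\<And>e b. e \<in> total E \<Longrightarrow> (line_pt E e b \<in> C' \<longleftrightarrow> bproj E e \<in> D' \<inter> U' \<and> den k' (t' e) b \<noteq> 0)"
    and \<kappa>': "\<And>e b. e \<in> total E \<Longrightarrow> bproj E e \<in> D' \<inter> U' \<Longrightarrow> den k' (t' e) b \<noteq> 0 \<Longrightarrow>
       \<kappa>' (line_pt E e b) = (\<phi>' (bproj E e), aff k' (t' e) b)"
    by (rule Y_chartE) blast
  note dM = proper_chartsD[OF M c(1)]
  have linO: "fibre_linear E (u m)" if "m \<in> O'" for m using lin dM(1) that by blast
  define DE where "DE = {e \<in> total E. bproj E e \<in> D \<inter> U}"
  define DE' where "DE' = {e \<in> total E. bproj E e \<in> D' \<inter> U'}"
  define \<kappa>E where "\<kappa>E = (\<lambda>e. (\<phi> (bproj E e), t e))"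
  define \<kappa>E' where "\<kappa>E' = (\<lambda>e. (\<phi>' (bproj E e), t' e))"
  have cE: "(W \<times> UNIV, DE, \<kappa>E) \<in> charts (total_mfd X E)" "(W' \<times> UNIV, DE', \<kappa>E') \<in> charts (total_mfd X E)"
    using total_mfd_chartI[OF c1(1,2)] total_mfd_chartI[OF c'] by (simp_all add: DE_def DE'_def \<kappa>E_def \<kappa>E'_def)
  note dE = proper_chartsD[OF proper_charts_total_space cE(1)]
  note dY = proper_chartsD[OF proper_charts_Y c(2)]
  define A where "A = map_prod \<psi> \<kappa>E ` ((O' \<times> DE) \<inter> ?act -` DE')"
  define G where "G = \<kappa>E' \<circ> ?act \<circ> inv_into (O' \<times> DE) (map_prod \<psi> \<kappa>E)"
  have A: "openin (top_of_set (P \<times> W \<times> UNIV)) A" "holo_on G A"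
    using holo_mapD[OF holo prod_mfd_chartI[OF c(1) cE(1)] cE(2)] by (simp_all add: A_def G_def)
  \<comment> \<open>Forgets the affine coordinate on Y and inserts the fibre coordinate 1, so that
    \<open>G (j z)\<close> describes the image of \<open>e1\<close> and \<open>h z\<close> is its
    fibre coordinate.\<close>
  define j where "j = (\<lambda>z :: 'p \<times> 'v \<times> complex. (fst z, (fst (snd z), 1 :: complex)))"
  \<comment> \<open>Between charts of the same kind the new denominator is 1 or \<open>h z\<close>.
    Between charts of opposite kind it is the affine coordinate \<open>snd (snd z)\<close> up to a
    power of \<open>h z\<close>, so that coordinate must stay away from 0.\<close>
  define Q where "Q = (V \<inter> j -` A) \<inter> (V \<inter> {z. k \<noteq> k' \<longrightarrow> snd (snd z) \<noteq> 0})"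
  define h where "h = (\<lambda>z. snd (G (j z)))"
  have j: "holo_on j S" for S unfolding j_def by (intro holo_on_intros)
  have "openin (top_of_set V) (V \<inter> j -` A)"
    by (rule continuous_openin_preimage[OF holo_on_imp_continuous_on[OF j] _ A(1)])
       (auto simp: j_def eqs c1(3))
  moreover have "open {z :: 'p \<times> 'v \<times> complex. k \<noteq> k' \<longrightarrow> snd (snd z) \<noteq> 0}"
    by (cases "k = k'") (auto intro!: open_Collect_neq continuous_intros)
  ultimately have Q: "openin (top_of_set V) Q"
    unfolding Q_def by (rule openin_Int[OF _ openin_open_Int])
  have point: "\<exists>m e1. m \<in> O' \<and> e1 \<in> DE \<and> u m e1 \<in> DE' \<and> t e1 = 1 \<and>
      fst z = \<psi> m \<and> fst (snd z) = \<phi> (bproj E e1) \<and> G (j z) = \<kappa>E' (u m e1) \<and> h z = t' (u m e1) \<and> h z \<noteq> 0"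
    if "z \<in> Q" for z
  proof -
    have "j z \<in> A" using that by (simp add: Q_def)
    then obtain m e1 where me: "m \<in> O'" "e1 \<in> DE" "u m e1 \<in> DE'" "j z = (\<psi> m, \<kappa>E e1)"
      by (auto simp: A_def)
    have G: "G (j z) = \<kappa>E' (u m e1)" using me dM(2) dE(2) by (simp add: G_def inv_into_map_prod)
    have h: "h z = t' (u m e1)" by (simp add: h_def G \<kappa>E'_def)
    \<comment> \<open>Nonvanishing of \<open>h\<close>: \<open>e1\<close> has coordinate 1 and is
      nonzero, hence so is its image.\<close>
    have "fsmul E 0 e1 \<noteq> e1" using triv_zero_iff[OF c1(2)] me by (simp add: DE_def j_def \<kappa>E_def)
    then have "fsmul E 0 (u m e1) \<noteq> u m e1"
      using fibre_linear_nonzero[OF linO] me by (simp add: DE_def)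
    then have "h z \<noteq> 0" using triv_zero_iff[OF c'(2)] me by (simp add: DE'_def h)
    then show ?thesis using me G h by (intro exI[of _ m] exI[of _ e1]) (simp add: j_def \<kappa>E_def)
  qed
  \<comment> \<open>The image of [a : 1] is [a h : 1] and that of [1 : a] is [h : a];
    \<open>k\<close> tells which of the two applies and \<open>k'\<close> which quotient is
    taken.\<close>
  define R where "R = (\<lambda>z. (fst (G (j z)),
    aff k' (if k then snd (snd z) * h z else h z) (if k then 1 else snd (snd z))))"
  have Qexpr: "\<exists>m y. m \<in> O' \<and> y \<in> C1 \<and> ?f (m, y) \<in> C' \<and> z = (\<psi> m, \<kappa>1 y) \<and> \<kappa>' (?f (m, y)) = R z"
    if z: "z \<in> Q" for z
  proof -
    obtain m e1 where me: "m \<in> O'" "e1 \<in> DE" "u m e1 \<in> DE'" "t e1 = 1" "fst z = \<psi> m"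
      "fst (snd z) = \<phi> (bproj E e1)" "G (j z) = \<kappa>E' (u m e1)" "h z = t' (u m e1)" "h z \<noteq> 0"
      using point[OF z] by blast
    define a where "a = snd (snd z)"
    \<comment> \<open>With \<open>b\<close> below, the representative with denominator 1 of the line
      with coordinate \<open>a\<close>, written as a multiple of \<open>e1\<close> so that
      homogeneity of \<open>u m\<close> applies.\<close>
    define e where "e = (if k then fsmul E a e1 else e1)"
    define b where "b = (if k then 1 else a)"
    have e: "e \<in> total E" "bproj E e = bproj E e1" "t e = (if k then a else 1)"
      using me c1(2) by (auto simp: e_def DE_def fsmul_in triv_fsmul)
    have nz: "fsmul E 0 e \<noteq> e \<or> b \<noteq> 0"
      using e me triv_zero_iff[OF c1(2) e(1)] by (auto simp: b_def DE_def)
    have ue: "u m e = (if k then fsmul E a (u m e1) else u m e1)"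
      using linO[OF me(1)] me(2) by (auto simp: fibre_linear_def e_def DE_def)
    have ue_in: "u m e \<in> total E" "bproj E (u m e) = bproj E (u m e1)" "t' (u m e) = (if k then a * h z else h z)"
      using me c'(2) by (auto simp: ue DE'_def fsmul_in triv_fsmul)
    have base: "bproj E e \<in> D \<inter> U" "bproj E (u m e) \<in> D' \<inter> U'"
      using e(2) ue_in(2) me by (auto simp: DE_def DE'_def)
    have den: "den k (t e) b \<noteq> 0" by (simp add: e(3) b_def den_def)
    have den': "den k' (t' (u m e)) b \<noteq> 0"
      using z me(9) unfolding Q_def a_def[symmetric] by (auto simp: ue_in(3) b_def den_def a_def)
    have f: "?f (m, line_pt E e b) = line_pt E (u m e) b"
      using proj_lift_line_pt(1)[OF linO[OF me(1)] e(1) nz] by simp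
    have "z = (\<psi> m, \<kappa>1 (line_pt E e b))"
      using \<kappa>1[OF e(1) base(1) den] e me(5,6) by (simp add: aff_def b_def a_def prod_eq_iff)
    moreover have "\<kappa>' (?f (m, line_pt E e b)) = R z"
      unfolding f using \<kappa>'[OF ue_in(1) base(2) den'] ue_in me(7)
      by (simp add: R_def \<kappa>E'_def b_def a_def)
    ultimately show ?thesis
      using me(1) mem[OF e(1)] mem'[OF ue_in(1)] base den den' f
      by (intro exI[of _ m] exI[of _ "line_pt E e b"]) auto
  qed
  have Gj: "holo_on (\<lambda>z. G (j z)) Q"
    by (rule holo_on_compose[OF j A(2)]) (auto simp: Q_def)
  have h: "holo_on h Q" unfolding h_def by (intro holo_on_snd Gj)
  have hnz: "h z \<noteq> 0" if "z \<in> Q" for z using point[OF that] by blast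
  have a: "holo_on (\<lambda>z. snd (snd z)) Q" by (intro holo_on_intros)
  have anz: "snd (snd z) \<noteq> 0" if "z \<in> Q" "k \<noteq> k'" for z using that by (simp add: Q_def)
  have "holo_on R Q"
    unfolding R_def aff_def
    by (cases k; cases k'; simp; intro holo_on_Pair holo_on_fst Gj holo_on_mult holo_on_divide h a holo_on_const)
       (auto simp: hnz dest: anz)
  moreover have "R z = (\<kappa>' \<circ> ?f \<circ> inv_into C \<kappa>) z" if "z \<in> Q" for z
    using Qexpr[OF that] dM(2) dY(2) by (auto simp: eqs inv_into_map_prod)
  ultimately have "holo_on (\<kappa>' \<circ> ?f \<circ> inv_into C \<kappa>) Q"
    using holo_on_cong by metis
  moreover have "Q \<subseteq> \<kappa> ` (C \<inter> ?f -` C')"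
  proof
    fix z assume "z \<in> Q"
    then obtain m y where "m \<in> O'" "y \<in> C1" "?f (m, y) \<in> C'" "z = (\<psi> m, \<kappa>1 y)"
      using Qexpr by blast
    then show "z \<in> \<kappa> ` (C \<inter> ?f -` C')"
      by (intro image_eqI[of _ _ "(m, y)"]) (auto simp: eqs)
  qed
  moreover have "\<kappa> p \<in> Q"
  proof -
    obtain m y where my: "p = (m, y)" "m \<in> O'" "y \<in> C1" using p eqs by auto
    obtain e a where e: "e \<in> total E" "bproj E e \<in> D \<inter> U" "t e = (if k then a else 1)"
       "y = line_pt E e (if k then 1 else a)" using normal[OF my(3)] by blast
    have base: "bproj E e \<in> U" using e by simp
    obtain e1 where e1: "e1 \<in> total E" "bproj E e1 = bproj E e" "t e1 = 1"
      by (rule triv_surj[OF c1(2) base])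
    have ee1: "e = (if k then fsmul E a e1 else e1)"
      using e e1 c1(2) by (intro triv_inj[OF c1(2)]) (auto simp: fsmul_in triv_fsmul)
    have nz: "fsmul E 0 e \<noteq> e \<or> (if k then 1 else a) \<noteq> 0"
      using e triv_zero_iff[OF c1(2) e(1)] by auto
    have ue: "u m e = (if k then fsmul E a (u m e1) else u m e1)" "u m e \<in> total E" "u m e1 \<in> total E"
      using linO[OF my(2)] e e1 by (auto simp: fibre_linear_def ee1)
    have "line_pt E (u m e) (if k then 1 else a) \<in> C'"
      using p(2) proj_lift_line_pt(1)[OF linO[OF my(2)] e(1) nz] by (simp add: my e(4))
    then have ub: "bproj E (u m e) \<in> D' \<inter> U'" "den k' (t' (u m e)) (if k then 1 else a) \<noteq> 0"
      using mem'[OF ue(2)] by auto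
    then have "u m e1 \<in> DE'" using ue fsmul_in(2)[OF ue(3)] by (auto simp: DE'_def split: if_splits)
    then have "(\<psi> m, \<kappa>E e1) \<in> A"
      using my e e1 by (auto simp: A_def DE_def intro!: image_eqI[of _ _ "(m, e1)"])
    moreover have \<kappa>1y: "\<kappa>1 y = (\<phi> (bproj E e), a)"
      using \<kappa>1[OF e(1,2), of "if k then 1 else a"] e(3,4) by (simp add: aff_def den_def)
    \<comment> \<open>For charts of opposite kind the target denominator is \<open>a\<close> or a
      multiple of \<open>a\<close>, and it is nonzero because the image line lies in
      \<open>C'\<close>.\<close>
    moreover have "a \<noteq> 0" if "k \<noteq> k'"
    proof -
      have "t' (u m e) = (if k then a * t' (u m e1) else t' (u m e1))"
        using ue(1) triv_fsmul[OF c'(2) ue(3)] \<open>u m e1 \<in> DE'\<close> by (simp add: DE'_def)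
      then show ?thesis using ub(2) that by (auto simp: den_def split: if_splits)
    qed
    moreover have "\<kappa> p \<in> V"
      using openin_imp_subset[OF dM(3)] openin_imp_subset[OF dY(3)] my by (auto simp: eqs)
    ultimately show ?thesis
      using e1 by (simp add: Q_def eqs my j_def \<kappa>E_def)
  qed
  ultimately show "\<exists>Q. openin (top_of_set V) Q \<and> \<kappa> p \<in> Q \<and> Q \<subseteq> \<kappa> ` (C \<inter> ?f -` C') \<and>
        holo_on (\<kappa>' \<circ> ?f \<circ> inv_into C \<kappa>) Q"
    using Q by (intro exI[of _ Q] conjI)
qed

end

section \<open>The torus and the bundle $\mathcal{L}(H,\alpha)$\<close>

locale lattice_quotient =
  fixes L :: "'v::fin_dim_complex_vector set"
  assumes lattice: "torus_lattice L"
begin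

abbreviation q :: "'v \<Rightarrow> 'v set" where "q v \<equiv> v +o L"

lemma inv_into_q: "inj_on q N \<Longrightarrow> x \<in> N \<Longrightarrow> inv_into N q (q x) = x"
  by (rule inv_into_f_f)

lemma L_span: "\<exists>B. module.span zscale B = L"
  using lattice unfolding torus_lattice_def by blast

lemma L_zero: "0 \<in> L"
  using L_span module.span_zero[OF module_zscale] by metis

lemma L_add: "l \<in> L \<Longrightarrow> m \<in> L \<Longrightarrow> l + m \<in> L"
  using L_span module.span_add[OF module_zscale] by metis

lemma L_neg: "l \<in> L \<Longrightarrow> - l \<in> L"
  using L_span module.span_neg[OF module_zscale] by metis

lemma L_diff: "l \<in> L \<Longrightarrow> m \<in> L \<Longrightarrow> l - m \<in> L"
  using L_add[of l "- m"] L_neg[of m] by simp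

lemma mem_q: "w \<in> q v \<longleftrightarrow> w - v \<in> L"
proof
  assume "w - v \<in> L"
  then show "w \<in> q v" using set_plus_intro2[of "w - v" L v] by simp
qed (rule set_plus_imp_minus)

lemma q_eq: "q v = q w \<longleftrightarrow> w - v \<in> L"
proof
  assume "q v = q w"
  then show "w - v \<in> L" using mem_q[of w w] mem_q[of w v] L_zero by simp
next
  assume *: "w - v \<in> L"
  have "x - v \<in> L \<longleftrightarrow> x - w \<in> L" for x
    using L_diff[OF _ *, of "x - v"] L_add[OF _ *, of "x - w"] by auto
  then show "q v = q w" by (auto simp: mem_q)
qed

lemma q_add: "q v + q w = q (v + w)"
proof -
  have "L + L = L"
    using L_add L_zero by (auto simp: set_plus_def) (metis add.right_neutral)
  then show ?thesis by (simp add: set_plus_rearrange)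
qed

lemma translation_q: "translation (q u) (q v) = q (v + u)"
  by (simp add: translation_def q_add)

lemma pts_torus: "pts (torus L) = range q"
  by (simp add: torus_def space_mfd_def)

lemma torus_chartE:
  assumes "(W, D, \<phi>) \<in> charts (torus L)"
  obtains N where "W = UNIV" "D = q ` N" "\<phi> = inv_into N q" "open N" "inj_on q N"
  using assms unfolding torus_def
  by (rule push_mfd_chartE) (auto simp: space_mfd_def intro: that)

lemma proper_charts_torus: "proper_charts (torus L)"
  unfolding torus_def
  by (rule proper_charts_push) (auto simp: proper_charts_def space_mfd_def)

text \<open>Two points of a ball of radius e / 2 differ by less than e, and by discreteness no
  nonzero lattice vector is that short.\<close>

lemma injective_nhd: "\<exists>N. open N \<and> v \<in> N \<and> inj_on q N"
proof -
  have "0 isolated_in L" using lattice L_zero discreteD unfolding torus_lattice_def by blast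
  then obtain T where T: "open T" "T \<inter> L = {0}" unfolding isolated_in_def by blast
  then have "0 \<in> T" by blast
  then obtain e where e: "e > 0" "ball 0 e \<subseteq> T" using T(1) open_contains_ball by blast
  have "inj_on q (ball v (e / 2))"
  proof (rule inj_onI)
    fix x y assume xy: "x \<in> ball v (e / 2)" "y \<in> ball v (e / 2)" "q x = q y"
    have "dist x y < e" using xy(1,2) by (intro dist_triangle_half_r[of v x e y]) simp_all
    then have "norm (y - x) < e" by (simp add: dist_norm norm_minus_commute)
    then have "y - x \<in> T" using e(2) by (auto simp: subset_iff)
    moreover have "y - x \<in> L" using xy(3) q_eq by blast
    ultimately have "y - x = 0" using T(2) by blast
    then show "x = y" by simp
  qed
  then show ?thesis using e(1) by (intro exI[of _ "ball v (e / 2)"]) auto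
qed

lemma torus_chartI:
  "open N \<Longrightarrow> inj_on q N \<Longrightarrow> (UNIV, q ` N, inv_into N q) \<in> charts (torus L)"
  using push_mfd_chartI[of UNIV UNIV id space_mfd N q]
  by (simp add: torus_def space_mfd_def)

lemma covered_torus: "covered (torus L)"
  unfolding covered_def
proof
  fix p assume "p \<in> pts (torus L)"
  then obtain v where v: "p = q v" by (auto simp: pts_torus)
  obtain N where "open N" "v \<in> N" "inj_on q N" using injective_nhd by blast
  then show "\<exists>(W, D, \<phi>)\<in>charts (torus L). p \<in> D"
    using v by (intro bexI[OF _ torus_chartI[of N]]) auto
qed

lemma mfd_open_image_q:
  assumes "open U"
  shows "mfd_open (torus L) (q ` U)"
proof -
  have "openin (top_of_set W) (\<phi> ` (D \<inter> q ` U))" if "(W, D, \<phi>) \<in> charts (torus L)" for W D \<phi>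
  proof -
    obtain N where N: "W = UNIV" "D = q ` N" "\<phi> = inv_into N q" "open N" "inj_on q N"
      using torus_chartE[OF \<open>(W, D, \<phi>) \<in> charts (torus L)\<close>] .
    have "\<phi> ` (D \<inter> q ` U) = N \<inter> (\<Union>l\<in>L. (+) l ` U)"
    proof (intro equalityI subsetI)
      fix x assume "x \<in> \<phi> ` (D \<inter> q ` U)"
      then obtain n u where nu: "n \<in> N" "u \<in> U" "q n = q u" "x = \<phi> (q n)" using N(2) by auto
      have "x = n" unfolding nu(4) N(3) by (rule inv_into_q[OF N(5) nu(1)])
      have "n - u \<in> L" using nu(3) q_eq[of u n] by simp
      then have "n \<in> (\<Union>l\<in>L. (+) l ` U)" using nu(2) by (intro UN_I[of "n - u"]) (auto simp: image_iff)
      then show "x \<in> N \<inter> (\<Union>l\<in>L. (+) l ` U)" using nu(1) unfolding \<open>x = n\<close> by (intro IntI)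
    next
      fix x assume "x \<in> N \<inter> (\<Union>l\<in>L. (+) l ` U)"
      then obtain l u where lu: "x \<in> N" "l \<in> L" "u \<in> U" "x = l + u" by auto
      have "q x = q u" using lu(2,4) q_eq[of u x] by simp
      then have "q x \<in> D \<inter> q ` U" using lu N(2) by auto
      moreover have "\<phi> (q x) = x" using lu(1) N(3,5) inv_into_q by simp
      ultimately show "x \<in> \<phi> ` (D \<inter> q ` U)" by (metis image_eqI)
    qed
    also have "open \<dots>" using assms N(4) by (auto intro!: open_Int open_UN open_translation)
    finally show ?thesis using N(1) by simp
  qed
  then show ?thesis unfolding mfd_open_def pts_torus by auto
qed

end

text \<open>Writes the sign in the law for \<open>\<alpha>\<close> as an exponential, so that the
  cocycle identity becomes an identity between exponents.\<close>

lemma exp_i_pi_Ints: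
  assumes "x \<in> \<int>"
  shows "exp (\<i> * of_real (pi * x)) = (-1) powi \<lfloor>x\<rfloor>"
proof -
  have "cis pi powi \<lfloor>x\<rfloor> = cis (of_int \<lfloor>x\<rfloor> * pi)" by (rule cis_power_int)
  then show ?thesis using assms by (simp add: cis_conv_exp mult.commute)
qed

section \<open>The factor of automorphy and its orbits\<close>

locale appell_humbert = lattice_quotient +
  fixes H :: "'a \<Rightarrow> 'a \<Rightarrow> complex" and \<alpha> :: "'a \<Rightarrow> complex"
  assumes data: "AH_data L H \<alpha>"
begin

lemma H_add_left: "H (x + y) z = H x z + H y z"
  and H_scaleC_left: "H (c *\<^sub>C x) y = c * H x y"
  and H_cnj: "H y x = cnj (H x y)"
  using data unfolding AH_data_def hermitian_form_def by blast+

lemma H_add_right: "H z (x + y) = H z x + H z y"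
  using H_add_left[of x y z] H_cnj[of z] by (metis complex_cnj_add)

lemma H_zero_left [simp]: "H 0 z = 0"
  using H_add_left[of 0 0 z] by simp

lemma H_zero_right [simp]: "H z 0 = 0"
  using H_add_right[of z 0 0] by simp

lemma H_minus_left: "H (- x) z = - H x z"
  using H_add_left[of "- x" x z] by (simp add: add_eq_0_iff2)

lemma H_minus_right: "H z (- x) = - H z x"
  using H_add_right[of z "- x" x] by (simp add: add_eq_0_iff2)

lemma \<alpha>_nonzero: "l \<in> L \<Longrightarrow> \<alpha> l \<noteq> 0"
  using data unfolding AH_data_def by fastforce

lemma \<alpha>_add:
  assumes "l \<in> L" "m \<in> L"
  shows "\<alpha> (l + m) = exp (\<i> * of_real (pi * Im (H l m))) * \<alpha> l * \<alpha> m"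
  using data assms exp_i_pi_Ints[of "Im (H l m)"] unfolding AH_data_def by metis

text \<open>The canonical factor of automorphy of (H, \<alpha>).\<close>

definition factor :: "'a \<Rightarrow> 'a \<Rightarrow> complex" where
  "factor l v = \<alpha> l * exp (of_real pi * H v l + of_real pi / 2 * H l l)"

lemma AH_map_eq: "AH_map H \<alpha> l (v, c) = (v + l, factor l v * c)"
  by (simp add: AH_map_def factor_def)

lemma factor_nonzero: "l \<in> L \<Longrightarrow> factor l v \<noteq> 0"
  by (simp add: factor_def \<alpha>_nonzero)

text \<open>The cocycle identity. The sign contributes half of \<open>pi * (H l m - H m l)\<close>
  to the exponent; together with the mixed terms of \<open>H (l + m) (l + m)\<close>, half of
  \<open>pi * (H l m + H m l)\<close>, it leaves \<open>pi * H l m\<close>, the term that moving the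
  argument from \<open>v\<close> to \<open>v + l\<close> requires.\<close>

lemma factor_add:
  assumes "l \<in> L" "m \<in> L"
  shows "factor (l + m) v = factor m (v + l) * factor l v"
proof -
  have "H m l = cnj (H l m)" by (rule H_cnj)
  then have "H l m - H m l = 2 * \<i> * of_real (Im (H l m))"
    by (simp add: complex_eq_iff)
  then have "\<i> * of_real (pi * Im (H l m)) = of_real pi / 2 * (H l m - H m l)"
    by simp
  then have "\<i> * of_real (pi * Im (H l m)) + (of_real pi * H v (l + m) + of_real pi / 2 * H (l + m) (l + m)) =
    (of_real pi * H (v + l) m + of_real pi / 2 * H m m) + (of_real pi * H v l + of_real pi / 2 * H l l)"
    by (simp only:) (simp add: H_add_left H_add_right algebra_simps)
  then have "exp (\<i> * of_real (pi * Im (H l m))) * exp (of_real pi * H v (l + m) + of_real pi / 2 * H (l + m) (l + m)) =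
    exp (of_real pi * H (v + l) m + of_real pi / 2 * H m m) * exp (of_real pi * H v l + of_real pi / 2 * H l l)"
    by (simp only: exp_add[symmetric])
  then show ?thesis unfolding factor_def \<alpha>_add[OF assms] by (simp add: mult_ac)
qed

text \<open>By the cocycle identity the value equals its own square, and it is nonzero.\<close>

lemma factor_zero: "factor 0 v = 1"
  using factor_add[OF L_zero L_zero, of v] factor_nonzero[OF L_zero, of v] by simp

abbreviation orbit :: "'a \<Rightarrow> complex \<Rightarrow> ('a \<times> complex) set" where
  "orbit v c \<equiv> AH_orbit L H \<alpha> (v, c)"

abbreviation AH where "AH \<equiv> AH_bundle L H \<alpha>"

lemma orbit_eq_image: "orbit v c = (\<lambda>l. (v + l, factor l v * c)) ` L"
  by (simp add: AH_orbit_def AH_map_eq)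

lemma mem_orbit: "(w, d) \<in> orbit v c \<longleftrightarrow> w - v \<in> L \<and> d = factor (w - v) v * c"
  unfolding orbit_eq_image by (auto simp: image_iff intro!: bexI[of _ "w - v"])

lemma orbit_self: "(v, c) \<in> orbit v c"
  by (simp add: mem_orbit L_zero factor_zero)

text \<open>The cocycle identity in terms of orbits: a vector may be represented over any point of
  its base coset, at the price of the factor.\<close>

lemma orbit_shift:
  assumes l: "l \<in> L"
  shows "orbit (v + l) (factor l v * c) = orbit v c"
proof -
  have "w - (v + l) \<in> L \<longleftrightarrow> w - v \<in> L" for w
    using L_add[OF _ l, of "w - (v + l)"] L_diff[OF _ l, of "w - v"] by (auto simp: algebra_simps)
  moreover have "factor (w - (v + l)) (v + l) * factor l v = factor (w - v) v" if "w - (v + l) \<in> L" for w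
    using factor_add[OF l that, of v] by simp
  ultimately show ?thesis
    by (auto simp: mem_orbit mult.assoc[symmetric])
qed

lemma fst_orbit: "fst ` orbit v c = q v"
  unfolding orbit_eq_image by (auto simp: image_image elt_set_plus_def)

lemma total_AH: "total AH = {orbit v c | v c. True}"
  by (auto simp: AH_bundle_def)

lemma bproj_AH: "bproj AH (orbit v c) = q v"
  by (simp add: AH_bundle_def fst_orbit)

lemma orbit_in: "orbit v c \<in> total AH"
  by (auto simp: total_AH)

lemma orbitE:
  assumes "S \<in> total AH" "bproj AH S = q v"
  obtains c where "S = orbit v c"
proof -
  obtain w d where S: "S = orbit w d" using assms(1) by (auto simp: total_AH)
  then have l: "v - w \<in> L" using assms(2) q_eq[of w v] by (simp add: bproj_AH)
  show ?thesis using orbit_shift[OF l, of w d] S that[of "factor (v - w) w * d"] by simp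
qed

lemma fsmul_AH: "fsmul AH c (orbit v a) = orbit v (c * a)"
  by (auto simp: AH_bundle_def mem_orbit)

lemma fadd_AH: "fadd AH (orbit v a) (orbit v b) = orbit v (a + b)"
  by (auto simp: AH_bundle_def mem_orbit distrib_left)

text \<open>\<open>U\<close> meets each coset at most once, so the trivialization reads the orbit at
  a definite point, where the factor is \<open>factor 0 v = 1\<close>.\<close>

lemma AH_trivE:
  assumes "(U', t) \<in> trivs AH"
  obtains U where "U' = q ` U" "open U" "inj_on q U" "\<And>v c. v \<in> U \<Longrightarrow> t (orbit v c) = c"
proof -
  obtain U where U: "U' = q ` U" "open U" "inj_on q U" "t = (\<lambda>S. THE c. \<exists>v\<in>U. (v, c) \<in> S)"
    using assms unfolding AH_bundle_def by auto
  have "t (orbit v c) = c" if "v \<in> U" for v c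
    unfolding U(4)
  proof (rule the_equality)
    show "\<exists>v'\<in>U. (v', c) \<in> orbit v c" using that orbit_self by blast
    fix d assume "\<exists>v'\<in>U. (v', d) \<in> orbit v c"
    then obtain v' where v': "v' \<in> U" "v' - v \<in> L" "d = factor (v' - v) v * c" by (auto simp: mem_orbit)
    then have "v' = v" using U(3) that q_eq[of v v'] by (auto simp: inj_on_def)
    then show "d = c" using v' by (simp add: factor_zero)
  qed
  then show ?thesis using U that by blast
qed

lemma AH_triv_bij:
  assumes "(U', t) \<in> trivs AH" "x \<in> U'"
  shows "bij_betw t (fiber AH x) UNIV"
proof -
  obtain U where U: "U' = q ` U" "\<And>v c. v \<in> U \<Longrightarrow> t (orbit v c) = c"
    using AH_trivE[OF assms(1)] by blast
  obtain v where v: "v \<in> U" "x = q v" using assms(2) U by blast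
  have "fiber AH x = range (orbit v)"
  proof (intro equalityI subsetI)
    fix S assume "S \<in> fiber AH x"
    then have "S \<in> total AH" "bproj AH S = q v" by (simp_all add: fiber_iff v(2))
    then obtain c where "S = orbit v c" by (rule orbitE)
    then show "S \<in> range (orbit v)" by simp
  qed (auto simp: fiber_iff v(2) orbit_in bproj_AH)
  then show ?thesis
    using U(2)[OF v(1)] by (auto simp: bij_betw_def inj_on_def image_image)
qed

lemma proper_charts_AH: "proper_charts (total_mfd (torus L) AH)"
  by (rule proper_charts_total[OF proper_charts_torus _ AH_triv_bij])
     (auto elim!: AH_trivE intro: mfd_open_image_q)

lemma covered_AH: "covered (total_mfd (torus L) AH)"
proof (rule covered_total[OF covered_torus])
  show "bproj AH \<in> total AH \<rightarrow> pts (torus L)" by (auto simp: total_AH bproj_AH pts_torus)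
  fix x assume "x \<in> pts (torus L)"
  then obtain v where v: "x = q v" by (auto simp: pts_torus)
  obtain N where "open N" "v \<in> N" "inj_on q N" using injective_nhd by blast
  then show "\<exists>(U, t)\<in>trivs AH. x \<in> U"
    unfolding AH_bundle_def v by (auto intro!: exI[of _ "q ` N"])
qed

text \<open>Compatibility with the lattice comes down to
  \<open>exp (pi * H u l) = exp (pi * H l u)\<close>. The exponents differ by 2 pi i times
  \<open>Im (H u l)\<close>, which is an integer for \<open>u\<close> in
  \<open>perp L H\<close>.\<close>

lemma heis_map_orbit:
  assumes u: "u \<in> perp L H"
  shows "heis_map H (u, r) ` orbit v c = orbit (v + u) (r * exp (of_real pi * H v u) * c)"
proof -
  have "factor l v * (r * exp (of_real pi * H (v + l) u) * c) =
      factor l (v + u) * (r * exp (of_real pi * H v u) * c)" if l: "l \<in> L" for l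
  proof -
    have int: "Im (H u l) \<in> \<int>" using u l by (auto simp: perp_def)
    have "H l u = cnj (H u l)" by (rule H_cnj)
    then have "H u l = H l u + 2 * \<i> * of_real (Im (H u l))" by (simp add: complex_eq_iff)
    then have "of_real pi * H u l = of_real pi * H l u + \<i> * of_real (2 * pi * Im (H u l))"
      by (metis (no_types, lifting) distrib_left mult.assoc mult.left_commute of_real_mult of_real_numeral)
    moreover have "exp (\<i> * of_real (2 * pi * Im (H u l))) = 1"
      using cis_multiple_2pi[OF int] by (simp add: cis_conv_exp)
    ultimately have "exp (of_real pi * H u l) = exp (of_real pi * H l u)"
      by (simp only: exp_add) simp
    then show ?thesis
      by (simp add: factor_def H_add_left distrib_left exp_add)
  qed
  then show ?thesis
    unfolding orbit_eq_image image_image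
    by (intro image_cong) (simp_all add: heis_map_def mult_ac)
qed

lemma bounded_linear_H: "bounded_linear (\<lambda>v. H v z)"
  by (rule clinear_functional_bounded) (simp_all add: H_add_left H_scaleC_left)

lemma holo_on_H:
  assumes "holo_on f S"
  shows "holo_on (\<lambda>x. H (f x) z) S"
  by (rule holo_on_compose[OF assms, where T = UNIV])
     (auto intro!: holo_on_linear bounded_linear_H simp: H_scaleC_left scaleC_complex_def)

end

section \<open>The action of the Heisenberg group\<close>

lemma cstar_mfd_simps [simp]: "pts cstar_mfd = - {0}" "charts cstar_mfd = {(UNIV, - {0}, id)}"
  by (simp_all add: cstar_mfd_def)

lemma proper_charts_cstar: "proper_charts cstar_mfd"
  by (auto simp: proper_charts_def)

context appell_humbert
begin

lemma herm_ker_left: "k \<in> herm_ker H \<Longrightarrow> H k v = 0"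
  by (simp add: herm_ker_def)

lemma herm_ker_right: "k \<in> herm_ker H \<Longrightarrow> H v k = 0"
  by (subst H_cnj) (simp add: herm_ker_left)

lemma herm_ker_zero: "0 \<in> herm_ker H"
  by (simp add: herm_ker_def)

lemma perp_add_ker: "u \<in> perp L H \<Longrightarrow> k \<in> herm_ker H \<Longrightarrow> u + k \<in> perp L H"
  by (simp add: perp_def H_add_left herm_ker_left)

lemma perp_minus: "u \<in> perp L H \<Longrightarrow> - u \<in> perp L H"
  by (simp add: perp_def H_minus_left)

lemma pts_perp [simp]: "pts (perp_mfd L H) = perp L H"
  by (simp add: perp_mfd_def)

lemma perp_chartE:
  assumes "(W, D, \<phi>) \<in> charts (perp_mfd L H)"
  obtains u0 where "W = herm_ker H" "D = (\<lambda>k. u0 + k) ` herm_ker H" "\<phi> = (\<lambda>u. u - u0)" "u0 \<in> perp L H"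
  using assms unfolding perp_mfd_def by (auto simp: elt_set_plus_def image_def intro!: that)

lemma perp_chartI:
  "u \<in> perp L H \<Longrightarrow> (herm_ker H, u +o herm_ker H, \<lambda>x. x - u) \<in> charts (perp_mfd L H)"
  by (auto simp: perp_mfd_def)

lemma proper_charts_perp: "proper_charts (perp_mfd L H)"
proof (rule proper_chartsI)
  fix W D \<phi> assume "(W, D, \<phi>) \<in> charts (perp_mfd L H)"
  then obtain u0 where c: "W = herm_ker H" "D = (\<lambda>k. u0 + k) ` herm_ker H" "\<phi> = (\<lambda>u. u - u0)"
    "u0 \<in> perp L H" by (rule perp_chartE)
  show "D \<subseteq> pts (perp_mfd L H)" using c by (auto intro: perp_add_ker)
  show "inj_on \<phi> D" by (simp add: c inj_on_def)
  show "openin (top_of_set W) (\<phi> ` D)" by (simp add: c image_image)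
qed

abbreviation "params \<equiv> prod_mfd (perp_mfd L H) cstar_mfd"

lemma proper_charts_params: "proper_charts params"
  by (rule proper_charts_prod[OF proper_charts_perp proper_charts_cstar])

lemma params_chart:
  assumes "p \<in> pts params"
  obtains W D \<phi> where "(W, D, \<phi>) \<in> charts params" "p \<in> D"
proof -
  obtain u r where p: "p = (u, r)" "u \<in> perp L H" "r \<noteq> 0" using assms by auto
  have "u \<in> u +o herm_ker H" using herm_ker_zero by (auto simp: elt_set_plus_def)
  then have "p \<in> (u +o herm_ker H) \<times> - {0}" using p by simp
  then show ?thesis
    by (rule that[OF prod_mfd_chartI[OF perp_chartI[OF p(2)]], rotated]) simp
qed

lemma heis_map_in_total:
  assumes "p \<in> pts params" "S \<in> total AH"
  shows "heis_map H p ` S \<in> total AH"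
proof -
  obtain u r where "p = (u, r)" "u \<in> perp L H" using assms(1) by auto
  moreover obtain v c where "S = orbit v c" using assms(2) by (auto simp: total_AH)
  ultimately show ?thesis by (simp add: heis_map_orbit orbit_in)
qed

text \<open>Two unrelated sheets over the torus occur in one chart: \<open>N\<close> supplies the
  base coordinate and \<open>U\<close> the fibre coordinate. Representatives of one point on the two
  sheets differ by a lattice vector.\<close>

lemma AH_chartE:
  assumes "(V, C, \<kappa>) \<in> charts (total_mfd (torus L) AH)"
  obtains N U t where "open N" "inj_on q N" "open U" "\<And>v c. v \<in> U \<Longrightarrow> t (orbit v c) = c" "V = UNIV"
    "C = {S \<in> total AH. bproj AH S \<in> q ` N \<inter> q ` U}" "\<kappa> = (\<lambda>S. (inv_into N q (bproj AH S), t S))"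
proof -
  obtain W D \<phi> U' t where c: "(W, D, \<phi>) \<in> charts (torus L)" "(U', t) \<in> trivs AH" "V = W \<times> UNIV"
    "C = {S \<in> total AH. bproj AH S \<in> D \<inter> U'}" "\<kappa> = (\<lambda>S. (\<phi> (bproj AH S), t S))"
    using assms by (rule total_mfd_chartE)
  obtain N where N: "W = UNIV" "D = q ` N" "\<phi> = inv_into N q" "open N" "inj_on q N"
    using c(1) by (rule torus_chartE)
  obtain U where U: "U' = q ` U" "open U" "\<And>v c. v \<in> U \<Longrightarrow> t (orbit v c) = c"
    using c(2) by (rule AH_trivE) blast
  show ?thesis
    by (rule that[OF N(4,5) U(2,3)]) (simp_all add: c N U(1))
qed

text \<open>\<open>H\<close> is antiholomorphic in its second argument, but \<open>H v u\<close> is constant along each component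
  \<open>u\<^sub>0 + ker H\<close> of the group, on which \<open>u\<close> varies.\<close>

theorem holo_map_heis_orbits:
  "holo_map (prod_mfd params (total_mfd (torus L) AH)) (total_mfd (torus L) AH) (\<lambda>(p, S). heis_map H p ` S)"
proof (rule holo_mapI_expression)
  let ?f = "\<lambda>(p, S). heis_map H p ` S"
  show "?f \<in> pts (prod_mfd params (total_mfd (torus L) AH)) \<rightarrow> pts (total_mfd (torus L) AH)"
    using heis_map_in_total by auto
  show "inj_on \<phi> D" if "(W, D, \<phi>) \<in> charts (prod_mfd params (total_mfd (torus L) AH))" for W D \<phi>
    using proper_chartsD(2)[OF proper_charts_prod[OF proper_charts_params proper_charts_AH] that] .
  fix V C \<kappa> V' C' \<kappa>' x
  assume c0: "(V, C, \<kappa>) \<in> charts (prod_mfd params (total_mfd (torus L) AH))"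
    and c0': "(V', C', \<kappa>') \<in> charts (total_mfd (torus L) AH)" and x: "x \<in> C" "?f x \<in> C'"
  from c0 obtain V1 C1 \<kappa>1 V2 C2 \<kappa>2 where c: "(V1, C1, \<kappa>1) \<in> charts params"
    "(V2, C2, \<kappa>2) \<in> charts (total_mfd (torus L) AH)"
    and eqs: "V = V1 \<times> V2" "C = C1 \<times> C2" "\<kappa> = map_prod \<kappa>1 \<kappa>2" by (rule prod_mfd_chartE)
  obtain u0 where u0: "u0 \<in> perp L H" "V1 = herm_ker H \<times> UNIV"
    "C1 = (\<lambda>k. u0 + k) ` herm_ker H \<times> - {0}" "\<kappa>1 = map_prod (\<lambda>u. u - u0) id"
    using c(1) by (auto elim!: prod_mfd_chartE perp_chartE)
  obtain N U t where N: "open N" "inj_on q N" and U: "open U" "\<And>v c. v \<in> U \<Longrightarrow> t (orbit v c) = c"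
    and c2: "V2 = UNIV" "C2 = {S \<in> total AH. bproj AH S \<in> q ` N \<inter> q ` U}"
      "\<kappa>2 = (\<lambda>S. (inv_into N q (bproj AH S), t S))"
    using c(2) by (rule AH_chartE) blast
  obtain N' U' t' where N': "open N'" "inj_on q N'" and U': "open U'" "\<And>v c. v \<in> U' \<Longrightarrow> t' (orbit v c) = c"
    and c': "C' = {S \<in> total AH. bproj AH S \<in> q ` N' \<inter> q ` U'}"
      "\<kappa>' = (\<lambda>S. (inv_into N' q (bproj AH S), t' S))"
    using c0' by (rule AH_chartE) blast
  obtain k r S where p: "x = ((u0 + k, r), S)" "k \<in> herm_ker H" "r \<noteq> 0" "S \<in> C2"
    using x(1) by (auto simp: eqs u0)
  obtain v w where v: "v \<in> N" "bproj AH S = q v" and w: "w \<in> U" "bproj AH S = q w"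
    using p(4) by (auto simp: c2)
  obtain c where S: "S = orbit w c" using orbitE[OF _ w(2)] p(4) by (auto simp: c2)
  \<comment> \<open>The lattice vector from the sheet \<open>N\<close> to the sheet
    \<open>U\<close>; \<open>l1\<close> and \<open>l2\<close> below play this part for the image
    point and the sheets \<open>N'\<close> and \<open>U'\<close>.\<close>
  define l where "l = w - v"
  have "q v = q w" using v(2) w(2) by simp
  then have l: "l \<in> L" "w = v + l" by (simp_all add: q_eq l_def)
  have perp: "u0 + k' \<in> perp L H" if "k' \<in> herm_ker H" for k' using that u0(1) perp_add_ker by blast
  have f: "?f ((u0 + k', r'), orbit v' c'') =
      orbit (v' + (u0 + k')) (r' * exp (of_real pi * H v' u0) * c'')" if "k' \<in> herm_ker H" for k' r' v' c''
    using heis_map_orbit[OF perp[OF that]] by (simp add: H_add_right herm_ker_right that)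
  have "q (v + l + (u0 + k)) \<in> q ` N' \<inter> q ` U'"
    using x(2) unfolding p(1) S f[OF p(2)] l(2) by (simp add: c' bproj_AH)
  then obtain n' w' where n': "n' \<in> N'" "q (v + l + (u0 + k)) = q n'"
    and w': "w' \<in> U'" "q (v + l + (u0 + k)) = q w'" by auto
  define l1 where "l1 = n' - (v + l + (u0 + k))"
  define l2 where "l2 = w' - (v + l + (u0 + k))"
  have l1: "l1 \<in> L" "n' = v + l + (u0 + k) + l1" and l2: "l2 \<in> L" "w' = v + l + (u0 + k) + l2"
    using n'(2)[unfolded q_eq] w'(2)[unfolded q_eq] by (simp_all add: l1_def l2_def)
  \<comment> \<open>The lattice vectors found at \<open>x\<close> are frozen. \<open>T\<close>
    collects the coordinates for which they still lead to the required sheets, an open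
    condition.\<close>
  define T where "T = {z :: ('a \<times> complex) \<times> ('a \<times> complex). snd (fst z) \<in> - {0} \<and> fst (snd z) \<in> N \<and>
    fst (snd z) + l \<in> U \<and> fst (snd z) + l + (u0 + fst (fst z)) + l1 \<in> N' \<and>
    fst (snd z) + l + (u0 + fst (fst z)) + l2 \<in> U'}"
  have "open T"
    unfolding T_def using N(1) U(1) N'(1) U'(1)
    by (intro open_Collect_conj open_vimage[unfolded vimage_def]) (auto intro!: continuous_intros)
  \<comment> \<open>The base coordinate is read on \<open>N'\<close> and the fibre coordinate on
    \<open>U'\<close>, whence the shift by \<open>l1\<close> in one and the factor for
    \<open>l2\<close> in the other. Kernel components are dropped from the arguments of
    \<open>H\<close>, which then occurs only with the fixed second arguments \<open>l2\<close> and
    \<open>u0\<close>.\<close>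
  define R where "R = (\<lambda>z :: ('a \<times> complex) \<times> ('a \<times> complex).
    (fst (snd z) + l + (u0 + fst (fst z)) + l1,
     \<alpha> l2 * exp (of_real pi * H (fst (snd z) + l + u0) l2 + of_real pi / 2 * H l2 l2) *
       (snd (fst z) * exp (of_real pi * H (fst (snd z) + l) u0) * snd (snd z))))"
  have R: "holo_on R (V \<inter> T)"
    unfolding R_def by (intro holo_on_intros holo_on_H)
  have "\<exists>x\<in>C. ?f x \<in> C' \<and> z = \<kappa> x \<and> \<kappa>' (?f x) = R z" if z: "z \<in> V \<inter> T" for z
  proof -
    obtain k r v c where zz: "z = ((k, r), (v, c))" by (metis prod.collapse)
    have zV: "k \<in> herm_ker H" "r \<noteq> 0" "v \<in> N" "v + l \<in> U" "v + l + (u0 + k) + l1 \<in> N'"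
      "v + l + (u0 + k) + l2 \<in> U'"
      using z by (auto simp: zz T_def eqs u0)
    let ?S = "orbit (v + l) c" and ?c = "r * exp (of_real pi * H (v + l) u0) * c"
    have qv: "q (v + l) = q v" "q (v + l + (u0 + k)) = q (v + l + (u0 + k) + l1)"
      "q (v + l + (u0 + k)) = q (v + l + (u0 + k) + l2)"
      using l(1) l1(1) l2(1) L_neg by (auto simp: q_eq)
    have "?S \<in> C2"
      using zV qv by (auto simp: c2 orbit_in bproj_AH intro: image_eqI[of _ _ v] image_eqI[of _ _ "v + l"])
    moreover have "\<kappa>2 ?S = (v, c)" using zV U(2) N(2) by (simp add: c2 bproj_AH qv(1) inv_into_q)
    ultimately have "((u0 + k, r), ?S) \<in> C" "z = \<kappa> ((u0 + k, r), ?S)"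
      using zV by (auto simp: eqs u0 zz)
    moreover have fx: "?f ((u0 + k, r), ?S) = orbit (v + l + (u0 + k)) ?c" by (rule f[OF zV(1)])
    have "q (v + l + (u0 + k)) \<in> q ` N'" unfolding qv(2) using zV by (intro imageI)
    moreover have "q (v + l + (u0 + k)) \<in> q ` U'" unfolding qv(3) using zV by (intro imageI)
    ultimately have "?f ((u0 + k, r), ?S) \<in> C'"
      unfolding fx by (simp add: c' orbit_in bproj_AH)
    moreover have "t' (orbit (v + l + (u0 + k)) ?c) = factor l2 (v + l + (u0 + k)) * ?c"
      using U'(2)[OF zV(6)] orbit_shift[OF l2(1)] by metis
    moreover have "factor l2 (v + l + (u0 + k)) = factor l2 (v + l + u0)"
      by (simp add: factor_def H_add_left herm_ker_left[OF zV(1)])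
    ultimately have "\<kappa>' (?f ((u0 + k, r), ?S)) = R z"
      unfolding fx using zV(5) N'(2) by (simp add: c' bproj_AH qv(2) R_def zz factor_def inv_into_q)
    then show ?thesis
      using \<open>((u0 + k, r), ?S) \<in> C\<close> \<open>z = \<kappa> ((u0 + k, r), ?S)\<close> \<open>?f ((u0 + k, r), ?S) \<in> C'\<close> by blast
  qed
  moreover have "\<kappa> x \<in> V \<inter> T"
  proof -
    have "\<kappa> x = ((k, r), (v, c))"
      using v w U(2) N(2) by (simp add: eqs u0 p c2 inv_into_q) (simp add: S U(2))
    moreover have "w + (u0 + k) + l1 \<in> N'" "w + (u0 + k) + l2 \<in> U'"
      using n'(1) w'(1) unfolding l1(2) l2(2) l(2) .
    ultimately show ?thesis
      using p(2,3) v(1) w(1) by (simp add: T_def eqs u0(2) c2(1) l(2)[symmetric])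
  qed
  moreover have "openin (top_of_set V) (V \<inter> T)" using \<open>open T\<close> by (rule openin_open_Int)
  ultimately show "\<exists>Q R. openin (top_of_set V) Q \<and> \<kappa> x \<in> Q \<and> holo_on R Q \<and>
      (\<forall>z\<in>Q. \<exists>x\<in>C. ?f x \<in> C' \<and> z = \<kappa> x \<and> \<kappa>' (?f x) = R z)"
    using R by blast
qed

end

section \<open>Automorphisms\<close>

text \<open>The zero-dimensional parameter space, modelled on the zero subspace of the complex
  numbers; over it a family is a single map.\<close>

definition point_mfd :: "(unit, complex) cmfd" where
  "point_mfd = \<lparr>pts = UNIV, charts = {({0}, UNIV, \<lambda>_. 0)}\<rparr>"

lemma proper_charts_point: "proper_charts point_mfd"
  by (auto simp: point_mfd_def proper_charts_def inj_on_def)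

context complex_line_bundle
begin

lemma holo_map_proj_lift_single:
  assumes lin: "fibre_linear E u" and holo: "holo_map (total_mfd X E) (total_mfd X E) u"
  shows "holo_map Y Y (proj_lift X E u)"
proof -
  have "holo_map (prod_mfd point_mfd (total_mfd X E)) (total_mfd X E) (\<lambda>(a, e). u e)"
    by (rule holo_map_prod_snd[OF proper_charts_point proper_charts_total_space holo])
  then have "holo_map (prod_mfd point_mfd Y) Y (\<lambda>(a, y). proj_lift X E u y)"
    using holo_map_proj_lift[OF proper_charts_point lin] by blast
  from holo_map_slice[OF proper_charts_point proper_charts_Y this, of "{0}" UNIV "\<lambda>_. 0" "()"]
  show ?thesis by (simp add: point_mfd_def)
qed

text \<open>Only agreement of \<open>w\<close> with the composite on the total space is asked, so it
  serves the truncated products of \<open>BijGroup\<close> as well as the identity as a product of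
  inverse maps.\<close>

lemma proj_lift_compose:
  assumes u: "fibre_linear E u" and v: "fibre_linear E v" and w: "\<And>e. e \<in> total E \<Longrightarrow> w e = u (v e)"
    and lin: "fibre_linear E w" and y: "y \<in> pts Y"
  shows "proj_lift X E w y = proj_lift X E u (proj_lift X E v y)"
proof -
  obtain e b where e: "e \<in> total E" "fsmul E 0 e \<noteq> e \<or> b \<noteq> 0" "y = line_pt E e b"
    using y by (rule line_ptE)
  have "v e \<in> total E" using v e(1) by (simp add: fibre_linear_def)
  moreover have "fsmul E 0 (v e) \<noteq> v e \<or> b \<noteq> 0" using e fibre_linear_nonzero[OF v e(1)] by blast
  ultimately show ?thesis
    using proj_lift_line_pt(1)[OF u] proj_lift_line_pt(1)[OF v e(1,2)] proj_lift_line_pt(1)[OF lin e(1,2)] e w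
    by simp
qed

lemma proj_lift_ident:
  assumes "\<And>e. e \<in> total E \<Longrightarrow> u e = e" and y: "y \<in> pts Y"
  shows "proj_lift X E u y = y"
proof -
  have u: "fibre_linear E u" using assms(1) fsmul_in by (simp add: fibre_linear_def inj_on_def)
  obtain e b where e: "e \<in> total E" "fsmul E 0 e \<noteq> e \<or> b \<noteq> 0" "y = line_pt E e b"
    using y by (rule line_ptE)
  then show ?thesis using proj_lift_line_pt(1)[OF u e(1,2)] assms(1) by simp
qed

lemma proj_lift_in: "fibre_linear E u \<Longrightarrow> y \<in> pts Y \<Longrightarrow> proj_lift X E u y \<in> pts Y"
  using proj_lift_line_pt by (metis line_ptE)

lemma fibre_linear_compose:
  assumes "fibre_linear E u" "fibre_linear E v" "\<And>e. e \<in> total E \<Longrightarrow> w e = u (v e)"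
  shows "fibre_linear E w"
proof -
  have v: "v e \<in> total E" if "e \<in> total E" for e using assms(2) that by (simp add: fibre_linear_def)
  have "inj_on w (total E)"
  proof (rule inj_onI)
    fix a b assume ab: "a \<in> total E" "b \<in> total E" "w a = w b"
    have inj: "inj_on u (total E)" "inj_on v (total E)" using assms(1,2) by (simp_all add: fibre_linear_def)
    have "u (v a) = u (v b)" using ab assms(3) by metis
    then have "v a = v b" using inj_onD[OF inj(1)] v ab(1,2) by blast
    then show "a = b" using inj_onD[OF inj(2)] ab(1,2) by blast
  qed
  then show ?thesis using assms fsmul_in(1) v by (simp add: fibre_linear_def)
qed

text \<open>The lift of the inverse is inverse to the lift, so holomorphy in both directions is an
  instance of the result for one map.\<close>

lemma proj_lift_in_Aut:
  assumes bij: "u \<in> Bij (total E)" and lin: "fibre_linear E u"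
    and holo: "holo_map (total_mfd X E) (total_mfd X E) u"
      "holo_map (total_mfd X E) (total_mfd X E) (inv_into (total E) u)"
  shows "proj_lift X E u \<in> carrier (Aut Y)"
proof -
  define v where "v = inv_into (total E) u"
  have b: "bij_betw u (total E) (total E)" using bij by (simp add: Bij_def)
  have uv: "u (v e) = e" and vu: "v (u e) = e" and v_in: "v e \<in> total E" if "e \<in> total E" for e
    using b that bij_betw_inv_into_right[OF b] bij_betw_inv_into_left[OF b]
      bij_betwE[OF bij_betw_inv_into[OF b]] by (auto simp: v_def)
  have lin_v: "fibre_linear E v"
    unfolding fibre_linear_def
  proof (intro conjI ballI allI)
    show "inj_on v (total E)" using bij_betw_inv_into[OF b] by (simp add: v_def bij_betw_def)
    fix e c assume e: "e \<in> total E"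
    show "v e \<in> total E" by (rule v_in[OF e])
    \<comment> \<open>Applying \<open>v\<close> to both sides gives homogeneity of the
      inverse.\<close>
    have "u (fsmul E c (v e)) = fsmul E c (u (v e))"
      using lin v_in[OF e] by (simp add: fibre_linear_def)
    then show "v (fsmul E c e) = fsmul E c (v e)"
      using vu[OF fsmul_in(1)[OF v_in[OF e]], of c] by (simp add: uv[OF e])
  qed
  let ?u = "proj_lift X E u" and ?v = "proj_lift X E v"
  have id: "fibre_linear E (\<lambda>e. e)" using fsmul_in by (simp add: fibre_linear_def)
  have UV: "?u (?v y) = y" and VU: "?v (?u y) = y" if y: "y \<in> pts Y" for y
    using proj_lift_compose[OF lin lin_v _ id y] proj_lift_compose[OF lin_v lin _ id y]
      proj_lift_ident[OF _ y, of "\<lambda>e. e"] uv vu by auto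
  have bY: "bij_betw ?u (pts Y) (pts Y)"
    using UV VU proj_lift_in[OF lin] proj_lift_in[OF lin_v]
    by (intro bij_betw_byWitness[where f' = ?v]) auto
  have "?u \<in> extensional (pts Y)"
    unfolding proj_lift_def by (simp add: projectivization_def)
  moreover have "holo_map Y Y ?u" by (rule holo_map_proj_lift_single[OF lin holo(1)])
  moreover have "holo_map Y Y (inv_into (pts Y) ?u)"
  proof (rule holo_map_cong[OF proper_charts_Y _ holo_map_proj_lift_single[OF lin_v holo(2)[folded v_def]]])
    fix y assume y: "y \<in> pts Y"
    show "?v y = inv_into (pts Y) ?u y"
      using inv_into_f_f[OF bij_betw_imp_inj_on[OF bY] proj_lift_in[OF lin_v y]] UV[OF y] by simp
  qed
  ultimately show ?thesis using bY by (simp add: Aut_def Bij_def)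
qed

text \<open>The line through (e, 1) is sent to the line through (u e, 1), whose only point with last
  coordinate 1 has first component \<open>u e\<close>. The trivial summand thus removes the scaling
  ambiguity.\<close>

lemma proj_lift_inj:
  assumes "fibre_linear E u" "fibre_linear E v" "u \<in> extensional (total E)" "v \<in> extensional (total E)"
    and eq: "proj_lift X E u = proj_lift X E v"
  shows "u = v"
proof (rule extensionalityI[OF assms(3,4)])
  fix e assume e: "e \<in> total E"
  have in_E: "u e \<in> total E" "v e \<in> total E" using assms(1,2) e by (simp_all add: fibre_linear_def)
  have "line_pt E (u e) 1 = line_pt E (v e) 1"
    using proj_lift_line_pt(1)[OF assms(1) e, of 1] proj_lift_line_pt(1)[OF assms(2) e, of 1] eq by simp
  then have "(u e, (bproj E (u e), 1)) \<in> line_pt E (v e) 1" using mem_line_pt[OF in_E(1)] by metis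
  then show "u e = v e" by (auto simp: line_pt_def fsmul_one[OF in_E(2)])
qed

end

section \<open>The group $\mathbf{S}(\mathcal{L})$\<close>

locale torus_bundle = lattice_quotient L for L :: "'v::fin_dim_complex_vector set" +
  fixes E :: "('e, 'v set, complex) vbundle"
  assumes line_bundle: "holomorphic_line_bundle (torus L) E"

sublocale torus_bundle \<subseteq> complex_line_bundle "torus L" E
  by unfold_locales (rule proper_charts_torus line_bundle)+

context torus_bundle
begin

lemma S_groupD:
  assumes u: "u \<in> carrier (S_group L E)"
  shows "u \<in> Bij (total E)"
    and "holo_map (total_mfd (torus L) E) (total_mfd (torus L) E) u"
    and "holo_map (total_mfd (torus L) E) (total_mfd (torus L) E) (inv_into (total E) u)"
    and "fibre_linear E u"
    and "\<exists>x\<in>pts (torus L). \<forall>e\<in>total E. bproj E (u e) = translation x (bproj E e)"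
proof -
  show *: "u \<in> Bij (total E)"
    "holo_map (total_mfd (torus L) E) (total_mfd (torus L) E) u"
    "holo_map (total_mfd (torus L) E) (total_mfd (torus L) E) (inv_into (total E) u)"
    "\<exists>x\<in>pts (torus L). \<forall>e\<in>total E. bproj E (u e) = translation x (bproj E e)"
    using u by (auto simp: S_group_def Aut_def)
  obtain x where x: "\<And>z. z \<in> pts (torus L) \<Longrightarrow> fiber_iso E E u z (translation x z)"
    using u by (auto simp: S_group_def)
  have bij: "bij_betw u (total E) (total E)" using *(1) by (simp add: Bij_def)
  show "fibre_linear E u"
    unfolding fibre_linear_def
  proof (intro conjI ballI allI)
    show "inj_on u (total E)" using bij by (simp add: bij_betw_def)
    fix e c assume e: "e \<in> total E"
    show "u e \<in> total E" by (rule bij_betw_apply[OF bij e])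
    have "e \<in> fiber E (bproj E e)" using e by (simp add: fiber_iff)
    then show "u (fsmul E c e) = fsmul E c (u e)"
      using x[OF bproj_in[OF e]] by (simp add: fiber_iso_def)
  qed
qed

text \<open>The description in \<open>rho\<close> is unambiguous because a translation is determined
  by its value at one point; the given \<open>e\<close> supplies such a point.\<close>

lemma bproj_rho:
  assumes u: "u \<in> carrier (S_group L E)" and e: "e \<in> total E"
  shows "bproj E (u e) = translation (rho L E u) (bproj E e)"
proof -
  obtain x where x: "x \<in> pts (torus L)" "\<forall>e\<in>total E. bproj E (u e) = translation x (bproj E e)"
    using S_groupD(5)[OF u] by blast
  obtain v where v: "bproj E e = q v" using bproj_in[OF e] by (auto simp: pts_torus)
  have "rho L E u = x"
    unfolding rho_def
  proof (rule the_equality)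
    show "x \<in> pts (torus L) \<and> (\<forall>e\<in>total E. bproj E (u e) = translation x (bproj E e))" using x by blast
    fix y assume y: "y \<in> pts (torus L) \<and> (\<forall>e\<in>total E. bproj E (u e) = translation y (bproj E e))"
    obtain a b where ab: "x = q a" "y = q b" using x(1) y by (auto simp: pts_torus)
    have "translation x (q v) = translation y (q v)" using x(2) y e v by metis
    then have "q (v + a) = q (v + b)" by (simp add: ab translation_q)
    then show "y = x" by (simp add: ab q_eq L_diff) (metis L_neg minus_diff_eq)
  qed
  then show ?thesis using x(2) e by simp
qed

lemma proj_lift_mon: "proj_lift (torus L) E \<in> mon (S_group L E) (Aut Y)"
proof -
  have aut: "proj_lift (torus L) E u \<in> carrier (Aut Y)" if "u \<in> carrier (S_group L E)" for u
    by (rule proj_lift_in_Aut[OF S_groupD(1,4,2,3)[OF that]])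
  have Bij_Y: "proj_lift (torus L) E u \<in> Bij (pts Y)" if "u \<in> carrier (S_group L E)" for u
    using aut[OF that] by (simp add: Aut_def)
  have "proj_lift (torus L) E (u \<otimes>\<^bsub>S_group L E\<^esub> v) =
      proj_lift (torus L) E u \<otimes>\<^bsub>Aut Y\<^esub> proj_lift (torus L) E v"
    if uv: "u \<in> carrier (S_group L E)" "v \<in> carrier (S_group L E)" for u v
  proof -
    have "u \<otimes>\<^bsub>S_group L E\<^esub> v = compose (total E) u v"
      by (simp add: S_group_def BijGroup_def S_groupD(1)[OF uv(1)] S_groupD(1)[OF uv(2)])
    moreover have "proj_lift (torus L) E u \<otimes>\<^bsub>Aut Y\<^esub> proj_lift (torus L) E v =
        compose (pts Y) (proj_lift (torus L) E u) (proj_lift (torus L) E v)"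
      by (simp add: Aut_def BijGroup_def Bij_Y[OF uv(1)] Bij_Y[OF uv(2)])
    moreover have "proj_lift (torus L) E (compose (total E) u v) =
        compose (pts Y) (proj_lift (torus L) E u) (proj_lift (torus L) E v)"
    proof (rule extensionalityI)
      show "proj_lift (torus L) E (compose (total E) u v) \<in> extensional (pts Y)"
        unfolding proj_lift_def by (simp add: projectivization_def)
      fix y assume y: "y \<in> pts Y"
      have lin: "fibre_linear E (compose (total E) u v)"
        by (rule fibre_linear_compose[OF S_groupD(4)[OF uv(1)] S_groupD(4)[OF uv(2)]]) (simp add: compose_def)
      have "proj_lift (torus L) E (compose (total E) u v) y =
          proj_lift (torus L) E u (proj_lift (torus L) E v y)"
        by (rule proj_lift_compose[OF S_groupD(4)[OF uv(1)] S_groupD(4)[OF uv(2)] _ lin y]) (simp add: compose_def)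
      then show "proj_lift (torus L) E (compose (total E) u v) y =
          compose (pts Y) (proj_lift (torus L) E u) (proj_lift (torus L) E v) y"
        using y by (simp add: compose_def)
    qed (rule compose_extensional)
    ultimately show ?thesis by simp
  qed
  moreover have "inj_on (proj_lift (torus L) E) (carrier (S_group L E))"
    by (intro inj_onI proj_lift_inj S_groupD(4) Bij_imp_extensional S_groupD(1))
  ultimately show ?thesis using aut by (auto simp: mon_def hom_def)
qed

lemma proj_base_proj_lift:
  assumes u: "u \<in> carrier (S_group L E)" and y: "y \<in> pts Y"
  shows "proj_base (direct_sum E (trivial_bundle (torus L))) (proj_lift (torus L) E u y) =
    translation (rho L E u) (proj_base (direct_sum E (trivial_bundle (torus L))) y)"
proof -
  obtain e b where e: "e \<in> total E" "fsmul E 0 e \<noteq> e \<or> b \<noteq> 0" "y = line_pt E e b"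
    using y by (rule line_ptE)
  have "u e \<in> total E" using S_groupD(4)[OF u] e(1) by (simp add: fibre_linear_def)
  then show ?thesis
    using e proj_lift_line_pt(1)[OF S_groupD(4)[OF u] e(1,2)] bproj_rho[OF u e(1)]
    by (simp add: proj_base_line_pt)
qed

end

section \<open>Transport of the Heisenberg action to the given bundle\<close>

locale trivialized_torus_bundle = torus_bundle L E + appell_humbert L H \<alpha>
  for L :: "'v::fin_dim_complex_vector set" and E :: "('e, 'v set, complex) vbundle" and H \<alpha> +
  fixes \<psi> :: "'e \<Rightarrow> ('v \<times> complex) set"
  assumes iso: "bundle_iso (torus L) E (AH_bundle L H \<alpha>) \<psi>"
begin

abbreviation "TE \<equiv> total_mfd (torus L) E"
abbreviation "\<psi>i \<equiv> inv_into (total E) \<psi>"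

lemma \<psi>_bij: "bij_betw \<psi> (total E) (total AH)"
  and \<psi>_holo: "holo_map TE (total_mfd (torus L) AH) \<psi>"
  and \<psi>i_holo: "holo_map (total_mfd (torus L) AH) TE \<psi>i"
  and \<psi>_fiber: "z \<in> pts (torus L) \<Longrightarrow> fiber_iso E AH \<psi> z z"
  using iso unfolding bundle_iso_def by blast+

lemma \<psi>_in: "e \<in> total E \<Longrightarrow> \<psi> e \<in> total AH"
  using \<psi>_bij by (rule bij_betw_apply)

lemma \<psi>i_in: "S \<in> total AH \<Longrightarrow> \<psi>i S \<in> total E"
  using bij_betw_inv_into[OF \<psi>_bij] by (rule bij_betw_apply)

lemma \<psi>_\<psi>i: "S \<in> total AH \<Longrightarrow> \<psi> (\<psi>i S) = S"
  by (rule bij_betw_inv_into_right[OF \<psi>_bij])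

lemma \<psi>i_\<psi>: "e \<in> total E \<Longrightarrow> \<psi>i (\<psi> e) = e"
  by (rule bij_betw_inv_into_left[OF \<psi>_bij])

lemma \<psi>_inj: "a \<in> total E \<Longrightarrow> b \<in> total E \<Longrightarrow> \<psi> a = \<psi> b \<Longrightarrow> a = b"
  using \<psi>i_\<psi> by metis

lemma mem_fiber: "e \<in> total E \<Longrightarrow> e \<in> fiber E (bproj E e)"
  by (simp add: fiber_iff)

lemma bproj_\<psi>:
  assumes e: "e \<in> total E"
  shows "bproj AH (\<psi> e) = bproj E e"
proof -
  have "bij_betw \<psi> (fiber E (bproj E e)) (fiber AH (bproj E e))"
    using \<psi>_fiber[OF bproj_in[OF e]] by (simp add: fiber_iso_def)
  from bij_betw_apply[OF this mem_fiber[OF e]] show ?thesis by (simp add: fiber_iff)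
qed

lemma \<psi>_fadd: "z \<in> pts (torus L) \<Longrightarrow> a \<in> fiber E z \<Longrightarrow> b \<in> fiber E z \<Longrightarrow> \<psi> (fadd E a b) = fadd AH (\<psi> a) (\<psi> b)"
  and \<psi>_fsmul: "z \<in> pts (torus L) \<Longrightarrow> a \<in> fiber E z \<Longrightarrow> \<psi> (fsmul E c a) = fsmul AH c (\<psi> a)"
  using \<psi>_fiber unfolding fiber_iso_def by blast+

text \<open>Indexed by pairs (u, r) rather than by classes modulo the lattice, since the explicit
  formula lives there. Truncated to \<open>total E\<close> because elements of the group are
  extensional.\<close>

definition act :: "'v \<times> complex \<Rightarrow> 'e \<Rightarrow> 'e" where
  "act p = (\<lambda>e\<in>total E. \<psi>i (heis_map H p ` \<psi> e))"

lemma act_in: "p \<in> pts params \<Longrightarrow> e \<in> total E \<Longrightarrow> act p e \<in> total E"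
  by (simp add: act_def \<psi>i_in heis_map_in_total \<psi>_in del: prod_mfd_simps)

lemma \<psi>_act: "p \<in> pts params \<Longrightarrow> e \<in> total E \<Longrightarrow> \<psi> (act p e) = heis_map H p ` \<psi> e"
  by (simp add: act_def \<psi>_\<psi>i heis_map_in_total \<psi>_in del: prod_mfd_simps)

lemma holo_map_act: "holo_map (prod_mfd params TE) TE (\<lambda>(p, e). act p e)"
proof -
  note P = proper_charts_prod[OF proper_charts_params proper_charts_total_space]
  have "holo_map (prod_mfd params TE) (total_mfd (torus L) AH) (\<lambda>(p, e). heis_map H p ` \<psi> e)"
    using holo_map_compose_param[OF proper_charts_params proper_charts_total_space proper_charts_AH
      covered_AH \<psi>_holo holo_map_heis_orbits] by simp
  from holo_map_compose[OF P proper_charts_AH covered_AH this \<psi>i_holo]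
  show ?thesis by (rule holo_map_cong[OF P, rotated]) (auto simp: act_def)
qed

text \<open>Applying (u, r) and then (- u, s) multiplies the fibres by
  \<open>s * r * exp (- pi * H u u)\<close>; the second component solves for
  \<open>s\<close>.\<close>

definition inv_param :: "'v \<times> complex \<Rightarrow> 'v \<times> complex" where
  "inv_param = (\<lambda>(u, r). (- u, exp (of_real pi * H u u) / r))"

lemma inv_param_in: "p \<in> pts params \<Longrightarrow> inv_param p \<in> pts params"
  by (auto simp: inv_param_def perp_minus)

lemma inv_param_inv_param: "p \<in> pts params \<Longrightarrow> inv_param (inv_param p) = p"
  by (auto simp: inv_param_def H_minus_left H_minus_right)

lemma heis_map_inv_param:
  assumes p: "p \<in> pts params" and S: "S \<in> total AH"
  shows "heis_map H (inv_param p) ` heis_map H p ` S = S"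
proof -
  obtain u r where ur: "p = (u, r)" "u \<in> perp L H" "r \<noteq> 0" using p by auto
  obtain v c where vc: "S = orbit v c" using S by (auto simp: total_AH)
  have "exp (of_real pi * H u u) * (exp (of_real pi * H (v + u) (- u)) * exp (of_real pi * H v u)) =
      exp (of_real pi * H u u + (of_real pi * H (v + u) (- u) + of_real pi * H v u))"
    by (simp only: exp_add)
  also have "of_real pi * H u u + (of_real pi * H (v + u) (- u) + of_real pi * H v u) = 0"
    by (simp add: H_add_left H_minus_right algebra_simps)
  finally have "exp (of_real pi * H u u) / r * exp (of_real pi * H (v + u) (- u)) *
      (r * exp (of_real pi * H v u) * c) = c"
    using ur(3) by (simp add: field_simps)
  then show ?thesis
    by (simp add: vc ur(1) inv_param_def heis_map_orbit ur(2) perp_minus)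
qed

lemma act_inv_param:
  assumes p: "p \<in> pts params" and e: "e \<in> total E"
  shows "act (inv_param p) (act p e) = e"
  using inv_param_in[OF p] act_in[OF p e] \<psi>_in[OF e]
  by (intro \<psi>_inj act_in e) (simp_all add: \<psi>_act p e heis_map_inv_param del: prod_mfd_simps)

lemma bproj_act:
  assumes p: "(u, r) \<in> pts params" and e: "e \<in> total E"
  shows "bproj E (act (u, r) e) = translation (q u) (bproj E e)"
proof -
  obtain v c where vc: "\<psi> e = orbit v c" using \<psi>_in[OF e] by (auto simp: total_AH)
  have "bproj E (act (u, r) e) = bproj AH (heis_map H (u, r) ` \<psi> e)"
    using bproj_\<psi>[OF act_in[OF p e]] \<psi>_act[OF p e] by simp
  also have "\<dots> = translation (q u) (bproj AH (\<psi> e))"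
    using p by (simp add: vc heis_map_orbit bproj_AH translation_q)
  finally show ?thesis by (simp add: bproj_\<psi>[OF e])
qed

text \<open>Vectors of one fibre can be represented over a common point \<open>v\<close>, where the
  map multiplies them by a common factor.\<close>

lemma heis_map_fadd_fsmul:
  assumes p: "p \<in> pts params" and S: "S \<in> total AH" "T \<in> total AH" "bproj AH S = bproj AH T"
  shows "heis_map H p ` fadd AH S T = fadd AH (heis_map H p ` S) (heis_map H p ` T)"
    and "heis_map H p ` fsmul AH c S = fsmul AH c (heis_map H p ` S)"
proof -
  obtain u r where ur: "p = (u, r)" "u \<in> perp L H" using p by auto
  obtain v a where a: "S = orbit v a" using S(1) by (auto simp: total_AH)
  then obtain b where b: "T = orbit v b" using orbitE[OF S(2), of v] S(3) by (auto simp: bproj_AH)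
  show "heis_map H p ` fadd AH S T = fadd AH (heis_map H p ` S) (heis_map H p ` T)"
    by (simp add: a b ur heis_map_orbit fadd_AH distrib_left)
  show "heis_map H p ` fsmul AH c S = fsmul AH c (heis_map H p ` S)"
    by (simp add: a ur heis_map_orbit fsmul_AH mult_ac)
qed

text \<open>The inclusion of G(H,\<alpha>) into S(L), transported to \<open>E\<close>. Holomorphy of
  one element is a slice of the joint action, and the inverse is the element of the inverse
  parameter, hence covered as well.\<close>

lemma act_in_S_group:
  assumes p: "p \<in> pts params"
  shows "act p \<in> carrier (S_group L E)"
proof -
  obtain u r where ur: "p = (u, r)" using p by auto
  let ?p' = "inv_param p"
  have p': "?p' \<in> pts params" by (rule inv_param_in[OF p])
  have inv: "act ?p' (act p e) = e" "act p (act ?p' e) = e" if "e \<in> total E" for e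
    using act_inv_param[OF p that] act_inv_param[OF p' that] inv_param_inv_param[OF p] by simp_all
  have bij: "bij_betw (act p) (total E) (total E)"
    using inv act_in[OF p] act_in[OF p'] by (intro bij_betw_byWitness[where f' = "act ?p'"]) auto
  have holo: "holo_map TE TE (act p)" if "p \<in> pts params" for p
  proof -
    obtain W D \<phi> where "(W, D, \<phi>) \<in> charts params" "p \<in> D" using \<open>p \<in> pts params\<close> by (rule params_chart)
    from holo_map_slice[OF proper_charts_params proper_charts_total_space holo_map_act this]
    show ?thesis by simp
  qed
  have holo_inv: "holo_map TE TE (inv_into (total E) (act p))"
  proof (rule holo_map_cong[OF proper_charts_total_space _ holo[OF p']])
    fix e assume "e \<in> pts TE"
    then have e: "e \<in> total E" by simp
    show "act ?p' e = inv_into (total E) (act p) e"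
      using bij_betw_inv_into_left[OF bij act_in[OF p' e]] inv(2)[OF e] by simp
  qed
  have base: "bproj E (act p e) = translation (q u) (bproj E e)" if "e \<in> total E" for e
    using bproj_act[OF p[unfolded ur] that] ur by simp
  have base': "bproj E (act ?p' e) = translation (q (- u)) (bproj E e)" if "e \<in> total E" for e
    using bproj_act[OF p'[unfolded ur inv_param_def prod.case] that] by (simp add: ur inv_param_def)
  have fib: "fiber_iso E E (act p) z (translation (q u) z)" if z: "z \<in> pts (torus L)" for z
  proof -
    obtain v where v: "z = q v" using z by (auto simp: pts_torus)
    have pull: "translation (q (- u)) (translation (q u) z) = z" by (simp add: v translation_q)
    have "bij_betw (act p) (fiber E z) (fiber E (translation (q u) z))"
      using inv act_in[OF p] act_in[OF p'] base base' pull
      by (intro bij_betw_byWitness[where f' = "act ?p'"]) (auto simp: fiber_iff)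
    moreover have "act p (fadd E a b) = fadd E (act p a) (act p b) \<and> act p (fsmul E c a) = fsmul E c (act p a)"
      if ab: "a \<in> fiber E z" "b \<in> fiber E z" for a b c
    proof -
      have t: "a \<in> total E" "b \<in> total E" "bproj E a = z" "bproj E b = z" using ab by (auto simp: fiber_iff)
      let ?z = "translation (q u) z"
      have z': "?z \<in> pts (torus L)" by (auto simp: v translation_q pts_torus)
      have fab: "act p a \<in> fiber E ?z" "act p b \<in> fiber E ?z"
        using t act_in[OF p] base by (auto simp: fiber_iff)
      have sum: "fadd E x y \<in> total E" if "x \<in> fiber E y'" "y \<in> fiber E y'" "y' \<in> pts (torus L)" for x y y'
        using fadd_in[OF that] by (simp add: fiber_iff)
      \<comment> \<open>Linearity is tested after applying the injective map \<open>\<psi>\<close>,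
        under which the action becomes explicit.\<close>
      have "\<psi> (act p (fadd E a b)) = heis_map H p ` fadd AH (\<psi> a) (\<psi> b)"
        using \<psi>_act[OF p sum[OF ab z]] \<psi>_fadd[OF z ab] by simp
      also have "\<dots> = fadd AH (\<psi> (act p a)) (\<psi> (act p b))"
        using heis_map_fadd_fsmul(1)[OF p \<psi>_in[OF t(1)] \<psi>_in[OF t(2)]]
        by (simp add: bproj_\<psi> \<psi>_act[OF p] t)
      also have "\<dots> = \<psi> (fadd E (act p a) (act p b))" using \<psi>_fadd[OF z' fab] by simp
      finally have add: "act p (fadd E a b) = fadd E (act p a) (act p b)"
        by (intro \<psi>_inj act_in[OF p] sum[OF ab z] sum[OF fab z'])
      have "\<psi> (act p (fsmul E c a)) = heis_map H p ` fsmul AH c (\<psi> a)"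
        using \<psi>_act[OF p fsmul_in(1)[OF t(1)]] \<psi>_fsmul[OF z ab(1)] by simp
      also have "\<dots> = fsmul AH c (\<psi> (act p a))"
        using heis_map_fadd_fsmul(2)[OF p \<psi>_in[OF t(1)] \<psi>_in[OF t(1)]] by (simp add: \<psi>_act[OF p t(1)])
      also have "\<dots> = \<psi> (fsmul E c (act p a))" using \<psi>_fsmul[OF z' fab(1)] by simp
      finally have "act p (fsmul E c a) = fsmul E c (act p a)"
        by (intro \<psi>_inj act_in[OF p] fsmul_in(1) t)
      with add show ?thesis ..
    qed
    ultimately show ?thesis by (simp add: fiber_iso_def)
  qed
  have "act p \<in> extensional (total E)" by (simp add: act_def)
  then have "act p \<in> carrier (Aut TE)"
    using bij holo[OF p] holo_inv by (simp add: Aut_def Bij_def)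
  then show ?thesis
    using base fib by (auto simp: S_group_def pts_torus)
qed

text \<open>Conjugation in the direction opposite to \<open>conj_map E AH \<psi>\<close>, to be
  inverse to it.\<close>

definition pull :: "(('v \<times> complex) set \<Rightarrow> ('v \<times> complex) set) \<Rightarrow> 'e \<Rightarrow> 'e" where
  "pull g = (\<lambda>e\<in>total E. \<psi>i (g (\<psi> e)))"

abbreviation "orbit_map p \<equiv> \<lambda>S\<in>total AH. heis_map H p ` S"

lemma pull_orbit_map: "pull (orbit_map p) = act p"
  by (simp add: pull_def act_def \<psi>_in cong: restrict_cong)

lemma pts_heis: "pts (heis_mfd L H \<alpha>) = orbit_map ` pts params"
  by (simp add: heis_mfd_def heis_tilde_mfd_def image_image)

lemma proper_charts_heis: "proper_charts (heis_mfd L H \<alpha>)"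
  unfolding heis_mfd_def heis_tilde_mfd_def
  by (intro proper_charts_push proper_charts_params)

lemma pull_in_S_group: "g \<in> pts (heis_mfd L H \<alpha>) \<Longrightarrow> pull g \<in> carrier (S_group L E)"
  using act_in_S_group by (auto simp: pts_heis pull_orbit_map simp del: prod_mfd_simps)

text \<open>Together with \<open>pull_conj_map\<close> it identifies the domain of a chart of
  \<open>S_mfd\<close> with the domain of the chart of \<open>heis_mfd\<close> from which it is
  built.\<close>

lemma conj_map_pull:
  assumes "g \<in> pts (heis_mfd L H \<alpha>)"
  shows "conj_map E AH \<psi> (pull g) = g"
proof -
  obtain p where p: "p \<in> pts params" "g = orbit_map p" using assms by (auto simp: pts_heis simp del: prod_mfd_simps)
  show ?thesis
    unfolding p(2) pull_orbit_map conj_map_def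
    by (rule restrict_ext) (simp add: \<psi>_act[OF p(1)] \<psi>i_in \<psi>_\<psi>i)
qed

lemma pull_conj_map:
  assumes "u \<in> carrier (S_group L E)"
  shows "pull (conj_map E AH \<psi> u) = u"
proof (rule extensionalityI[of _ "total E"])
  show "pull (conj_map E AH \<psi> u) \<in> extensional (total E)" by (simp add: pull_def)
  show "u \<in> extensional (total E)" by (rule Bij_imp_extensional[OF S_groupD(1)[OF assms]])
  fix e assume e: "e \<in> total E"
  then have "u e \<in> total E" using S_groupD(4)[OF assms] by (simp add: fibre_linear_def)
  then show "pull (conj_map E AH \<psi> u) e = u e"
    using e by (simp add: pull_def conj_map_def \<psi>_in \<psi>i_\<psi>)
qed

text \<open>The action on \<open>E\<close> descends in two stages, from parameters to maps of V x C
  and from these to maps of orbits, each by the universal property of \<open>push_mfd\<close>; after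
  that the passage to lines applies to the resulting family.\<close>

lemma holo_map_heis_Y:
  "holo_map (prod_mfd (heis_mfd L H \<alpha>) Y) Y (\<lambda>(g, y). proj_lift (torus L) E (pull g) y)"
proof (rule holo_map_proj_lift[OF proper_charts_heis])
  show "fibre_linear E (pull g)" if "g \<in> pts (heis_mfd L H \<alpha>)" for g
    by (rule S_groupD(4)[OF pull_in_S_group[OF that]])
  show "holo_map (prod_mfd (heis_mfd L H \<alpha>) TE) TE (\<lambda>(g, e). pull g e)"
    unfolding heis_mfd_def heis_tilde_mfd_def
    by (intro holo_map_push_prod proper_charts_push proper_charts_params proper_charts_total_space)
       (simp add: pull_orbit_map holo_map_act)
qed

end

text \<open>Each chart of \<open>S_mfd\<close> brings its own \<open>H\<close>,
  \<open>\<alpha>\<close> and \<open>\<psi>\<close>, so the transport is instantiated chart by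
  chart. In that chart the action has the same coordinate expression as the action of
  \<open>heis_mfd\<close> through \<open>pull\<close>.\<close>

theorem (in torus_bundle) holo_map_S_action:
  "holo_map (prod_mfd (S_mfd L E) Y) Y (\<lambda>(u, y). proj_lift (torus L) E u y)"
proof (rule holo_mapI_expression)
  let ?f = "\<lambda>(u, y). proj_lift (torus L) E u y"
  have chart: "\<exists>H \<alpha> \<psi> D0 \<phi>0. trivialized_torus_bundle L E H \<alpha> \<psi> \<and> (W, D0, \<phi>0) \<in> charts (heis_mfd L H \<alpha>) \<and>
      D = {u \<in> carrier (S_group L E). conj_map E (AH_bundle L H \<alpha>) \<psi> u \<in> D0} \<and>
      \<phi> = (\<lambda>u. \<phi>0 (conj_map E (AH_bundle L H \<alpha>) \<psi> u))"
    if c: "(W, D, \<phi>) \<in> charts (S_mfd L E)" for W D \<phi>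
  proof -
    obtain H \<alpha> \<psi> D0 \<phi>0 where *: "AH_data L H \<alpha>" "bundle_iso (torus L) E (AH_bundle L H \<alpha>) \<psi>"
      "(W, D0, \<phi>0) \<in> charts (heis_mfd L H \<alpha>)"
      "D = {u \<in> carrier (S_group L E). conj_map E (AH_bundle L H \<alpha>) \<psi> u \<in> D0}"
      "\<phi> = (\<lambda>u. \<phi>0 (conj_map E (AH_bundle L H \<alpha>) \<psi> u))"
      using c unfolding S_mfd_def by auto
    have "trivialized_torus_bundle L E H \<alpha> \<psi>"
      by unfold_locales (rule *)+
    then show ?thesis using * by blast
  qed
  \<comment> \<open>\<open>pull\<close> recovers an element from its conjugate, so injectivity is
    inherited from the charts of \<open>heis_mfd\<close>.\<close>
  have inj_S: "inj_on \<phi> D" if c: "(W, D, \<phi>) \<in> charts (S_mfd L E)" for W D \<phi>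
  proof -
    obtain H \<alpha> \<psi> D0 \<phi>0 where t: "trivialized_torus_bundle L E H \<alpha> \<psi>"
      and *: "(W, D0, \<phi>0) \<in> charts (heis_mfd L H \<alpha>)"
      "D = {u \<in> carrier (S_group L E). conj_map E (AH_bundle L H \<alpha>) \<psi> u \<in> D0}"
      "\<phi> = (\<lambda>u. \<phi>0 (conj_map E (AH_bundle L H \<alpha>) \<psi> u))"
      using chart[OF c] by blast
    interpret t: trivialized_torus_bundle L E H \<alpha> \<psi> by (rule t)
    show ?thesis
    proof (rule inj_onI)
      fix u v assume uv: "u \<in> D" "v \<in> D" "\<phi> u = \<phi> v"
      then have eq: "conj_map E (AH_bundle L H \<alpha>) \<psi> u = conj_map E (AH_bundle L H \<alpha>) \<psi> v"
        using proper_chartsD(2)[OF t.proper_charts_heis *(1)] by (auto simp: *(2,3) inj_on_eq_iff)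
      have S: "u \<in> carrier (S_group L E)" "v \<in> carrier (S_group L E)" using uv by (simp_all add: *(2))
      show "u = v" using t.pull_conj_map[OF S(2)] unfolding eq[symmetric] t.pull_conj_map[OF S(1)] .
    qed
  qed
  show "inj_on \<kappa> C" if "(V, C, \<kappa>) \<in> charts (prod_mfd (S_mfd L E) Y)" for V C \<kappa>
    using that by (rule prod_mfd_chartE) (auto intro!: map_prod_inj_on inj_S proper_chartsD(2)[OF proper_charts_Y])
  show "?f \<in> pts (prod_mfd (S_mfd L E) Y) \<rightarrow> pts Y"
    using proj_lift_in S_groupD(4) by (auto simp: S_mfd_def)
  fix V C \<kappa> V' C' \<kappa>' p
  assume c0: "(V, C, \<kappa>) \<in> charts (prod_mfd (S_mfd L E) Y)" and c': "(V', C', \<kappa>') \<in> charts Y"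
    and p: "p \<in> C" "?f p \<in> C'"
  from c0 obtain W D \<phi> V2 C2 \<kappa>2 where c1: "(W, D, \<phi>) \<in> charts (S_mfd L E)" "(V2, C2, \<kappa>2) \<in> charts Y"
    and eqs: "V = W \<times> V2" "C = D \<times> C2" "\<kappa> = map_prod \<phi> \<kappa>2" by (rule prod_mfd_chartE)
  obtain H \<alpha> \<psi> D0 \<phi>0 where t: "trivialized_torus_bundle L E H \<alpha> \<psi>"
    and *: "(W, D0, \<phi>0) \<in> charts (heis_mfd L H \<alpha>)"
    "D = {u \<in> carrier (S_group L E). conj_map E (AH_bundle L H \<alpha>) \<psi> u \<in> D0}"
    "\<phi> = (\<lambda>u. \<phi>0 (conj_map E (AH_bundle L H \<alpha>) \<psi> u))"
    using chart[OF c1(1)] by blast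
  interpret t: trivialized_torus_bundle L E H \<alpha> \<psi> by (rule t)
  let ?c = "conj_map E (AH_bundle L H \<alpha>) \<psi>"
  let ?F = "\<lambda>(g, y). proj_lift (torus L) E (t.pull g) y"
  note d0 = proper_chartsD[OF t.proper_charts_heis *(1)] and dY = proper_chartsD[OF proper_charts_Y c1(2)]
  note F = holo_mapD[OF t.holo_map_heis_Y prod_mfd_chartI[OF *(1) c1(2)] c']
  \<comment> \<open>The domain of the coordinate expression for \<open>heis_mfd\<close>; each of its
    points is the coordinate of some \<open>t.pull g\<close>, which lies in S(L).\<close>
  let ?Q = "map_prod \<phi>0 \<kappa>2 ` (D0 \<times> C2 \<inter> ?F -` C')"
  let ?R = "\<kappa>' \<circ> ?F \<circ> inv_into (D0 \<times> C2) (map_prod \<phi>0 \<kappa>2)"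
  have "\<exists>x\<in>C. ?f x \<in> C' \<and> z = \<kappa> x \<and> \<kappa>' (?f x) = ?R z" if z: "z \<in> ?Q" for z
  proof -
    obtain g y where g: "g \<in> D0" "y \<in> C2" "?F (g, y) \<in> C'" "z = (\<phi>0 g, \<kappa>2 y)" using z by auto
    have "g \<in> pts (heis_mfd L H \<alpha>)" using d0(1) g(1) by blast
    then have b: "t.pull g \<in> carrier (S_group L E)" "?c (t.pull g) = g"
      by (rule t.pull_in_S_group, rule t.conj_map_pull)
    have "?R z = \<kappa>' (?F (g, y))" using g d0(2) dY(2) by (simp add: inv_into_map_prod)
    then show ?thesis
      using b g by (intro bexI[of _ "(t.pull g, y)"]) (auto simp: eqs *(2,3))
  qed
  moreover have "\<kappa> p \<in> ?Q"
  proof -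
    obtain u y where uy: "p = (u, y)" "u \<in> carrier (S_group L E)" "?c u \<in> D0" "y \<in> C2"
      using p(1) by (auto simp: eqs *(2))
    then show ?thesis
      using p(2) t.pull_conj_map[OF uy(2)] by (intro image_eqI[of _ _ "(?c u, y)"]) (auto simp: eqs *(3))
  qed
  ultimately show "\<exists>Q R. openin (top_of_set V) Q \<and> \<kappa> p \<in> Q \<and> holo_on R Q \<and>
      (\<forall>z\<in>Q. \<exists>x\<in>C. ?f x \<in> C' \<and> z = \<kappa> x \<and> \<kappa>' (?f x) = R z)"
    using F unfolding eqs(1) by (intro exI[of _ ?Q] exI[of _ ?R] conjI ballI)
qed

theorem theorem1p7:
  fixes L :: "'v::fin_dim_complex_vector set"
    and E :: "('e, 'v set, complex) vbundle"
  assumes "torus_lattice L"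
    and "holomorphic_line_bundle (torus L) E"
  shows "\<exists>\<Upsilon>. \<Upsilon> \<in> mon (S_group L E) (Aut (Y_mfd L E)) \<and>
    holo_map (prod_mfd (S_mfd L E) (Y_mfd L E)) (Y_mfd L E) (\<lambda>(u, y). \<Upsilon> u y) \<and>
    (\<forall>u\<in>carrier (S_group L E). \<forall>y\<in>pts (Y_mfd L E).
       Y_proj L E (\<Upsilon> u y) = translation (rho L E u) (Y_proj L E y))"
proof -
  interpret torus_bundle L E by unfold_locales (rule assms)+
  show ?thesis
    unfolding Y_mfd_def Y_proj_def Y_bundle_def
    using proj_lift_mon holo_map_S_action proj_base_proj_lift
    by (intro exI[of _ "proj_lift (torus L) E"] conjI ballI)
qed

end
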